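(* The effective topos $\mathcal{E}\!\mathit{ff}$ is Hilbertian.
   Context: **Hilbertian topos.** An elementary topos $\mathcal{E}$ (with terminal object $1$) is Hilbertian if for every object $A$ such that $A\to 1$ is epic and every monomorphism $p:X\rightarrowtail A$ there are an object $U$, an epimorphism $X\twoheadrightarrow U$, a monomorphism $U\rightarrowtail 1$ (so that $X\twoheadrightarrow U\rightarrowtail 1$ is the epi-mono factorization of $X\to 1$), an arrow $u:U\to X$ and an arrow $\varepsilon_p:1\to A$ such that $p\circ u$ equals the composite $U\rightarrowtail 1\xrightarrow{\varepsilon_p}A$. **Kleene realizability order.** For natural numbers $n,p$, write $n.p$ for the Kleene application, i.e. the (possibly undefined) value at $p$ of the partial recursive function coded by $n$. For a set $X$ and $\phi,\psi:X\to\mathcal{P}(\mathbb{N})$, put $\phi\le\psi$ iff there is a number $n$ such that for every $x\in X$ and every $a\in\phi(x)$, $n.a$ is defined and $n.a\in\psi(x)$. This is a preorder on $\mathcal{P}(\mathbb{N})^X$ whose poset reflection is a Heyting algebra. The Heyting operations are represented pointwise by: for $S,T\subseteq\mathbb{N}$, $S\wedge T=\{\langle m,n\rangle : m\in S, n\in T\}$ for a fixed recursive pairing bijection $\langle\cdot,\cdot\rangle$, and $S\rightarrow T=\{e : \text{for all } m\in S,\ e.m \text{ is defined and } e.m\in T\}$. The top element $\top_X$ is constantly $\mathbb{N}$. A sentence is an element $\phi\in\mathcal{P}(\mathbb{N})\cong\mathcal{P}(\mathbb{N})^1$ ($1$ a singleton); it is valid if $\top_1\le\phi$, i.e. $\phi\ne\emptyset$.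 **The effective topos $\mathcal{E}\!\mathit{ff}$.** Objects are pairs $(A,\rho)$ with $A$ a set and $\rho\in\mathcal{P}(\mathbb{N})^{A\times A}$ a partial equivalence relation, meaning that the sentences $\bigcap_{x,y\in A}(\rho(x,y)\rightarrow\rho(y,x))$ and $\bigcap_{x,y,z\in A}(\rho(x,y)\wedge\rho(y,z)\rightarrow\rho(x,z))$ are valid. A functional relation from $(A,\rho)$ to $(B,\sigma)$ is an $F\in\mathcal{P}(\mathbb{N})^{A\times B}$ such that the following sentences are valid: $$\bigcap_{a\in A}\bigcap_{b\in B}\bigl(F(a,b)\rightarrow\rho(a,a)\wedge\sigma(b,b)\bigr),$$ $$\bigcap_{a,a'\in A}\bigcap_{b,b'\in B}\bigl(F(a,b)\wedge\rho(a,a')\wedge\sigma(b,b')\rightarrow F(a',b')\bigr),$$ $$\bigcap_{a\in A}\bigcap_{b,b'\in B}\bigl(F(a,b)\wedge F(a,b')\rightarrow\sigma(b,b')\bigr),$$ $$\bigcap_{a\in A}\Bigl(\rho(a,a)\rightarrow\bigcup_{b\in B}F(a,b)\Bigr).$$ An arrow $(A,\rho)\to(B,\sigma)$ is an equivalence class $[F]$ of functional relations, where $G\in[F]$ iff $G=F$ in the poset reflection of $\mathcal{P}(\mathbb{N})^{A\times B}$ (i.e. $F\le G$ and $G\le F$). Composition is relational: $(G\circ F)(a,c)=\bigcup_{b\in B}F(a,b)\wedge G(b,c)$, and the identity on $(A,\rho)$ is $[\rho]$. The terminal object is $(1,\top_{1\times1})$. *)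

theory Defs
  imports "HOL-Library.Nat_Bijection" "HOL-Library.FuncSet" "HOL-Library.Equipollence"
begin

section \<open>Categories and elementary toposes\<close>

record ('o, 'm) cat =
  Obj :: "'o set"
  Arr :: "'m set"
  Dom :: "'m \<Rightarrow> 'o"
  Cod :: "'m \<Rightarrow> 'o"
  Id :: "'o \<Rightarrow> 'm"
  Comp :: "'m \<Rightarrow> 'm \<Rightarrow> 'm"  (infixl "\<odot>\<index>" 70)

definition hom :: "('o, 'm) cat \<Rightarrow> 'o \<Rightarrow> 'o \<Rightarrow> 'm set" where
  "hom C a b = {f \<in> Arr C. Dom C f = a \<and> Cod C f = b}"

locale category =
  fixes C :: "('o, 'm) cat" (structure)
  assumes dom_obj: "f \<in> Arr C \<Longrightarrow> Dom C f \<in> Obj C"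
    and cod_obj: "f \<in> Arr C \<Longrightarrow> Cod C f \<in> Obj C"
    and id_hom: "a \<in> Obj C \<Longrightarrow> Id C a \<in> hom C a a"
    and comp_hom: "f \<in> hom C a b \<Longrightarrow> g \<in> hom C b c \<Longrightarrow> g \<odot> f \<in> hom C a c"
    and id_left: "f \<in> hom C a b \<Longrightarrow> Id C b \<odot> f = f"
    and id_right: "f \<in> hom C a b \<Longrightarrow> f \<odot> Id C a = f"
    and comp_assoc: "f \<in> hom C a b \<Longrightarrow> g \<in> hom C b c \<Longrightarrow> h \<in> hom C c d
                     \<Longrightarrow> h \<odot> (g \<odot> f) = (h \<odot> g) \<odot> f"

definition monic :: "('o, 'm) cat \<Rightarrow> 'm \<Rightarrow> bool" where
  "monic C m \<longleftrightarrow> m \<in> Arr C \<and>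
     (\<forall>z \<in> Obj C. \<forall>f \<in> hom C z (Dom C m). \<forall>g \<in> hom C z (Dom C m).
        m \<odot>\<^bsub>C\<^esub> f = m \<odot>\<^bsub>C\<^esub> g \<longrightarrow> f = g)"

definition epic :: "('o, 'm) cat \<Rightarrow> 'm \<Rightarrow> bool" where
  "epic C e \<longleftrightarrow> e \<in> Arr C \<and>
     (\<forall>z \<in> Obj C. \<forall>f \<in> hom C (Cod C e) z. \<forall>g \<in> hom C (Cod C e) z.
        f \<odot>\<^bsub>C\<^esub> e = g \<odot>\<^bsub>C\<^esub> e \<longrightarrow> f = g)"

definition terminal :: "('o, 'm) cat \<Rightarrow> 'o \<Rightarrow> bool" where
  "terminal C t \<longleftrightarrow> t \<in> Obj C \<and> (\<forall>a \<in> Obj C. \<exists>!f. f \<in> hom C a t)"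

definition product :: "('o, 'm) cat \<Rightarrow> 'o \<Rightarrow> 'o \<Rightarrow> 'o \<Rightarrow> 'm \<Rightarrow> 'm \<Rightarrow> bool" where
  "product C a b s p q \<longleftrightarrow> p \<in> hom C s a \<and> q \<in> hom C s b \<and>
     (\<forall>z \<in> Obj C. \<forall>f \<in> hom C z a. \<forall>g \<in> hom C z b.
        \<exists>!h. h \<in> hom C z s \<and> p \<odot>\<^bsub>C\<^esub> h = f \<and> q \<odot>\<^bsub>C\<^esub> h = g)"

text \<open>
  \<open>pullback C f g s p q\<close>: the square \<open>f \<odot> p = g \<odot> q\<close> with corner \<open>s\<close>
  (so \<open>p\<close> lies opposite to \<open>g\<close>, and is the pullback of \<open>g\<close> along \<open>f\<close>) is a pullback.
\<close>

definition pullback :: "('o, 'm) cat \<Rightarrow> 'm \<Rightarrow> 'm \<Rightarrow> 'o \<Rightarrow> 'm \<Rightarrow> 'm \<Rightarrow> bool" where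
  "pullback C f g s p q \<longleftrightarrow>
     f \<in> Arr C \<and> g \<in> Arr C \<and> Cod C f = Cod C g \<and>
     p \<in> hom C s (Dom C f) \<and> q \<in> hom C s (Dom C g) \<and> f \<odot>\<^bsub>C\<^esub> p = g \<odot>\<^bsub>C\<^esub> q \<and>
     (\<forall>z \<in> Obj C. \<forall>p' \<in> hom C z (Dom C f). \<forall>q' \<in> hom C z (Dom C g).
        f \<odot>\<^bsub>C\<^esub> p' = g \<odot>\<^bsub>C\<^esub> q' \<longrightarrow>
        (\<exists>!h. h \<in> hom C z s \<and> p \<odot>\<^bsub>C\<^esub> h = p' \<and> q \<odot>\<^bsub>C\<^esub> h = q'))"

text \<open>
  \<open>P\<close> with the monomorphism \<open>m : E \<rightarrow> a \<times> P\<close> is a power object of \<open>a\<close>: every monomorphism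
  \<open>r : R \<rightarrow> a \<times> i\<close> is the pullback of \<open>m\<close> along \<open>h = id \<times> \<chi>\<close> for exactly one \<open>\<chi> : i \<rightarrow> P\<close>.
  Here \<open>(S, s1, s2)\<close> is a product of \<open>a\<close> and \<open>P\<close>, and \<open>(T, t1, t2)\<close> a product of \<open>a\<close> and \<open>i\<close>.
\<close>

definition power_object :: "('o, 'm) cat \<Rightarrow> 'o \<Rightarrow> 'o \<Rightarrow> 'o \<Rightarrow> 'm \<Rightarrow> 'm \<Rightarrow> 'm \<Rightarrow> bool" where
  "power_object C a P S s1 s2 m \<longleftrightarrow>
     product C a P S s1 s2 \<and> monic C m \<and> Cod C m = S \<and>
     (\<forall>i T t1 t2 r. product C a i T t1 t2 \<and> monic C r \<and> Cod C r = T \<longrightarrow>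
        (\<exists>!\<chi>. \<chi> \<in> hom C i P \<and>
           (\<exists>h k. h \<in> hom C T S \<and> s1 \<odot>\<^bsub>C\<^esub> h = t1 \<and> s2 \<odot>\<^bsub>C\<^esub> h = \<chi> \<odot>\<^bsub>C\<^esub> t2 \<and>
                  pullback C h m (Dom C r) r k)))"

text \<open>
  Finite limits (a terminal object and pullbacks) together with power objects.
\<close>

definition elementary_topos :: "('o, 'm) cat \<Rightarrow> bool" where
  "elementary_topos C \<longleftrightarrow> category C \<and>
     (\<exists>t. terminal C t) \<and>
     (\<forall>f \<in> Arr C. \<forall>g \<in> Arr C. Cod C f = Cod C g \<longrightarrow> (\<exists>s p q. pullback C f g s p q)) \<and>
     (\<forall>a \<in> Obj C. \<exists>P S s1 s2 m. power_object C a P S s1 s2 m)"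

text \<open>
  The terminal object \<open>t\<close> ranges over all terminal objects. Since \<open>t\<close> is terminal,
  \<open>i \<odot> e\<close> below is automatically the epi-mono factorization of the arrow from \<open>X\<close> to \<open>t\<close>.
\<close>

definition hilbertian_topos :: "('o, 'm) cat \<Rightarrow> bool" where
  "hilbertian_topos C \<longleftrightarrow> elementary_topos C \<and>
     (\<forall>t A X b p. terminal C t \<and> b \<in> hom C A t \<and> epic C b \<and> p \<in> hom C X A \<and> monic C p \<longrightarrow>
        (\<exists>U e i u \<epsilon>. e \<in> hom C X U \<and> epic C e \<and> i \<in> hom C U t \<and> monic C i \<and>
           u \<in> hom C U X \<and> \<epsilon> \<in> hom C t A \<and> p \<odot>\<^bsub>C\<^esub> u = \<epsilon> \<odot>\<^bsub>C\<^esub> i))"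

section \<open>Partial recursive functions and Kleene application\<close>

text \<open>
  Programs for unary partial recursive functions; several arguments are passed through
  the Cantor pairing \<^const>\<open>prod_encode\<close>.
\<close>

datatype program =
    Zero | Succ | Fst | Snd
  | Pairing program program
  | Compose program program
  | PrimRec program program
  | Mu program

text \<open>
  \<^const>\<open>None\<close> means undefined. The program \<open>PrimRec f g\<close> computes \<open>h\<close> with \<open>h(a, 0) = f(a)\<close> and
  \<open>h(a, n + 1) = g(a, (n, h(a, n)))\<close>, and \<open>Mu f\<close> computes from \<open>x\<close> the least \<open>n\<close> with
  \<open>f(x, n) = 0\<close>, which requires \<open>f(x, i)\<close> to be defined for all \<open>i < n\<close>.
\<close>

primrec run :: "program \<Rightarrow> nat \<Rightarrow> nat option" where
  "run Zero x = Some 0"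
| "run Succ x = Some (Suc x)"
| "run Fst x = Some (fst (prod_decode x))"
| "run Snd x = Some (snd (prod_decode x))"
| "run (Pairing f g) x =
     Option.bind (run f x) (\<lambda>a. Option.bind (run g x) (\<lambda>b. Some (prod_encode (a, b))))"
| "run (Compose f g) x = Option.bind (run g x) (run f)"
| "run (PrimRec f g) x =
     (let (a, k) = prod_decode x in
      rec_nat (run f a)
        (\<lambda>n r. Option.bind r (\<lambda>y. run g (prod_encode (a, prod_encode (n, y))))) k)"
| "run (Mu f) x =
     (if \<exists>n. run f (prod_encode (x, n)) = Some 0 \<and>
             (\<forall>i<n. run f (prod_encode (x, i)) \<noteq> None)
      then Some (LEAST n. run f (prod_encode (x, n)) = Some 0)
      else None)"

primrec godel :: "program \<Rightarrow> nat" where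
  "godel Zero = 0"
| "godel Succ = 1"
| "godel Fst = 2"
| "godel Snd = 3"
| "godel (Pairing f g) = 4 * prod_encode (godel f, godel g) + 4"
| "godel (Compose f g) = 4 * prod_encode (godel f, godel g) + 5"
| "godel (PrimRec f g) = 4 * prod_encode (godel f, godel g) + 6"
| "godel (Mu f) = 4 * godel f + 7"

lemma inj_godel: "inj godel"
proof (rule injI)
  fix f g
  show "godel f = godel g \<Longrightarrow> f = g"
  proof (induction f arbitrary: g)
    case Zero then show ?case by (cases g) auto
  next
    case Succ then show ?case by (cases g) auto
  next
    case Fst then show ?case by (cases g) auto
  next
    case Snd then show ?case by (cases g) auto
  next
    case (Pairing f1 f2) then show ?case by (cases g) (auto, presburger+)
  next
    case (Compose f1 f2) then show ?case by (cases g) (auto, presburger+)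
  next
    case (PrimRec f1 f2) then show ?case by (cases g) (auto, presburger+)
  next
    case (Mu f1) then show ?case by (cases g) (auto, presburger+)
  qed
qed

lemma surj_godel: "surj godel"
proof -
  have "\<exists>f. godel f = n" for n
  proof (induction n rule: less_induct)
    case (less n)
    show ?case
    proof (cases "n < 4")
      case True
      then consider "n = 0" | "n = 1" | "n = 2" | "n = 3" by linarith
      then show ?thesis by cases (metis godel.simps)+
    next
      case False
      define k where "k = (n - 4) div 4"
      obtain a b where ab: "k = prod_encode (a, b)" by (metis prod_decode_inverse surj_pair)
      have "k < n" using False unfolding k_def by linarith
      moreover have "a \<le> k" "b \<le> k" unfolding ab by (rule le_prod_encode_1, rule le_prod_encode_2)
      ultimately obtain f g h where "godel f = a" "godel g = b" "godel h = k"
        using less.IH by (meson le_less_trans)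
      moreover have "n = 4 * k + 4 \<or> n = 4 * k + 5 \<or> n = 4 * k + 6 \<or> n = 4 * k + 7"
        using False unfolding k_def by presburger
      ultimately show ?thesis using ab by (metis godel.simps(5-8))
    qed
  qed
  then show ?thesis by (metis surjI)
qed

lemma bij_godel: "bij godel"
  using inj_godel surj_godel by (rule bijI)

definition kleene_app :: "nat \<Rightarrow> nat \<Rightarrow> nat option" where
  "kleene_app n p = run (inv godel n) p"

section \<open>The realizability order\<close>

definition realizes_le :: "'x set \<Rightarrow> ('x \<Rightarrow> nat set) \<Rightarrow> ('x \<Rightarrow> nat set) \<Rightarrow> bool" where
  "realizes_le X \<phi> \<psi> \<longleftrightarrow> (\<exists>n. \<forall>x\<in>X. \<forall>a\<in>\<phi> x. \<exists>y\<in>\<psi> x. kleene_app n a = Some y)"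

definition conj_r :: "nat set \<Rightarrow> nat set \<Rightarrow> nat set"  (infixr "\<sqinter>\<^sub>r" 70) where
  "S \<sqinter>\<^sub>r T = {prod_encode (m, n) | m n. m \<in> S \<and> n \<in> T}"

definition imp_r :: "nat set \<Rightarrow> nat set \<Rightarrow> nat set"  (infixr "\<rightarrow>\<^sub>r" 60) where
  "S \<rightarrow>\<^sub>r T = {e. \<forall>m\<in>S. \<exists>y\<in>T. kleene_app e m = Some y}"

definition valid :: "nat set \<Rightarrow> bool" where
  "valid \<phi> \<longleftrightarrow> \<phi> \<noteq> {}"

section \<open>The effective topos\<close>

text \<open>
  In HOL, the sets of the category have to be taken from some type \<open>'u\<close>, and no category
  of carriers inside one type is closed under power sets unless the type is large. The sets
  are therefore taken to be the subsets of \<open>'u\<close> of cardinality less than that of \<open>'u\<close> itself,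
  where the cardinality of \<open>'u\<close> is an uncountable strong limit. Elements of carriers serve
  only as labels: every set whose cardinality is less than that of \<open>'u\<close> is in bijection
  with one of these subsets.
\<close>

definition set_universe :: "'u itself \<Rightarrow> bool" where
  "set_universe _ \<longleftrightarrow>
     (UNIV :: nat set) \<prec> (UNIV :: 'u set) \<and>
     (\<forall>A :: 'u set. A \<prec> (UNIV :: 'u set) \<longrightarrow> Pow A \<prec> (UNIV :: 'u set))"

type_synonym 'u eff_obj = "'u set \<times> ('u \<times> 'u \<Rightarrow> nat set)"

text \<open>
  The exponent \<open>P(N)\<^sup>X\<close> is the extensional function space \<open>X \<rightarrow>\<^sub>E UNIV\<close>.
\<close>

definition partial_equivalence :: "'u set \<Rightarrow> ('u \<times> 'u \<Rightarrow> nat set) \<Rightarrow> bool" where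
  "partial_equivalence A \<rho> \<longleftrightarrow>
     \<rho> \<in> A \<times> A \<rightarrow>\<^sub>E UNIV \<and>
     valid (\<Inter>x\<in>A. \<Inter>y\<in>A. \<rho> (x, y) \<rightarrow>\<^sub>r \<rho> (y, x)) \<and>
     valid (\<Inter>x\<in>A. \<Inter>y\<in>A. \<Inter>z\<in>A. \<rho> (x, y) \<sqinter>\<^sub>r \<rho> (y, z) \<rightarrow>\<^sub>r \<rho> (x, z))"

definition eff_objects :: "'u eff_obj set" where
  "eff_objects = {(A, \<rho>). A \<prec> (UNIV :: 'u set) \<and> partial_equivalence A \<rho>}"

text \<open>
  A threefold conjunction is bracketed to the right.
\<close>

fun functional_relation :: "'u eff_obj \<Rightarrow> 'u eff_obj \<Rightarrow> ('u \<times> 'u \<Rightarrow> nat set) \<Rightarrow> bool" where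
  "functional_relation (A, \<rho>) (B, \<sigma>) F \<longleftrightarrow>
     F \<in> A \<times> B \<rightarrow>\<^sub>E UNIV \<and>
     valid (\<Inter>a\<in>A. \<Inter>b\<in>B. F (a, b) \<rightarrow>\<^sub>r \<rho> (a, a) \<sqinter>\<^sub>r \<sigma> (b, b)) \<and>
     valid (\<Inter>a\<in>A. \<Inter>a'\<in>A. \<Inter>b\<in>B. \<Inter>b'\<in>B.
              F (a, b) \<sqinter>\<^sub>r \<rho> (a, a') \<sqinter>\<^sub>r \<sigma> (b, b') \<rightarrow>\<^sub>r F (a', b')) \<and>
     valid (\<Inter>a\<in>A. \<Inter>b\<in>B. \<Inter>b'\<in>B. F (a, b) \<sqinter>\<^sub>r F (a, b') \<rightarrow>\<^sub>r \<sigma> (b, b')) \<and>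
     valid (\<Inter>a\<in>A. \<rho> (a, a) \<rightarrow>\<^sub>r (\<Union>b\<in>B. F (a, b)))"

definition rel_class :: "'u set \<Rightarrow> 'u set \<Rightarrow> ('u \<times> 'u \<Rightarrow> nat set) \<Rightarrow> ('u \<times> 'u \<Rightarrow> nat set) set" where
  "rel_class A B F =
     {G \<in> A \<times> B \<rightarrow>\<^sub>E UNIV. realizes_le (A \<times> B) F G \<and> realizes_le (A \<times> B) G F}"

definition rel_comp :: "'u set \<Rightarrow> 'u set \<Rightarrow> 'u set \<Rightarrow>
    ('u \<times> 'u \<Rightarrow> nat set) \<Rightarrow> ('u \<times> 'u \<Rightarrow> nat set) \<Rightarrow> ('u \<times> 'u \<Rightarrow> nat set)" where
  "rel_comp A B D G F = restrict (\<lambda>(a, d). \<Union>b\<in>B. F (a, b) \<sqinter>\<^sub>r G (b, d)) (A \<times> D)"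

text \<open>
  An arrow records its domain and codomain besides the class of functional relations.
\<close>

type_synonym 'u eff_arr = "'u eff_obj \<times> ('u \<times> 'u \<Rightarrow> nat set) set \<times> 'u eff_obj"

definition eff_arrows :: "'u eff_arr set" where
  "eff_arrows = {(X, rel_class (fst X) (fst Y) F, Y) | X Y F.
     X \<in> eff_objects \<and> Y \<in> eff_objects \<and> functional_relation X Y F}"

text \<open>
  The composite of two classes collects the classes of the composites of all representatives;
  these classes coincide.
\<close>

fun eff_comp :: "'u eff_arr \<Rightarrow> 'u eff_arr \<Rightarrow> 'u eff_arr" where
  "eff_comp (Y', g, Z) (X, f, Y) =
     (X, \<Union>F\<in>f. \<Union>G\<in>g. rel_class (fst X) (fst Z) (rel_comp (fst X) (fst Y) (fst Z) G F), Z)"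

definition eff :: "('u eff_obj, 'u eff_arr) cat" where
  "eff = \<lparr>Obj = eff_objects,
          Arr = eff_arrows,
          Dom = (\<lambda>(X, f, Y). X),
          Cod = (\<lambda>(X, f, Y). Y),
          Id = (\<lambda>X. (X, rel_class (fst X) (fst X) (snd X), X)),
          Comp = eff_comp\<rparr>"

end

theory Submission
  imports Defs
begin

text \<open>
  Validity of a formula is tested on generic elements, as in Kripke-Joyal semantics over the
  partitioned assemblies: a generic element assigns values to coded environments, and a formula
  is forced if one program computes realizers from the codes. Objects then behave like sets with an
  equality and arrows like functions, so that limits and power objects of the effective topos
  are constructed as for sets. The truth values of closed formulas are only two, empty or not.
  Hence an object \<open>X\<close> either has a global point, which splits \<open>X \<rightarrow> 1\<close>, or is initial;
  in the second case \<open>U = X\<close>, and any global point of the well-supported object \<open>A\<close>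
  serves as \<open>\<epsilon>\<close>.
\<close>


section \<open>Kleene application\<close>

text \<open>Two facts of recursion theory carry the forcing clauses. To introduce an implication,
  parametrization (\<open>smn\<close>) turns a program on an extended stage into a realizer that
  depends on the old code. To eliminate one, a universal program is needed: the realizer of the
  implication is itself computed from the environment, so there is no fixed program to compose with.
  Apart from these the clauses only compose and pair programs. The obstacle is that quantifiers are
  intersections and unions, so realizers never see the labels they speak about. Environments
  therefore carry labels beside a number, and only the number is an input. Stages with tracked maps
  are the partitioned assemblies, which are projective in the effective topos; this is why a total
  relation has a value at the stage itself, with no passage to a cover. That closed formulas have
  two truth values rests on classical logic: a nonempty set of numbers contains some number, and a
  constant program returns it.\<close>

abbreviation pair :: "nat \<Rightarrow> nat \<Rightarrow> nat" where "pair a b \<equiv> prod_encode (a, b)"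
abbreviation pfst :: "nat \<Rightarrow> nat" where "pfst z \<equiv> fst (prod_decode z)"
abbreviation psnd :: "nat \<Rightarrow> nat" where "psnd z \<equiv> snd (prod_decode z)"

section \<open>Closure properties of the total recursive functions\<close>

definition computable :: "(nat \<Rightarrow> nat) \<Rightarrow> bool" where
  "computable f \<longleftrightarrow> (\<exists>p. \<forall>x. run p x = Some (f x))"

named_theorems computable

lemma computable_id [computable]: "computable (\<lambda>x. x)"
proof -
  have "\<forall>x. run (Pairing Fst Snd) x = Some x" by simp
  then show ?thesis unfolding computable_def by blast
qed

lemma computable_compose:
  assumes "computable f" "computable g"
  shows "computable (\<lambda>x. f (g x))"
proof -
  obtain p q where "\<forall>x. run p x = Some (f x)" "\<forall>x. run q x = Some (g x)"
    using assms unfolding computable_def by blast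
  then have "\<forall>x. run (Compose p q) x = Some (f (g x))" by simp
  then show ?thesis unfolding computable_def by blast
qed

lemma computable_Suc [computable]: "computable f \<Longrightarrow> computable (\<lambda>x. Suc (f x))"
  by (rule computable_compose[of Suc]) (auto simp: computable_def intro: exI[of _ Succ])

lemma computable_pfst [computable]: "computable f \<Longrightarrow> computable (\<lambda>x. pfst (f x))"
  by (rule computable_compose[of pfst]) (auto simp: computable_def intro: exI[of _ Fst])

lemma computable_psnd [computable]: "computable f \<Longrightarrow> computable (\<lambda>x. psnd (f x))"
  by (rule computable_compose[of psnd]) (auto simp: computable_def intro: exI[of _ Snd])

lemma computable_const [computable]: "computable (\<lambda>x. k)"
proof (induction k)
  case 0
  have "\<forall>x. run Zero x = Some 0" by simp
  then show ?case unfolding computable_def by blast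
next
  case (Suc k)
  then show ?case by (rule computable_Suc)
qed

lemma computable_pair [computable]:
  assumes "computable f" "computable g"
  shows "computable (\<lambda>x. pair (f x) (g x))"
proof -
  obtain p q where "\<forall>x. run p x = Some (f x)" "\<forall>x. run q x = Some (g x)"
    using assms unfolding computable_def by blast
  then have "\<forall>x. run (Pairing p q) x = Some (pair (f x) (g x))" by simp
  then show ?thesis unfolding computable_def by blast
qed

text \<open>Programs are unary, so parameter, counter and previous value reach the step function as
  nested pairs. Predecessor, case distinction, addition and division by 4 are all instances.\<close>

lemma computable_rec_nat:
  assumes "computable f" "computable (\<lambda>z. g (pfst z) (pfst (psnd z)) (psnd (psnd z)))" "computable k"
  shows "computable (\<lambda>x. rec_nat (f x) (g x) (k x))"
proof -
  define g' where "g' = (\<lambda>z. g (pfst z) (pfst (psnd z)) (psnd (psnd z)))"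
  obtain p q where p: "\<forall>x. run p x = Some (f x)" and q: "\<forall>x. run q x = Some (g' x)"
    using assms(1,2) unfolding computable_def g'_def by blast
  have "rec_nat (run p a) (\<lambda>n r. Option.bind r (\<lambda>y. run q (pair a (pair n y)))) m
      = Some (rec_nat (f a) (g a) m)" for a m
    by (induction m) (simp_all add: p q g'_def)
  then have "\<forall>z. run (PrimRec p q) z = Some (rec_nat (f (pfst z)) (g (pfst z)) (psnd z))"
    by (simp add: case_prod_beta)
  then have "computable (\<lambda>z. rec_nat (f (pfst z)) (g (pfst z)) (psnd z))"
    unfolding computable_def by blast
  from computable_compose[OF this, of "\<lambda>x. pair x (k x)"] show ?thesis
    by (simp add: computable_pair computable_id assms(3))
qed

lemma computable_pred [computable]:
  assumes "computable f"
  shows "computable (\<lambda>x. f x - Suc 0)"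
proof -
  have "rec_nat 0 (\<lambda>n r. n) m = m - Suc 0" for m :: nat by (cases m) auto
  then show ?thesis
    using computable_rec_nat[of "\<lambda>x. 0" "\<lambda>x n r. n" f] assms by (simp add: computable)
qed

lemma computable_minus_numeral [computable]:
  assumes "computable f"
  shows "computable (\<lambda>x. f x - numeral k)"
proof -
  have "computable (\<lambda>x. f x - n)" for n
  proof (induction n)
    case 0
    then show ?case using assms by simp
  next
    case (Suc n)
    from computable_pred[OF this] show ?case by simp
  qed
  then show ?thesis .
qed

text \<open>A case distinction is a recursion whose step ignores both the counter and the previous
  value.\<close>

lemma computable_if_zero [computable]:
  assumes "computable c" "computable f" "computable g"
  shows "computable (\<lambda>x. if c x = 0 then f x else g x)"
proof -
  have "rec_nat a (\<lambda>n r. b) m = (if m = 0 then a else b)" for m and a b :: nat by (cases m) auto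
  then show ?thesis
    using computable_rec_nat[of f "\<lambda>x n r. g x" c] assms
      computable_compose[OF assms(3), of pfst] by (simp add: computable)
qed

lemma computable_add [computable]:
  assumes "computable f" "computable g"
  shows "computable (\<lambda>x. f x + g x)"
proof -
  have "rec_nat a (\<lambda>n r. Suc r) m = a + m" for m a :: nat by (induction m) auto
  then show ?thesis
    using computable_rec_nat[of f "\<lambda>x n r. Suc r" g] assms by (simp add: computable)
qed

lemma computable_mult_numeral [computable]:
  assumes "computable f"
  shows "computable (\<lambda>x. numeral k * f x)"
proof -
  have "computable (\<lambda>x. n * f x)" for n
    by (induction n) (simp_all add: computable assms)
  then show ?thesis .
qed

lemma computable_Let [computable]:
  assumes "computable f" "computable (\<lambda>z. g (pfst z) (psnd z))"
  shows "computable (\<lambda>x. let y = f x in g x y)"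
  using computable_compose[OF assms(2), of "\<lambda>x. pair x (f x)"] assms(1) by (simp add: computable)

text \<open>The divisor 4 is the number of composite constructors in \<open>godel\<close>, which the
  remainder tells apart. Quotient and remainder are computed together because the carry of one
  depends on the other.\<close>

lemma computable_div_mod_4:
  "computable (\<lambda>x. pair (x div 4) (x mod 4))"
proof -
  \<comment> \<open>With truncated subtraction, \<open>psnd r - 2 = 0\<close> says that the
    remainder is at most 2 and can grow without a carry.\<close>
  define g where "g r = (if psnd r - 2 = 0 then pair (pfst r) (Suc (psnd r)) else pair (Suc (pfst r)) 0)" for r
  have g: "g (pair (m div 4) (m mod 4)) = pair (Suc m div 4) (Suc m mod 4)" for m
    by (auto simp: g_def mod_Suc div_Suc)
  have rec: "rec_nat (pair 0 0) (\<lambda>_. g) m = pair (m div 4) (m mod 4)" for m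
    by (induction m) (simp_all add: g del: prod_encode_eq)
  have "computable (\<lambda>x. rec_nat (pair 0 0) (\<lambda>_. g) x)"
    unfolding g_def by (rule computable_rec_nat) (intro computable)+
  then show ?thesis unfolding rec .
qed

lemma computable_div_4 [computable]: "computable f \<Longrightarrow> computable (\<lambda>x. f x div 4)"
  using computable_compose[OF computable_pfst[OF computable_div_mod_4], of f] by simp

lemma computable_mod_4 [computable]: "computable f \<Longrightarrow> computable (\<lambda>x. f x mod 4)"
  using computable_compose[OF computable_psnd[OF computable_div_mod_4], of f] by simp

lemma kleene_app_godel [simp]: "kleene_app (godel p) = run p"
  unfolding kleene_app_def fun_eq_iff by (simp add: inv_f_f[OF inj_godel])

subsection \<open>Parametrization\<close>

text \<open>The parameter \<open>a\<close> is compiled into the program as a constant. The point is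
  that the code of the resulting program is a recursive function of \<open>a\<close>.\<close>

lemma smn:
  obtains e where "computable e" "\<And>a m. kleene_app (e a) m = run p (pair a m)"
proof -
  \<comment> \<open>The constant \<open>a\<close> is \<open>Succ\<close> composed \<open>a\<close>
    times onto \<open>Zero\<close>; this shape makes its code primitive recursive in
    \<open>a\<close>.\<close>
  define c where "c = rec_nat Zero (\<lambda>_ q. Compose Succ q)"
  have c: "run (c a) x = Some a" for a x by (induction a) (simp_all add: c_def)
  define q where "q a = Compose p (Pairing (c a) (Pairing Fst Snd))" for a
  \<comment> \<open>The step is the code of \<open>Compose Succ q\<close> for a program
    \<open>q\<close> with code \<open>r\<close>: the code of \<open>Succ\<close> is 1, and 5 is the
    offset of \<open>Compose\<close>.\<close>
  have "godel (c a) = rec_nat 0 (\<lambda>_ r. 4 * pair 1 r + 5) a" for a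
    by (induction a) (simp_all add: c_def)
  then have "computable (\<lambda>a. godel (c a))"
    using computable_rec_nat[of "\<lambda>x. 0" "\<lambda>x n r. 4 * pair 1 r + 5" "\<lambda>x. x"] by (simp add: computable)
  then have "computable (\<lambda>a. godel (q a))" by (simp add: q_def computable)
  moreover have "kleene_app (godel (q a)) m = run p (pair a m)" for a m
    by (simp add: q_def c del: godel.simps)
  ultimately show thesis using that by blast
qed

subsection \<open>A universal program\<close>

text \<open>
  A state consists of a stack of tasks and a current value. Tag 0 asks to run the program with
  the given code on the value; the other tags are continuations: 1 and 2 for the two halves
  of a pairing, 3 for a recursion with the given number of rounds left, 4 for a search.
  The stack is 0 when empty, and otherwise the successor of the pair of its top and the rest.
\<close>

abbreviation push :: "nat \<Rightarrow> nat \<Rightarrow> nat \<Rightarrow> nat" where "push t d R \<equiv> Suc (pair (pair t d) R)"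

text \<open>All tests compare a truncated difference with 0. Nested in increasing order they amount
  to equality tests, and they match the rule \<open>computable_if_zero\<close>.\<close>

definition exec_step :: "nat \<Rightarrow> nat \<Rightarrow> nat \<Rightarrow> nat" where
  "exec_step d R v =
     (if d = 0 then pair R 0 else if d - 1 = 0 then pair R (Suc v)
      else if d - 2 = 0 then pair R (pfst v) else if d - 3 = 0 then pair R (psnd v)
      else let k = (d - 4) div 4; f = pfst k; g = psnd k; i = (d - 4) mod 4 in
        if i = 0 then pair (push 0 f (push 1 (pair g v) R)) v
        else if i - 1 = 0 then pair (push 0 g (push 0 f R)) v
        else if i - 2 = 0 then pair (push 0 f (push 3 (pair g (pair (pfst v) (pair 0 (psnd v)))) R)) (pfst v)
        else pair (push 0 k (push 4 (pair k (pair v 0)) R)) (pair v 0))"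

text \<open>The data \<open>d\<close> holds, for tag 1, the code of the second half and the original
  input; for tag 2, the first result; for tag 3, the step program, the parameter, the rounds done
  and the rounds left; for tag 4, the program, the parameter and the current candidate. For these
  tags \<open>v\<close> is the value just returned by the subtask above.\<close>

definition task_step :: "nat \<Rightarrow> nat \<Rightarrow> nat \<Rightarrow> nat \<Rightarrow> nat" where
  "task_step t d R v =
     (if t = 0 then exec_step d R v
      else if t - 1 = 0 then pair (push 0 (pfst d) (push 2 v R)) (psnd d)
      else if t - 2 = 0 then pair R (pair d v)
      else if t - 3 = 0 then
        let g = pfst d; a = pfst (psnd d); n = pfst (psnd (psnd d)); m = psnd (psnd (psnd d)) in
        if m = 0 then pair R v
        else pair (push 0 g (push 3 (pair g (pair a (pair (Suc n) (m - 1)))) R)) (pair a (pair n v))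
      else let f = pfst d; x = pfst (psnd d); n = psnd (psnd d) in
        if v = 0 then pair R n
        else pair (push 0 f (push 4 (pair f (pair x (Suc n))) R)) (pair x (Suc n)))"

text \<open>A state with empty stack is a fixed point, so a finished computation keeps its value
  however many further steps are made.\<close>

definition mstep :: "nat \<Rightarrow> nat" where
  "mstep s = (let T = pfst s; v = psnd s in if T = 0 then s
     else task_step (pfst (pfst (T - 1))) (psnd (pfst (T - 1))) (psnd (T - 1)) v)"

lemma computable_exec_step [computable]:
  assumes "computable d" "computable R" "computable v"
  shows "computable (\<lambda>x. exec_step (d x) (R x) (v x))"
proof -
  have "computable (\<lambda>z. exec_step (pfst z) (pfst (psnd z)) (psnd (psnd z)))"
    unfolding exec_step_def One_nat_def by (intro computable)
  from computable_compose[OF this, of "\<lambda>x. pair (d x) (pair (R x) (v x))"] assms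
  show ?thesis by (simp add: computable)
qed

lemma computable_task_step [computable]:
  assumes "computable t" "computable d" "computable R" "computable v"
  shows "computable (\<lambda>x. task_step (t x) (d x) (R x) (v x))"
proof -
  have "computable (\<lambda>z. task_step (pfst (pfst z)) (psnd (pfst z)) (pfst (psnd z)) (psnd (psnd z)))"
    unfolding task_step_def One_nat_def by (intro computable)
  from computable_compose[OF this, of "\<lambda>x. pair (pair (t x) (d x)) (pair (R x) (v x))"] assms
  show ?thesis by (simp add: computable)
qed

lemma computable_mstep: "computable mstep"
  unfolding mstep_def One_nat_def by (intro computable)

lemma mstep_empty [simp]: "mstep (pair 0 v) = pair 0 v"
  by (simp add: mstep_def)

lemma mstep_push [simp]: "mstep (pair (push t d R) v) = task_step t d R v"
  by (simp add: mstep_def)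

definition msteps :: "nat \<Rightarrow> nat \<Rightarrow> bool" where
  "msteps s s' \<longleftrightarrow> (\<exists>n. (mstep ^^ n) s = s')"

lemma msteps_refl: "msteps s s"
  unfolding msteps_def by (rule exI[of _ 0]) simp

lemma msteps_trans [trans]: "msteps s s' \<Longrightarrow> msteps s' s'' \<Longrightarrow> msteps s s''"
  unfolding msteps_def by (metis comp_apply funpow_add)

lemma msteps_step: "mstep s = s' \<Longrightarrow> msteps s' s'' \<Longrightarrow> msteps s s''"
  unfolding msteps_def by (metis funpow_Suc_right comp_apply)

text \<open>Inverts the composite cases of \<open>godel\<close>: the quotient recovers the code of
  the arguments, the remainder the constructor.\<close>

lemma numeral_div_4: "(4 * k + 4 - 4) div 4 = (k::nat)" "(4 * k + 5 - 4) div 4 = k"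
  "(4 * k + 6 - 4) div 4 = k" "(4 * k + 7 - 4) div 4 = k"
  "(4 * k + 4 - 4) mod 4 = 0" "(4 * k + 5 - 4) mod 4 = 1"
  "(4 * k + 6 - 4) mod 4 = 2" "(4 * k + 7 - 4) mod 4 = 3"
proof -
  have "4 * k + 4 - 4 = 4 * k" "4 * k + 5 - 4 = 4 * k + 1"
    "4 * k + 6 - 4 = 4 * k + 2" "4 * k + 7 - 4 = 4 * k + 3" by linarith+
  then show "(4 * k + 4 - 4) div 4 = (k::nat)" "(4 * k + 5 - 4) div 4 = k"
    "(4 * k + 6 - 4) div 4 = k" "(4 * k + 7 - 4) div 4 = k"
    "(4 * k + 4 - 4) mod 4 = 0" "(4 * k + 5 - 4) mod 4 = 1"
    "(4 * k + 6 - 4) mod 4 = 2" "(4 * k + 7 - 4) mod 4 = 3"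
    by (simp_all only:) (simp_all add: mod_Suc)
qed

lemma exec_step_godel:
  "exec_step (godel Zero) R v = pair R 0"
  "exec_step (godel Succ) R v = pair R (Suc v)"
  "exec_step (godel Fst) R v = pair R (pfst v)"
  "exec_step (godel Snd) R v = pair R (psnd v)"
  "exec_step (godel (Pairing f g)) R v = pair (push 0 (godel f) (push 1 (pair (godel g) v) R)) v"
  "exec_step (godel (Compose f g)) R v = pair (push 0 (godel g) (push 0 (godel f) R)) v"
  "exec_step (godel (PrimRec f g)) R v =
     pair (push 0 (godel f) (push 3 (pair (godel g) (pair (pfst v) (pair 0 (psnd v)))) R)) (pfst v)"
  "exec_step (godel (Mu f)) R v = pair (push 0 (godel f) (push 4 (pair (godel f) (pair v 0)) R)) (pair v 0)"
  unfolding exec_step_def godel.simps numeral_div_4 Let_def by simp_all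

lemma task_step_simps:
  "task_step 0 d R v = exec_step d R v"
  "task_step (Suc 0) (pair g x) R v = pair (push 0 g (push 2 v R)) x"
  "task_step 2 d R v = pair R (pair d v)"
  "task_step 3 (pair g (pair a (pair n 0))) R v = pair R v"
  "task_step 3 (pair g (pair a (pair n (Suc m)))) R v =
     pair (push 0 g (push 3 (pair g (pair a (pair (Suc n) m))) R)) (pair a (pair n v))"
  "task_step 4 (pair f (pair x n)) R 0 = pair R n"
  "task_step 4 (pair f (pair x n)) R (Suc v) = pair (push 0 f (push 4 (pair f (pair x (Suc n))) R)) (pair x (Suc n))"
  unfolding task_step_def by simp_all

text \<open>Loop invariant: after \<open>n\<close> rounds the current value \<open>v\<close> is the
  recursion at \<open>n\<close>. The induction is on the rounds \<open>m\<close> that are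
  left.\<close>

lemma msteps_primrec:
  assumes g: "\<And>x y R. run g x = Some y \<Longrightarrow> msteps (pair (push 0 (godel g) R) x) (pair R y)"
    and "rec_nat r (\<lambda>n r. Option.bind r (\<lambda>y. run g (pair a (pair n y)))) (n + m) = Some z"
    and "rec_nat r (\<lambda>n r. Option.bind r (\<lambda>y. run g (pair a (pair n y)))) n = Some v"
  shows "msteps (pair (push 3 (pair (godel g) (pair a (pair n m))) R) v) (pair R z)"
  using assms(2,3)
proof (induction m arbitrary: n v)
  case 0
  then show ?case by (auto intro!: msteps_step[OF _ msteps_refl] simp: task_step_simps)
next
  case (Suc m)
  let ?rec = "rec_nat r (\<lambda>n r. Option.bind r (\<lambda>y. run g (pair a (pair n y))))"
  \<comment> \<open>An undefined value of the recursion stays undefined in all later rounds, so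
    definedness at the end descends to round \<open>Suc n\<close>.\<close>
  have "\<exists>w. ?rec (Suc n) = Some w"
  proof (rule ccontr)
    assume "\<not> ?thesis"
    then have "?rec (Suc n) = None" by (simp del: nat.rec)
    then have "?rec (Suc n + j) = None" for j by (induction j) simp_all
    with Suc.prems(1) show False by (metis add_Suc_shift option.distinct(1))
  qed
  then obtain w where w: "?rec (Suc n) = Some w" ..
  have "run g (pair a (pair n v)) = Some w" using w Suc.prems(2) by simp
  from g[OF this] have "msteps (pair (push 3 (pair (godel g) (pair a (pair n (Suc m)))) R) v)
      (pair (push 3 (pair (godel g) (pair a (pair (Suc n) m))) R) w)"
    by (intro msteps_step[of "pair (push 3 _ R) v"]) (simp_all add: task_step_simps)
  also have "msteps \<dots> (pair R z)" using Suc.IH[of "Suc n"] Suc.prems(1) w by simp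
  finally show ?case .
qed

text \<open>Induction on the distance \<open>n\<close> from the candidate \<open>i\<close> to the
  answer; every candidate before the answer returns a successor and so moves the search on by
  one.\<close>

lemma msteps_mu:
  assumes f: "\<And>x y R. run f x = Some y \<Longrightarrow> msteps (pair (push 0 (godel f) R) x) (pair R y)"
    and "run f (pair x (i + n)) = Some 0" "\<And>j. j < i + n \<Longrightarrow> \<exists>y. run f (pair x j) = Some (Suc y)"
  shows "msteps (pair (push 0 (godel f) (push 4 (pair (godel f) (pair x i)) R)) (pair x i)) (pair R (i + n))"
  using assms(2,3)
proof (induction n arbitrary: i)
  case 0
  then have "msteps (pair (push 0 (godel f) (push 4 (pair (godel f) (pair x i)) R)) (pair x i))
    (pair (push 4 (pair (godel f) (pair x i)) R) 0)" by (intro f) simp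
  also have "msteps \<dots> (pair R (i + 0))"
    by (rule msteps_step[OF _ msteps_refl]) (simp add: task_step_simps)
  finally show ?case .
next
  case (Suc n)
  obtain y where "run f (pair x i) = Some (Suc y)" using Suc.prems(2)[of i] by auto
  from f[OF this] have "msteps (pair (push 0 (godel f) (push 4 (pair (godel f) (pair x i)) R)) (pair x i))
    (pair (push 4 (pair (godel f) (pair x i)) R) (Suc y))" .
  also have "msteps \<dots> (pair R (i + Suc n))"
    using Suc.IH[of "Suc i"] Suc.prems
    by (intro msteps_step[of "pair (push 4 _ R) (Suc y)"]) (simp_all add: task_step_simps)
  finally show ?case .
qed

text \<open>The stack \<open>R\<close> is arbitrary so that the induction hypotheses apply to
  subprograms running on top of pending continuations.\<close>

lemma msteps_run: "run p x = Some y \<Longrightarrow> msteps (pair (push 0 (godel p) R) x) (pair R y)"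
proof (induction p arbitrary: x y R)
  case (Pairing f g)
  then obtain a b where a: "run f x = Some a" and b: "run g x = Some b" and y: "y = pair a b"
    by (auto simp: bind_eq_Some_conv)
  have "msteps (pair (push 0 (godel (Pairing f g)) R) x)
      (pair (push 0 (godel f) (push 1 (pair (godel g) x) R)) x)"
    by (rule msteps_step[OF _ msteps_refl]) (simp add: task_step_simps(1) exec_step_godel del: godel.simps)
  also have "msteps \<dots> (pair (push 1 (pair (godel g) x) R) a)" by (rule Pairing.IH(1)[OF a])
  also have "msteps \<dots> (pair (push 0 (godel g) (push 2 a R)) x)"
    by (rule msteps_step[OF _ msteps_refl]) (simp add: task_step_simps)
  also have "msteps \<dots> (pair (push 2 a R) b)" by (rule Pairing.IH(2)[OF b])
  also have "msteps \<dots> (pair R y)"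
    by (rule msteps_step[OF _ msteps_refl]) (simp add: task_step_simps y)
  finally show ?case .
next
  case (Compose f g)
  then obtain a where a: "run g x = Some a" and y: "run f a = Some y"
    by (auto simp: bind_eq_Some_conv)
  have "msteps (pair (push 0 (godel (Compose f g)) R) x) (pair (push 0 (godel g) (push 0 (godel f) R)) x)"
    by (rule msteps_step[OF _ msteps_refl]) (simp add: task_step_simps(1) exec_step_godel del: godel.simps)
  also have "msteps \<dots> (pair (push 0 (godel f) R) a)" by (rule Compose.IH(2)[OF a])
  also have "msteps \<dots> (pair R y)" by (rule Compose.IH(1)[OF y])
  finally show ?case .
next
  case (PrimRec f g)
  obtain a k where x: "prod_decode x = (a, k)" by fastforce
  let ?rec = "rec_nat (run f a) (\<lambda>n r. Option.bind r (\<lambda>y. run g (pair a (pair n y))))"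
  have y: "?rec k = Some y" using PrimRec.prems x by simp
  have "\<exists>w. run f a = Some w"
  proof (rule ccontr)
    assume "\<not> ?thesis"
    then have "run f a = None" by simp
    then have "?rec j = None" for j by (induction j) simp_all
    with y show False by simp
  qed
  then obtain w where w: "run f a = Some w" ..
  have "msteps (pair (push 0 (godel (PrimRec f g)) R) x)
     (pair (push 0 (godel f) (push 3 (pair (godel g) (pair a (pair 0 k))) R)) a)"
    by (rule msteps_step[OF _ msteps_refl]) (simp add: task_step_simps(1) exec_step_godel x del: godel.simps)
  also have "msteps \<dots> (pair (push 3 (pair (godel g) (pair a (pair 0 k))) R) w)"
    by (rule PrimRec.IH(1)[OF w])
  also have "msteps \<dots> (pair R y)"
    by (rule msteps_primrec[OF PrimRec.IH(2), where r = "run f a"]) (use y w in simp_all)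
  finally show ?case .
next
  case (Mu f)
  let ?P = "\<lambda>n. run f (pair x n) = Some 0"
  obtain n0 where n0: "?P n0" "\<forall>i<n0. run f (pair x i) \<noteq> None" and y: "y = (LEAST n. ?P n)"
    using Mu.prems by (auto split: if_splits)
  have "?P y" unfolding y by (rule LeastI[of ?P n0]) (rule n0(1))
  moreover have "\<exists>z. run f (pair x j) = Some (Suc z)" if "j < y" for j
  proof -
    have "\<not> ?P j" using that unfolding y by (rule not_less_Least)
    moreover have "run f (pair x j) \<noteq> None"
      using n0 that Least_le[of ?P n0] unfolding y by simp
    ultimately show ?thesis by (metis not0_implies_Suc option.exhaust)
  qed
  ultimately have "msteps (pair (push 0 (godel f) (push 4 (pair (godel f) (pair x 0)) R)) (pair x 0)) (pair R (0 + y))"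
    by (intro msteps_mu Mu.IH) simp_all
  then show ?case
    by (intro msteps_step[of "pair (push 0 (godel (Mu f)) R) x"])
      (simp_all add: task_step_simps(1) exec_step_godel del: godel.simps)
qed (rule msteps_step[OF _ msteps_refl], simp add: task_step_simps(1) exec_step_godel del: godel.simps)+

text \<open>\<open>U\<close> searches for the first step count at which the stack is empty and reads
  off the value there. Agreement on defined applications is what realizers of implications
  require.\<close>

lemma universal_program:
  obtains U where "\<And>e m y. kleene_app e m = Some y \<Longrightarrow> run U (pair e m) = Some y"
proof -
  \<comment> \<open>The state after \<open>n\<close> steps, started with one task: run the code
    \<open>pfst z\<close> on \<open>psnd z\<close>.\<close>
  define st where "st z n = (mstep ^^ n) (pair (push 0 (pfst z) 0) (psnd z))" for z n
  have st: "st z n = rec_nat (pair (push 0 (pfst z) 0) (psnd z)) (\<lambda>_. mstep) n" for z n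
    unfolding st_def by (induction n) simp_all
  have "computable (\<lambda>z. rec_nat (pair (push 0 (pfst (pfst z)) 0) (psnd (pfst z))) (\<lambda>_. mstep) (psnd z))"
    by (rule computable_rec_nat) (intro computable computable_compose[OF computable_mstep])+
  then have st_comp: "computable (\<lambda>z. st (pfst z) (psnd z))" unfolding st .
  obtain P where P: "\<And>z. run P z = Some (pfst (st (pfst z) (psnd z)))"
    using computable_pfst[OF st_comp] unfolding computable_def by blast
  obtain Q where Q: "\<And>z. run Q z = Some (psnd (st (pfst z) (psnd z)))"
    using computable_psnd[OF st_comp] unfolding computable_def by blast
  \<comment> \<open>\<open>Pairing Fst Snd\<close> is the identity; it keeps the input next to the
    step count found by \<open>Mu P\<close>.\<close>
  define U where "U = Compose Q (Pairing (Pairing Fst Snd) (Mu P))"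
  have "run U (pair e m) = Some y" if "kleene_app e m = Some y" for e m y
  proof -
    obtain p where e: "e = godel p" using surj_godel by (metis surjD)
    have "run p m = Some y" using that e by simp
    from msteps_run[OF this, of 0] obtain n where n: "st (pair e m) n = pair 0 y"
      unfolding msteps_def st_def e by auto
    define k where "k = (LEAST n. pfst (st (pair e m) n) = 0)"
    have k0: "pfst (st (pair e m) k) = 0" unfolding k_def by (rule LeastI[of _ n]) (simp add: n)
    have "k \<le> n" unfolding k_def by (rule Least_le) (simp add: n)
    \<comment> \<open>The state at step \<open>n\<close> is reached from the one at step
      \<open>k\<close>, which is already a fixed point; hence both coincide.\<close>
    then have "st (pair e m) n = (mstep ^^ (n - k)) (st (pair e m) k)"
      unfolding st_def by (metis comp_apply funpow_add le_add_diff_inverse2)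
    moreover have "(mstep ^^ j) (st (pair e m) k) = st (pair e m) k" for j
      using k0 by (induction j) (auto simp: mstep_def)
    ultimately have "st (pair e m) k = pair 0 y" using n by simp
    moreover have "run (Mu P) (pair e m) = Some k"
      using n by (auto simp: P k_def intro!: exI[of _ n])
    ultimately show ?thesis by (simp add: U_def Q del: run.simps(8))
  qed
  then show thesis by (rule that)
qed


section \<open>Forcing\<close>

text \<open>
  The head of an environment is its code, the only part that a realizer has access to; the tail
  records values of variables. A stage is a set of environments, and a generic element of a set is
  a function on a stage. An existential statement is forced iff some generic element
  satisfies its body, because a realizer sees the whole code and the witness is a choice
  depending on the environment.
\<close>

type_synonym 'u env = "('u + nat) list"

definition code :: "'u env \<Rightarrow> nat" where
  "code s = projr (hd s)"

definition forces :: "'u env set \<Rightarrow> ('u env \<Rightarrow> nat set) \<Rightarrow> bool"  (infix "\<tturnstile>" 50) where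
  "S \<tturnstile> \<phi> \<longleftrightarrow> (\<exists>p. \<forall>s\<in>S. \<exists>y\<in>\<phi> s. run p (code s) = Some y)"

text \<open>The morphisms of partitioned assemblies: maps of environments that a program tracks on
  codes.\<close>

definition refines :: "'u env set \<Rightarrow> 'u env set \<Rightarrow> ('u env \<Rightarrow> 'u env) \<Rightarrow> bool" where
  "refines S' S h \<longleftrightarrow> h \<in> S' \<rightarrow> S \<and> (\<exists>p. \<forall>s\<in>S'. run p (code s) = Some (code (h s)))"

lemma forcesI: "(\<And>s. s \<in> S \<Longrightarrow> \<exists>y\<in>\<phi> s. run p (code s) = Some y) \<Longrightarrow> S \<tturnstile> \<phi>"
  unfolding forces_def by blast

lemma forces_cong: "(\<And>s. s \<in> S \<Longrightarrow> \<phi> s = \<psi> s) \<Longrightarrow> S \<tturnstile> \<phi> \<longleftrightarrow> S \<tturnstile> \<psi>"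
  unfolding forces_def by auto

lemma forces_subset: "S \<tturnstile> \<phi> \<Longrightarrow> (\<And>s. s \<in> S \<Longrightarrow> \<phi> s \<subseteq> \<psi> s) \<Longrightarrow> S \<tturnstile> \<psi>"
  unfolding forces_def by (meson subsetD)

lemma forces_nonempty: "S \<tturnstile> \<phi> \<Longrightarrow> s \<in> S \<Longrightarrow> \<phi> s \<noteq> {}"
  unfolding forces_def by blast

lemma forces_empty [simp]: "{} \<tturnstile> \<phi>"
  unfolding forces_def by simp

lemma forces_UNIV [simp]: "S \<tturnstile> (\<lambda>s. UNIV)"
  by (rule forcesI[of _ _ Zero]) simp

lemma forces_const: "a \<in> \<phi> \<Longrightarrow> S \<tturnstile> (\<lambda>s. \<phi>)"
proof -
  assume a: "a \<in> \<phi>"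
  obtain p where "\<forall>x. run p x = Some a"
    using computable_const[of a] unfolding computable_def by blast
  with a show ?thesis by (intro forcesI[of _ _ p]) simp
qed

lemma refines_in: "refines S' S h \<Longrightarrow> s \<in> S' \<Longrightarrow> h s \<in> S"
  unfolding refines_def by blast

lemma refines_id: "refines S S (\<lambda>s. s)"
proof -
  have "\<forall>s\<in>S. run (Pairing Fst Snd) (code s) = Some (code s)" by simp
  then show ?thesis unfolding refines_def by blast
qed

lemma forces_mono: "refines S' S h \<Longrightarrow> S \<tturnstile> \<phi> \<Longrightarrow> S' \<tturnstile> (\<lambda>s. \<phi> (h s))"
proof -
  assume h: "refines S' S h" and "S \<tturnstile> \<phi>"
  then obtain p q where "\<forall>s\<in>S. \<exists>y\<in>\<phi> s. run p (code s) = Some y"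
    "\<forall>s\<in>S'. run q (code s) = Some (code (h s))" unfolding forces_def refines_def by blast
  then show ?thesis using refines_in[OF h] by (intro forcesI[of _ _ "Compose p q"]) simp
qed

lemma forces_conj: "S \<tturnstile> (\<lambda>s. \<phi> s \<sqinter>\<^sub>r \<psi> s) \<longleftrightarrow> S \<tturnstile> \<phi> \<and> S \<tturnstile> \<psi>"
proof (intro iffI conjI)
  assume "S \<tturnstile> (\<lambda>s. \<phi> s \<sqinter>\<^sub>r \<psi> s)"
  then obtain p where p: "\<forall>s\<in>S. \<exists>y\<in>\<phi> s \<sqinter>\<^sub>r \<psi> s. run p (code s) = Some y"
    unfolding forces_def by blast
  show "S \<tturnstile> \<phi>" by (rule forcesI[of _ _ "Compose Fst p"]) (use p in \<open>fastforce simp: conj_r_def\<close>)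
  show "S \<tturnstile> \<psi>" by (rule forcesI[of _ _ "Compose Snd p"]) (use p in \<open>fastforce simp: conj_r_def\<close>)
next
  assume "S \<tturnstile> \<phi> \<and> S \<tturnstile> \<psi>"
  then obtain p q where "\<forall>s\<in>S. \<exists>y\<in>\<phi> s. run p (code s) = Some y"
    "\<forall>s\<in>S. \<exists>y\<in>\<psi> s. run q (code s) = Some y" unfolding forces_def by blast
  then show "S \<tturnstile> (\<lambda>s. \<phi> s \<sqinter>\<^sub>r \<psi> s)"
    by (intro forcesI[of _ _ "Pairing p q"]) (fastforce simp: conj_r_def)
qed

lemma forces_Union: "S \<tturnstile> (\<lambda>s. \<Union>x\<in>X. \<phi> s x) \<longleftrightarrow> (\<exists>x \<in> S \<rightarrow> X. S \<tturnstile> (\<lambda>s. \<phi> s (x s)))"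
proof
  assume "S \<tturnstile> (\<lambda>s. \<Union>x\<in>X. \<phi> s x)"
  then obtain p where "\<forall>s\<in>S. \<exists>x. x \<in> X \<and> (\<exists>y\<in>\<phi> s x. run p (code s) = Some y)"
    unfolding forces_def by blast
  then obtain x where "\<forall>s\<in>S. x s \<in> X \<and> (\<exists>y\<in>\<phi> s (x s). run p (code s) = Some y)"
    by (auto simp: bchoice_iff)
  then show "\<exists>x \<in> S \<rightarrow> X. S \<tturnstile> (\<lambda>s. \<phi> s (x s))" unfolding forces_def by blast
next
  assume "\<exists>x \<in> S \<rightarrow> X. S \<tturnstile> (\<lambda>s. \<phi> s (x s))"
  then show "S \<tturnstile> (\<lambda>s. \<Union>x\<in>X. \<phi> s x)" unfolding forces_def by (fastforce simp: Pi_iff)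
qed

text \<open>The two programs yield a realizer \<open>e\<close> of the implication and a realizer
  \<open>m\<close> of the premise, both varying with the environment; the universal program applies
  one to the other.\<close>

lemma forces_modus_ponens:
  assumes "S \<tturnstile> (\<lambda>s. \<phi> s \<rightarrow>\<^sub>r \<psi> s)" "S \<tturnstile> \<phi>"
  shows "S \<tturnstile> \<psi>"
proof -
  obtain U where U: "\<And>e m y. kleene_app e m = Some y \<Longrightarrow> run U (pair e m) = Some y"
    using universal_program by blast
  obtain p q where "\<forall>s\<in>S. \<exists>e\<in>\<phi> s \<rightarrow>\<^sub>r \<psi> s. run p (code s) = Some e"
    "\<forall>s\<in>S. \<exists>m\<in>\<phi> s. run q (code s) = Some m" using assms unfolding forces_def by blast
  then show ?thesis
    by (intro forcesI[of _ _ "Compose U (Pairing p q)"]) (fastforce simp: imp_r_def dest: U)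
qed

text \<open>The Kripke-Joyal clause for a universally quantified implication. From right to left it
  is tested at a single refinement, the generic one, where \<open>x\<close> and a realizer of the
  premise have been adjoined.\<close>

lemma forces_Inter_imp:
  fixes S :: "'u env set" and X :: "'u set"
  shows "S \<tturnstile> (\<lambda>s. \<Inter>x\<in>X. \<phi> s x \<rightarrow>\<^sub>r \<psi> s x) \<longleftrightarrow>
     (\<forall>S' h. refines S' S h \<longrightarrow> (\<forall>x \<in> S' \<rightarrow> X.
        S' \<tturnstile> (\<lambda>s. \<phi> (h s) (x s)) \<longrightarrow> S' \<tturnstile> (\<lambda>s. \<psi> (h s) (x s))))" (is "_ \<longleftrightarrow> ?R")
proof
  assume L: "S \<tturnstile> (\<lambda>s. \<Inter>x\<in>X. \<phi> s x \<rightarrow>\<^sub>r \<psi> s x)"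
  show ?R
  proof (intro allI impI ballI)
    fix S' h x
    assume h: "refines S' S h" and x: "x \<in> S' \<rightarrow> X" and \<phi>: "S' \<tturnstile> (\<lambda>s. \<phi> (h s) (x s))"
    from forces_mono[OF h L] have "S' \<tturnstile> (\<lambda>s. \<phi> (h s) (x s) \<rightarrow>\<^sub>r \<psi> (h s) (x s))"
      by (rule forces_subset) (rule INT_lower[OF funcset_mem[OF x]])
    from forces_modus_ponens[OF this \<phi>] show "S' \<tturnstile> (\<lambda>s. \<psi> (h s) (x s))" .
  qed
next
  assume R: ?R
  \<comment> \<open>The realizer \<open>m\<close> joins the code while \<open>x\<close> stays hidden
    in the tail. Because environments are lists, the enlarged stage lives in the same type, and
    \<open>h\<close> drops the two new entries.\<close>
  define S' where "S' = {Inr (pair (code s) m) # Inl x # s |s m x. s \<in> S \<and> x \<in> X \<and> m \<in> \<phi> s x}"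
  define x where "x = (\<lambda>s :: 'u env. projl (hd (tl s)))"
  define h where "h = (\<lambda>s :: 'u env. tl (tl s))"
  have "refines S' S h"
    unfolding refines_def by (auto simp: S'_def h_def code_def intro!: exI[of _ Fst])
  moreover have "x \<in> S' \<rightarrow> X" by (auto simp: S'_def x_def)
  moreover have "S' \<tturnstile> (\<lambda>s. \<phi> (h s) (x s))"
    by (rule forcesI[of _ _ Snd]) (auto simp: S'_def h_def x_def code_def)
  ultimately have "S' \<tturnstile> (\<lambda>s. \<psi> (h s) (x s))" using R by blast
  then obtain p where "\<forall>s\<in>S'. \<exists>y\<in>\<psi> (h s) (x s). run p (code s) = Some y"
    unfolding forces_def by blast
  then have p: "\<exists>y\<in>\<psi> s x. run p (pair (code s) m) = Some y" if "s \<in> S" "x \<in> X" "m \<in> \<phi> s x" for s x m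
    using that unfolding S'_def h_def x_def code_def by fastforce
  \<comment> \<open>Currying: \<open>p\<close> takes the old code and \<open>m\<close> together;
    \<open>e\<close> maps the old code to a realizer that waits for \<open>m\<close>, uniformly in
    \<open>x\<close>.\<close>
  obtain e where e: "computable e" "\<And>a m. kleene_app (e a) m = run p (pair a m)" using smn by blast
  then obtain q where "\<forall>a. run q a = Some (e a)" unfolding computable_def by blast
  with p e(2) show "S \<tturnstile> (\<lambda>s. \<Inter>x\<in>X. \<phi> s x \<rightarrow>\<^sub>r \<psi> s x)"
    by (intro forcesI[of _ _ q]) (auto simp: imp_r_def)
qed

section \<open>Validity of closed formulas, tested on generic elements\<close>

lemma realizes_le_forces:
  assumes "realizes_le X \<phi> \<psi>" "x \<in> S \<rightarrow> X" "S \<tturnstile> (\<lambda>s. \<phi> (x s))"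
  shows "S \<tturnstile> (\<lambda>s. \<psi> (x s))"
proof -
  obtain e where e: "\<forall>x\<in>X. \<forall>a\<in>\<phi> x. \<exists>y\<in>\<psi> x. kleene_app e a = Some y"
    using assms(1) unfolding realizes_le_def by blast
  obtain p where "e = godel p" using surj_godel by (metis surjD)
  moreover obtain q where "\<forall>s\<in>S. \<exists>y\<in>\<phi> (x s). run q (code s) = Some y"
    using assms(3) unfolding forces_def by blast
  ultimately show ?thesis using e assms(2)
    by (intro forcesI[of _ _ "Compose p q"]) (fastforce simp: Pi_iff)
qed

text \<open>The universal test is the stage of all pairs of a list and a realizer, with the realizer
  as code and the list as tail. Tuples of labels are coded as lists because this is the form in
  which an environment can store them.\<close>

lemma realizes_le_list:
  fixes L :: "'u list set"
  assumes "\<And>S (l :: 'u env \<Rightarrow> 'u list). l \<in> S \<rightarrow> L \<Longrightarrow> S \<tturnstile> (\<lambda>s. \<phi> (l s)) \<Longrightarrow> S \<tturnstile> (\<lambda>s. \<psi> (l s))"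
  shows "realizes_le L \<phi> \<psi>"
proof -
  define S where "S = {Inr m # map Inl l |m l. l \<in> L \<and> m \<in> \<phi> l}"
  define l where "l = (\<lambda>s :: 'u env. map projl (tl s))"
  have "l \<in> S \<rightarrow> L" by (auto simp: S_def l_def comp_def)
  moreover have "S \<tturnstile> (\<lambda>s. \<phi> (l s))"
    by (rule forcesI[of _ _ "Pairing Fst Snd"]) (auto simp: S_def l_def comp_def code_def)
  ultimately have "S \<tturnstile> (\<lambda>s. \<psi> (l s))" by (rule assms)
  then obtain p where "\<forall>s\<in>S. \<exists>y\<in>\<psi> (l s). run p (code s) = Some y" unfolding forces_def by blast
  then have "\<exists>y\<in>\<psi> l. kleene_app (godel p) m = Some y" if "l \<in> L" "m \<in> \<phi> l" for l m
    using that by (fastforce simp: S_def l_def code_def comp_def)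
  then show ?thesis unfolding realizes_le_def by blast
qed

text \<open>The realizers of such a sentence are exactly the numbers that witness an inequality in
  the realizability order. The versions for more variables differ in the length of the list.\<close>

lemma valid_Inter1:
  fixes A :: "'u set"
  shows "valid (\<Inter>a\<in>A. \<phi> a \<rightarrow>\<^sub>r \<psi> a) \<longleftrightarrow>
    (\<forall>S :: 'u env set. \<forall>a \<in> S \<rightarrow> A. S \<tturnstile> (\<lambda>s. \<phi> (a s)) \<longrightarrow> S \<tturnstile> (\<lambda>s. \<psi> (a s)))" (is "_ \<longleftrightarrow> ?R")
proof -
  have "valid (\<Inter>a\<in>A. \<phi> a \<rightarrow>\<^sub>r \<psi> a) \<longleftrightarrow> realizes_le A \<phi> \<psi>"
    unfolding valid_def realizes_le_def imp_r_def ex_in_conv[symmetric] by simp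
  also have "\<dots> \<longleftrightarrow> ?R"
  proof (intro iffI allI ballI impI)
    assume R: ?R
    have "realizes_le ((\<lambda>a. [a]) ` A) (\<lambda>l. \<phi> (l ! 0)) (\<lambda>l. \<psi> (l ! 0))"
    proof (rule realizes_le_list)
      fix S and l :: "'u env \<Rightarrow> 'u list"
      assume l: "l \<in> S \<rightarrow> (\<lambda>a. [a]) ` A" and \<phi>: "S \<tturnstile> (\<lambda>s. \<phi> (l s ! 0))"
      have "(\<lambda>s. l s ! 0) \<in> S \<rightarrow> A"
        using funcset_mem[OF l] by fastforce
      then show "S \<tturnstile> (\<lambda>s. \<psi> (l s ! 0))" by (rule R[rule_format, OF _ \<phi>])
    qed
    then show "realizes_le A \<phi> \<psi>" unfolding realizes_le_def by auto
  qed (rule realizes_le_forces)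
  finally show ?thesis .
qed

lemma realizes_le_Times2:
  fixes A B :: "'u set"
  shows "realizes_le (A \<times> B) \<phi> \<psi> \<longleftrightarrow>
    (\<forall>S :: 'u env set. \<forall>a \<in> S \<rightarrow> A. \<forall>b \<in> S \<rightarrow> B.
       S \<tturnstile> (\<lambda>s. \<phi> (a s, b s)) \<longrightarrow> S \<tturnstile> (\<lambda>s. \<psi> (a s, b s)))" (is "_ \<longleftrightarrow> ?R")
proof (intro iffI allI ballI impI)
  assume R: ?R
  let ?L = "(\<lambda>(a, b). [a, b]) ` (A \<times> B)"
  have "realizes_le ?L (\<lambda>l. \<phi> (l ! 0, l ! 1)) (\<lambda>l. \<psi> (l ! 0, l ! 1))"
  proof (rule realizes_le_list)
    fix S and l :: "'u env \<Rightarrow> 'u list"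
    assume l: "l \<in> S \<rightarrow> ?L" and \<phi>: "S \<tturnstile> (\<lambda>s. \<phi> (l s ! 0, l s ! 1))"
    have "\<exists>a\<in>A. \<exists>b\<in>B. l s = [a, b]" if "s \<in> S" for s
      using funcset_mem[OF l that] by auto
    then have "(\<lambda>s. l s ! 0) \<in> S \<rightarrow> A" "(\<lambda>s. l s ! 1) \<in> S \<rightarrow> B" by fastforce+
    then show "S \<tturnstile> (\<lambda>s. \<psi> (l s ! 0, l s ! 1))" by (rule R[rule_format, OF _ _ \<phi>])
  qed
  then show "realizes_le (A \<times> B) \<phi> \<psi>" unfolding realizes_le_def by auto
next
  fix S :: "'u env set" and a b
  assume "realizes_le (A \<times> B) \<phi> \<psi>" "a \<in> S \<rightarrow> A" "b \<in> S \<rightarrow> B" "S \<tturnstile> (\<lambda>s. \<phi> (a s, b s))"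
  then show "S \<tturnstile> (\<lambda>s. \<psi> (a s, b s))"
    using realizes_le_forces[of "A \<times> B" \<phi> \<psi> "\<lambda>s. (a s, b s)" S] by auto
qed

lemma valid_Inter2:
  fixes A B :: "'u set"
  shows "valid (\<Inter>a\<in>A. \<Inter>b\<in>B. \<phi> a b \<rightarrow>\<^sub>r \<psi> a b) \<longleftrightarrow>
    (\<forall>S :: 'u env set. \<forall>a \<in> S \<rightarrow> A. \<forall>b \<in> S \<rightarrow> B.
       S \<tturnstile> (\<lambda>s. \<phi> (a s) (b s)) \<longrightarrow> S \<tturnstile> (\<lambda>s. \<psi> (a s) (b s)))" (is "_ \<longleftrightarrow> ?R")
proof -
  have "valid (\<Inter>a\<in>A. \<Inter>b\<in>B. \<phi> a b \<rightarrow>\<^sub>r \<psi> a b) \<longleftrightarrow>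
      realizes_le (A \<times> B) (\<lambda>(a, b). \<phi> a b) (\<lambda>(a, b). \<psi> a b)"
    unfolding valid_def realizes_le_def imp_r_def ex_in_conv[symmetric] by simp
  then show ?thesis by (simp add: realizes_le_Times2)
qed

lemma valid_Inter3:
  fixes A B C :: "'u set"
  shows "valid (\<Inter>a\<in>A. \<Inter>b\<in>B. \<Inter>c\<in>C. \<phi> a b c \<rightarrow>\<^sub>r \<psi> a b c) \<longleftrightarrow>
    (\<forall>S :: 'u env set. \<forall>a \<in> S \<rightarrow> A. \<forall>b \<in> S \<rightarrow> B. \<forall>c \<in> S \<rightarrow> C.
       S \<tturnstile> (\<lambda>s. \<phi> (a s) (b s) (c s)) \<longrightarrow> S \<tturnstile> (\<lambda>s. \<psi> (a s) (b s) (c s)))" (is "_ \<longleftrightarrow> ?R")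
proof -
  have "valid (\<Inter>a\<in>A. \<Inter>b\<in>B. \<Inter>c\<in>C. \<phi> a b c \<rightarrow>\<^sub>r \<psi> a b c) \<longleftrightarrow>
      realizes_le (A \<times> B \<times> C) (\<lambda>(a, b, c). \<phi> a b c) (\<lambda>(a, b, c). \<psi> a b c)"
    unfolding valid_def realizes_le_def imp_r_def ex_in_conv[symmetric] by simp
  also have "\<dots> \<longleftrightarrow> ?R"
  proof (intro iffI allI ballI impI)
    assume R: ?R
    let ?L = "(\<lambda>(a, b, c). [a, b, c]) ` (A \<times> B \<times> C)"
    have "realizes_le ?L (\<lambda>l. \<phi> (l ! 0) (l ! 1) (l ! 2)) (\<lambda>l. \<psi> (l ! 0) (l ! 1) (l ! 2))"
    proof (rule realizes_le_list)
      fix S and l :: "'u env \<Rightarrow> 'u list"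
      assume l: "l \<in> S \<rightarrow> ?L" and \<phi>: "S \<tturnstile> (\<lambda>s. \<phi> (l s ! 0) (l s ! 1) (l s ! 2))"
      have "\<exists>a\<in>A. \<exists>b\<in>B. \<exists>c\<in>C. l s = [a, b, c]" if "s \<in> S" for s
        using funcset_mem[OF l that] by auto
      then have "(\<lambda>s. l s ! 0) \<in> S \<rightarrow> A" "(\<lambda>s. l s ! 1) \<in> S \<rightarrow> B" "(\<lambda>s. l s ! 2) \<in> S \<rightarrow> C"
        by fastforce+
      then show "S \<tturnstile> (\<lambda>s. \<psi> (l s ! 0) (l s ! 1) (l s ! 2))" by (rule R[rule_format, OF _ _ _ \<phi>])
    qed
    then show "realizes_le (A \<times> B \<times> C) (\<lambda>(a, b, c). \<phi> a b c) (\<lambda>(a, b, c). \<psi> a b c)"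
      unfolding realizes_le_def by auto
  next
    fix S :: "'u env set" and a b c
    assume "realizes_le (A \<times> B \<times> C) (\<lambda>(a, b, c). \<phi> a b c) (\<lambda>(a, b, c). \<psi> a b c)"
      "a \<in> S \<rightarrow> A" "b \<in> S \<rightarrow> B" "c \<in> S \<rightarrow> C" "S \<tturnstile> (\<lambda>s. \<phi> (a s) (b s) (c s))"
    then show "S \<tturnstile> (\<lambda>s. \<psi> (a s) (b s) (c s))"
      using realizes_le_forces[of "A \<times> B \<times> C" "\<lambda>(a, b, c). \<phi> a b c" "\<lambda>(a, b, c). \<psi> a b c"
        "\<lambda>s. (a s, b s, c s)" S] by (simp add: Pi_iff)
  qed
  finally show ?thesis .
qed

lemma valid_Inter4:
  fixes A B C D :: "'u set"
  shows "valid (\<Inter>a\<in>A. \<Inter>b\<in>B. \<Inter>c\<in>C. \<Inter>d\<in>D. \<phi> a b c d \<rightarrow>\<^sub>r \<psi> a b c d) \<longleftrightarrow>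
    (\<forall>S :: 'u env set. \<forall>a \<in> S \<rightarrow> A. \<forall>b \<in> S \<rightarrow> B. \<forall>c \<in> S \<rightarrow> C. \<forall>d \<in> S \<rightarrow> D.
       S \<tturnstile> (\<lambda>s. \<phi> (a s) (b s) (c s) (d s)) \<longrightarrow> S \<tturnstile> (\<lambda>s. \<psi> (a s) (b s) (c s) (d s)))" (is "_ \<longleftrightarrow> ?R")
proof -
  have "valid (\<Inter>a\<in>A. \<Inter>b\<in>B. \<Inter>c\<in>C. \<Inter>d\<in>D. \<phi> a b c d \<rightarrow>\<^sub>r \<psi> a b c d) \<longleftrightarrow>
      realizes_le (A \<times> B \<times> C \<times> D) (\<lambda>(a, b, c, d). \<phi> a b c d) (\<lambda>(a, b, c, d). \<psi> a b c d)"
    unfolding valid_def realizes_le_def imp_r_def ex_in_conv[symmetric] by simp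
  also have "\<dots> \<longleftrightarrow> ?R"
  proof (intro iffI allI ballI impI)
    assume R: ?R
    let ?L = "(\<lambda>(a, b, c, d). [a, b, c, d]) ` (A \<times> B \<times> C \<times> D)"
    have "realizes_le ?L (\<lambda>l. \<phi> (l ! 0) (l ! 1) (l ! 2) (l ! 3)) (\<lambda>l. \<psi> (l ! 0) (l ! 1) (l ! 2) (l ! 3))"
    proof (rule realizes_le_list)
      fix S and l :: "'u env \<Rightarrow> 'u list"
      assume l: "l \<in> S \<rightarrow> ?L" and \<phi>: "S \<tturnstile> (\<lambda>s. \<phi> (l s ! 0) (l s ! 1) (l s ! 2) (l s ! 3))"
      have "\<exists>a\<in>A. \<exists>b\<in>B. \<exists>c\<in>C. \<exists>d\<in>D. l s = [a, b, c, d]" if "s \<in> S" for s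
        using funcset_mem[OF l that] by auto
      then have "(\<lambda>s. l s ! 0) \<in> S \<rightarrow> A" "(\<lambda>s. l s ! 1) \<in> S \<rightarrow> B" "(\<lambda>s. l s ! 2) \<in> S \<rightarrow> C"
        "(\<lambda>s. l s ! 3) \<in> S \<rightarrow> D"
        by fastforce+
      then show "S \<tturnstile> (\<lambda>s. \<psi> (l s ! 0) (l s ! 1) (l s ! 2) (l s ! 3))" by (rule R[rule_format, OF _ _ _ _ \<phi>])
    qed
    then show "realizes_le (A \<times> B \<times> C \<times> D) (\<lambda>(a, b, c, d). \<phi> a b c d) (\<lambda>(a, b, c, d). \<psi> a b c d)"
      unfolding realizes_le_def by auto
  next
    fix S :: "'u env set" and a b c d
    assume "realizes_le (A \<times> B \<times> C \<times> D) (\<lambda>(a, b, c, d). \<phi> a b c d) (\<lambda>(a, b, c, d). \<psi> a b c d)"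
      "a \<in> S \<rightarrow> A" "b \<in> S \<rightarrow> B" "c \<in> S \<rightarrow> C" "d \<in> S \<rightarrow> D" "S \<tturnstile> (\<lambda>s. \<phi> (a s) (b s) (c s) (d s))"
    then show "S \<tturnstile> (\<lambda>s. \<psi> (a s) (b s) (c s) (d s))"
      using realizes_le_forces[of "A \<times> B \<times> C \<times> D" "\<lambda>(a, b, c, d). \<phi> a b c d"
        "\<lambda>(a, b, c, d). \<psi> a b c d" "\<lambda>s. (a s, b s, c s, d s)" S] by (simp add: Pi_iff)
  qed
  finally show ?thesis .
qed


section \<open>Generic elements of objects and arrows\<close>

text \<open>The diagonal case \<open>eqv S X a a\<close> plays the role of existence: it says that
  \<open>a\<close> is a generic element of \<open>X\<close> at stage \<open>S\<close>.\<close>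

definition eqv :: "'u env set \<Rightarrow> 'u eff_obj \<Rightarrow> ('u env \<Rightarrow> 'u) \<Rightarrow> ('u env \<Rightarrow> 'u) \<Rightarrow> bool" where
  "eqv S X a b \<longleftrightarrow> a \<in> S \<rightarrow> fst X \<and> b \<in> S \<rightarrow> fst X \<and> S \<tturnstile> (\<lambda>s. snd X (a s, b s))"

definition rel :: "'u env set \<Rightarrow> 'u set \<Rightarrow> 'u set \<Rightarrow> ('u \<times> 'u \<Rightarrow> nat set) \<Rightarrow>
    ('u env \<Rightarrow> 'u) \<Rightarrow> ('u env \<Rightarrow> 'u) \<Rightarrow> bool" where
  "rel S A B F a b \<longleftrightarrow> a \<in> S \<rightarrow> A \<and> b \<in> S \<rightarrow> B \<and> S \<tturnstile> (\<lambda>s. F (a s, b s))"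

text \<open>The graph of an arrow at a stage. All representatives of the class force the same pairs
  (\<open>app_mk_arrow\<close>), so asking for one is harmless.\<close>

definition app :: "'u env set \<Rightarrow> 'u eff_arr \<Rightarrow> ('u env \<Rightarrow> 'u) \<Rightarrow> ('u env \<Rightarrow> 'u) \<Rightarrow> bool" where
  "app S f a b \<longleftrightarrow> (\<exists>F \<in> fst (snd f). rel S (fst (fst f)) (fst (snd (snd f))) F a b)"

lemma eff_simps [simp]:
  "Obj eff = eff_objects" "Arr eff = eff_arrows" "Comp eff = eff_comp"
  "Dom eff (X, c, Y) = X" "Cod eff (X, c, Y) = Y"
  "Id eff X = (X, rel_class (fst X) (fst X) (snd X), X)"
  by (simp_all add: eff_def)

text \<open>With this and \<open>functional_relation_iff\<close>, objects and arrows are handled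
  through generic elements, without mention of numbers.\<close>

lemma eff_objects_iff:
  "X \<in> eff_objects \<longleftrightarrow> fst X \<prec> (UNIV :: 'u set) \<and> snd X \<in> fst X \<times> fst X \<rightarrow>\<^sub>E UNIV \<and>
     (\<forall>(S :: 'u env set) a b. eqv S X a b \<longrightarrow> eqv S X b a) \<and>
     (\<forall>(S :: 'u env set) a b c. eqv S X a b \<longrightarrow> eqv S X b c \<longrightarrow> eqv S X a c)"
proof -
  have "(\<forall>(S :: 'u env set) a b. eqv S X a b \<longrightarrow> eqv S X b a) \<longleftrightarrow>
     valid (\<Inter>x\<in>fst X. \<Inter>y\<in>fst X. snd X (x, y) \<rightarrow>\<^sub>r snd X (y, x))"
    unfolding valid_Inter2 eqv_def by blast
  moreover have "(\<forall>(S :: 'u env set) a b c. eqv S X a b \<longrightarrow> eqv S X b c \<longrightarrow> eqv S X a c) \<longleftrightarrow>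
     valid (\<Inter>x\<in>fst X. \<Inter>y\<in>fst X. \<Inter>z\<in>fst X. snd X (x, y) \<sqinter>\<^sub>r snd X (y, z) \<rightarrow>\<^sub>r snd X (x, z))"
    unfolding valid_Inter3 eqv_def forces_conj by blast
  ultimately show ?thesis by (simp add: eff_objects_def partial_equivalence_def case_prod_beta)
qed

lemma functional_relation_iff:
  "functional_relation X Y F \<longleftrightarrow> F \<in> fst X \<times> fst Y \<rightarrow>\<^sub>E UNIV \<and>
     (\<forall>(S :: 'u env set) a b. rel S (fst X) (fst Y) F a b \<longrightarrow> eqv S X a a \<and> eqv S Y b b) \<and>
     (\<forall>(S :: 'u env set) a a' b b'. rel S (fst X) (fst Y) F a b \<longrightarrow> eqv S X a a' \<longrightarrow> eqv S Y b b' \<longrightarrow>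
        rel S (fst X) (fst Y) F a' b') \<and>
     (\<forall>(S :: 'u env set) a b b'. rel S (fst X) (fst Y) F a b \<longrightarrow> rel S (fst X) (fst Y) F a b' \<longrightarrow> eqv S Y b b') \<and>
     (\<forall>(S :: 'u env set) a. eqv S X a a \<longrightarrow> (\<exists>b. rel S (fst X) (fst Y) F a b))"
proof -
  obtain A \<rho> B \<sigma> where X: "X = (A, \<rho>)" and Y: "Y = (B, \<sigma>)" by fastforce
  have "valid (\<Inter>a\<in>A. \<Inter>b\<in>B. F (a, b) \<rightarrow>\<^sub>r \<rho> (a, a) \<sqinter>\<^sub>r \<sigma> (b, b)) \<longleftrightarrow>
      (\<forall>(S :: 'u env set) a b. rel S A B F a b \<longrightarrow> eqv S X a a \<and> eqv S Y b b)"
    unfolding valid_Inter2 eqv_def rel_def forces_conj X Y fst_conv snd_conv by blast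
  moreover have "valid (\<Inter>a\<in>A. \<Inter>a'\<in>A. \<Inter>b\<in>B. \<Inter>b'\<in>B.
              F (a, b) \<sqinter>\<^sub>r \<rho> (a, a') \<sqinter>\<^sub>r \<sigma> (b, b') \<rightarrow>\<^sub>r F (a', b')) \<longleftrightarrow>
      (\<forall>(S :: 'u env set) a a' b b'. rel S A B F a b \<longrightarrow> eqv S X a a' \<longrightarrow> eqv S Y b b' \<longrightarrow> rel S A B F a' b')"
    unfolding valid_Inter4 eqv_def rel_def forces_conj X Y fst_conv snd_conv by blast
  moreover have "valid (\<Inter>a\<in>A. \<Inter>b\<in>B. \<Inter>b'\<in>B. F (a, b) \<sqinter>\<^sub>r F (a, b') \<rightarrow>\<^sub>r \<sigma> (b, b')) \<longleftrightarrow>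
      (\<forall>(S :: 'u env set) a b b'. rel S A B F a b \<longrightarrow> rel S A B F a b' \<longrightarrow> eqv S Y b b')"
    unfolding valid_Inter3 eqv_def rel_def forces_conj X Y fst_conv snd_conv by blast
  \<comment> \<open>The union on the right becomes a generic value \<open>b\<close> at the same
    stage; this is where totality starts to behave like that of a function.\<close>
  moreover have "valid (\<Inter>a\<in>A. \<rho> (a, a) \<rightarrow>\<^sub>r (\<Union>b\<in>B. F (a, b))) \<longleftrightarrow>
      (\<forall>(S :: 'u env set) a. eqv S X a a \<longrightarrow> (\<exists>b. rel S A B F a b))"
    unfolding valid_Inter1 eqv_def rel_def forces_Union X Y fst_conv snd_conv by blast
  ultimately show ?thesis by (simp add: X Y)
qed

lemma eff_objects_small: "X \<in> eff_objects \<Longrightarrow> fst X \<prec> (UNIV :: 'u set)" for X :: "'u eff_obj"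
  by (simp only: eff_objects_iff)

lemma eff_objects_PiE: "X \<in> eff_objects \<Longrightarrow> snd X \<in> fst X \<times> fst X \<rightarrow>\<^sub>E UNIV"
  by (simp only: eff_objects_iff)

lemma eqv_sym: "X \<in> eff_objects \<Longrightarrow> eqv S X a b \<Longrightarrow> eqv S X b a"
  unfolding eff_objects_iff by blast

lemma eqv_trans: "X \<in> eff_objects \<Longrightarrow> eqv S X a b \<Longrightarrow> eqv S X b c \<Longrightarrow> eqv S X a c"
  unfolding eff_objects_iff by blast

lemma eqv_refl1: "X \<in> eff_objects \<Longrightarrow> eqv S X a b \<Longrightarrow> eqv S X a a"
  by (blast intro: eqv_sym eqv_trans)

lemma eqv_refl2: "X \<in> eff_objects \<Longrightarrow> eqv S X a b \<Longrightarrow> eqv S X b b"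
  by (blast intro: eqv_sym eqv_trans)

lemma eqv_mono:
  assumes "refines S' S h" "eqv S X a b"
  shows "eqv S' X (\<lambda>s. a (h s)) (\<lambda>s. b (h s))"
  using assms forces_mono[OF assms(1), of "\<lambda>s. snd X (a s, b s)"] refines_in[OF assms(1)]
  unfolding eqv_def Pi_iff by blast

lemma rel_mono:
  assumes "refines S' S h" "rel S A B F a b"
  shows "rel S' A B F (\<lambda>s. a (h s)) (\<lambda>s. b (h s))"
  using assms forces_mono[OF assms(1), of "\<lambda>s. F (a s, b s)"] refines_in[OF assms(1)]
  unfolding rel_def Pi_iff by blast

lemma app_mono: "refines S' S h \<Longrightarrow> app S f a b \<Longrightarrow> app S' f (\<lambda>s. a (h s)) (\<lambda>s. b (h s))"
  unfolding app_def by (blast intro: rel_mono)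

lemma realizes_le_rel:
  fixes A B :: "'u set"
  shows "realizes_le (A \<times> B) F G \<longleftrightarrow> (\<forall>(S :: 'u env set) a b. rel S A B F a b \<longrightarrow> rel S A B G a b)"
  unfolding realizes_le_Times2 rel_def by blast

lemma rel_class_self: "F \<in> A \<times> B \<rightarrow>\<^sub>E UNIV \<Longrightarrow> F \<in> rel_class A B F"
  unfolding rel_class_def by (simp add: realizes_le_rel)

lemma rel_class_cong:
  fixes A B :: "'u set"
  assumes "\<And>(S :: 'u env set) a b. rel S A B F a b \<longleftrightarrow> rel S A B G a b"
  shows "rel_class A B F = rel_class A B G"
  unfolding rel_class_def realizes_le_rel assms ..

subsection \<open>Arrows and objects from formulas\<close>

text \<open>The restriction puts an arbitrary formula into the extensional function space; by
  \<open>rel_restrict\<close> generic elements do not notice it.\<close>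

definition mk_arrow :: "'u eff_obj \<Rightarrow> 'u eff_obj \<Rightarrow> ('u \<times> 'u \<Rightarrow> nat set) \<Rightarrow> 'u eff_arr" where
  "mk_arrow X Y F = (X, rel_class (fst X) (fst Y) (restrict F (fst X \<times> fst Y)), Y)"

definition mk_object :: "'u set \<Rightarrow> ('u \<times> 'u \<Rightarrow> nat set) \<Rightarrow> 'u eff_obj" where
  "mk_object A \<rho> = (A, restrict \<rho> (A \<times> A))"

lemma rel_restrict [simp]: "rel S A B (restrict F (A \<times> B)) a b \<longleftrightarrow> rel S A B F a b"
  unfolding rel_def by (auto simp: Pi_iff elim!: forces_subset)

lemma app_mk_arrow: "app S (mk_arrow X Y F) a b \<longleftrightarrow> rel S (fst X) (fst Y) F a b"
proof
  assume "app S (mk_arrow X Y F) a b"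
  then obtain G where "G \<in> rel_class (fst X) (fst Y) (restrict F (fst X \<times> fst Y))"
    "rel S (fst X) (fst Y) G a b" unfolding app_def mk_arrow_def by auto
  then have "rel S (fst X) (fst Y) (restrict F (fst X \<times> fst Y)) a b"
    unfolding rel_class_def realizes_le_rel by blast
  then show "rel S (fst X) (fst Y) F a b" by simp
next
  assume "rel S (fst X) (fst Y) F a b"
  then have "rel S (fst X) (fst Y) (restrict F (fst X \<times> fst Y)) a b" by simp
  then show "app S (mk_arrow X Y F) a b"
    unfolding app_def mk_arrow_def fst_conv snd_conv
    by (intro bexI[of _ "restrict F (fst X \<times> fst Y)"] rel_class_self) simp_all
qed

lemma eqv_mk_object:
  "eqv S (mk_object A \<rho>) a b \<longleftrightarrow> a \<in> S \<rightarrow> A \<and> b \<in> S \<rightarrow> A \<and> S \<tturnstile> (\<lambda>s. \<rho> (a s, b s))"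
  using rel_restrict[of S A A \<rho> a b] unfolding eqv_def mk_object_def rel_def by simp

lemma mk_object_eff_objects:
  assumes "A \<prec> (UNIV :: 'u set)"
    "\<And>(S :: 'u env set) a b. eqv S (mk_object A \<rho>) a b \<Longrightarrow> eqv S (mk_object A \<rho>) b a"
    "\<And>(S :: 'u env set) a b c. eqv S (mk_object A \<rho>) a b \<Longrightarrow> eqv S (mk_object A \<rho>) b c \<Longrightarrow>
       eqv S (mk_object A \<rho>) a c"
  shows "mk_object A \<rho> \<in> eff_objects"
  unfolding eff_objects_iff
proof (intro conjI allI impI)
  show "fst (mk_object A \<rho>) \<prec> (UNIV :: 'u set)" using assms(1) by (simp add: mk_object_def)
qed (rule assms(2) assms(3), assumption+ | simp add: mk_object_def)+

text \<open>Gives every arrow a formula as representative, so that its graph can occur inside the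
  formula of a new object or arrow.\<close>

lemma hom_iff: "f \<in> hom eff X Y \<longleftrightarrow> X \<in> eff_objects \<and> Y \<in> eff_objects \<and>
    (\<exists>F. f = mk_arrow X Y F \<and> functional_relation X Y (restrict F (fst X \<times> fst Y)))"
proof
  assume "f \<in> hom eff X Y"
  then obtain F where F: "f = (X, rel_class (fst X) (fst Y) F, Y)" "X \<in> eff_objects" "Y \<in> eff_objects"
    "functional_relation X Y F" unfolding hom_def by (auto simp: eff_arrows_def)
  have *: "restrict F (fst X \<times> fst Y) = F"
    by (rule PiE_restrict, rule conjunct1[OF iffD1[OF functional_relation_iff F(4)]])
  have "f = mk_arrow X Y F" unfolding F(1) mk_arrow_def * ..
  with F(2-4) show "X \<in> eff_objects \<and> Y \<in> eff_objects \<and>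
    (\<exists>F. f = mk_arrow X Y F \<and> functional_relation X Y (restrict F (fst X \<times> fst Y)))"
    by (intro conjI exI[of _ F]) (simp_all only: *)
next
  assume "X \<in> eff_objects \<and> Y \<in> eff_objects \<and>
    (\<exists>F. f = mk_arrow X Y F \<and> functional_relation X Y (restrict F (fst X \<times> fst Y)))"
  then obtain F where F: "f = mk_arrow X Y F" and "functional_relation X Y (restrict F (fst X \<times> fst Y))"
    "X \<in> eff_objects" "Y \<in> eff_objects" by blast
  then have "f \<in> eff_arrows"
    unfolding eff_arrows_def mem_Collect_eq mk_arrow_def by metis
  then show "f \<in> hom eff X Y" by (simp add: hom_def F mk_arrow_def)
qed

lemma mk_arrow_hom:
  fixes X Y :: "'u eff_obj"
  assumes "X \<in> eff_objects" "Y \<in> eff_objects"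
    "\<And>(S :: 'u env set) a b. rel S (fst X) (fst Y) F a b \<Longrightarrow> eqv S X a a \<and> eqv S Y b b"
    "\<And>(S :: 'u env set) a a' b b'. rel S (fst X) (fst Y) F a b \<Longrightarrow> eqv S X a a' \<Longrightarrow> eqv S Y b b' \<Longrightarrow>
       rel S (fst X) (fst Y) F a' b'"
    "\<And>(S :: 'u env set) a b b'. rel S (fst X) (fst Y) F a b \<Longrightarrow> rel S (fst X) (fst Y) F a b' \<Longrightarrow> eqv S Y b b'"
    "\<And>(S :: 'u env set) a. eqv S X a a \<Longrightarrow> \<exists>b. rel S (fst X) (fst Y) F a b"
  shows "mk_arrow X Y F \<in> hom eff X Y"
proof -
  have "functional_relation X Y (restrict F (fst X \<times> fst Y))"
    unfolding functional_relation_iff rel_restrict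
  proof (intro conjI allI impI)
    show "restrict F (fst X \<times> fst Y) \<in> fst X \<times> fst Y \<rightarrow>\<^sub>E UNIV" by simp
  qed (rule conjunct1[OF assms(3)] conjunct2[OF assms(3)] assms(4-6), assumption+)+
  then show ?thesis unfolding hom_iff using assms(1,2) by blast
qed

lemma hom_objects: "f \<in> hom eff X Y \<Longrightarrow> X \<in> eff_objects" "f \<in> hom eff X Y \<Longrightarrow> Y \<in> eff_objects"
  unfolding hom_iff by blast+

lemma
  assumes "f \<in> hom eff X Y"
  shows app_eqv1: "app S f a b \<Longrightarrow> eqv S X a a"
    and app_eqv2: "app S f a b \<Longrightarrow> eqv S Y b b"
    and app_cong: "app S f a b \<Longrightarrow> eqv S X a a' \<Longrightarrow> eqv S Y b b' \<Longrightarrow> app S f a' b'"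
    and app_unique: "app S f a b \<Longrightarrow> app S f a b' \<Longrightarrow> eqv S Y b b'"
    and app_total: "eqv S X a a \<Longrightarrow> \<exists>b. app S f a b"
proof -
  obtain F where f: "f = mk_arrow X Y F" and F: "functional_relation X Y (restrict F (fst X \<times> fst Y))"
    using assms unfolding hom_iff by blast
  note F = F[unfolded functional_relation_iff rel_restrict]
  show "app S f a b \<Longrightarrow> eqv S X a a" "app S f a b \<Longrightarrow> eqv S Y b b"
    "app S f a b \<Longrightarrow> eqv S X a a' \<Longrightarrow> eqv S Y b b' \<Longrightarrow> app S f a' b'"
    "app S f a b \<Longrightarrow> app S f a b' \<Longrightarrow> eqv S Y b b'"
    "eqv S X a a \<Longrightarrow> \<exists>b. app S f a b"
    unfolding f app_mk_arrow
    using F[THEN conjunct2, THEN conjunct1, rule_format, of S a b]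
      F[THEN conjunct2, THEN conjunct2, THEN conjunct1, rule_format, of S a b a' b']
      F[THEN conjunct2, THEN conjunct2, THEN conjunct2, THEN conjunct1, rule_format, of S a b b']
      F[THEN conjunct2, THEN conjunct2, THEN conjunct2, THEN conjunct2, rule_format, of S a]
    by simp_all
qed

lemma app_cong1: "f \<in> hom eff X Y \<Longrightarrow> app S f a b \<Longrightarrow> eqv S X a a' \<Longrightarrow> app S f a' b"
  by (blast intro: app_cong app_eqv2)

lemma app_cong2: "f \<in> hom eff X Y \<Longrightarrow> app S f a b \<Longrightarrow> eqv S Y b b' \<Longrightarrow> app S f a b'"
  by (blast intro: app_cong app_eqv1)

text \<open>One inclusion of graphs is enough: totality of \<open>f\<close> provides a value, and
  single-valuedness of \<open>g\<close> identifies it with the given one.\<close>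

lemma app_ext:
  fixes X Y :: "'u eff_obj"
  assumes f: "f \<in> hom eff X Y" and g: "g \<in> hom eff X Y"
    and le: "\<And>(S :: 'u env set) a b. app S f a b \<Longrightarrow> app S g a b"
  shows "f = g"
proof -
  have le': "app S f a b" if "app S g a b" for S :: "'u env set" and a b
  proof -
    from app_total[OF f app_eqv1[OF g that]] obtain b' where b': "app S f a b'" ..
    from app_unique[OF g le[OF b'] that] show ?thesis by (rule app_cong2[OF f b'])
  qed
  obtain F G where F: "f = mk_arrow X Y F" and G: "g = mk_arrow X Y G"
    using f g unfolding hom_iff by blast
  have "rel_class (fst X) (fst Y) (restrict F (fst X \<times> fst Y)) = rel_class (fst X) (fst Y) (restrict G (fst X \<times> fst Y))"
    by (rule rel_class_cong, unfold rel_restrict, rule iffI)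
      (rule le[unfolded F G app_mk_arrow] le'[unfolded F G app_mk_arrow], assumption)+
  then show ?thesis by (simp add: F G mk_arrow_def)
qed

subsection \<open>The category structure\<close>

lemma Id_mk_arrow: "X \<in> eff_objects \<Longrightarrow> Id eff X = mk_arrow X X (snd X)"
proof -
  assume "X \<in> eff_objects"
  then have "restrict (snd X) (fst X \<times> fst X) = snd X"
    by (rule PiE_restrict[OF eff_objects_PiE])
  then show ?thesis by (simp add: mk_arrow_def)
qed

lemma app_Id: "X \<in> eff_objects \<Longrightarrow> app S (Id eff X) a b \<longleftrightarrow> eqv S X a b"
  unfolding Id_mk_arrow app_mk_arrow rel_def eqv_def ..

lemma Id_hom: "X \<in> eff_objects \<Longrightarrow> Id eff X \<in> hom eff X X"
  unfolding Id_mk_arrow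
proof (rule mk_arrow_hom)
  fix S :: "'a env set" and a b a' b'
  assume X: "X \<in> eff_objects"
  have rel: "rel S (fst X) (fst X) (snd X) a b \<longleftrightarrow> eqv S X a b" for a b
    unfolding rel_def eqv_def ..
  show "rel S (fst X) (fst X) (snd X) a b \<Longrightarrow> eqv S X a a \<and> eqv S X b b"
    "rel S (fst X) (fst X) (snd X) a b \<Longrightarrow> eqv S X a a' \<Longrightarrow> eqv S X b b' \<Longrightarrow> rel S (fst X) (fst X) (snd X) a' b'"
    "rel S (fst X) (fst X) (snd X) a b \<Longrightarrow> rel S (fst X) (fst X) (snd X) a b' \<Longrightarrow> eqv S X b b'"
    "eqv S X a a \<Longrightarrow> \<exists>b. rel S (fst X) (fst X) (snd X) a b"
    unfolding rel using eqv_sym[OF X] eqv_trans[OF X] by blast+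
qed

lemma rel_rel_comp:
  "rel S A D (rel_comp A B D G F) a d \<longleftrightarrow> (\<exists>b. rel S A B F a b \<and> rel S B D G b d)"
proof -
  have "rel S A D (rel_comp A B D G F) a d \<longleftrightarrow>
      rel S A D (\<lambda>(a, d). \<Union>b\<in>B. F (a, b) \<sqinter>\<^sub>r G (b, d)) a d"
    unfolding rel_comp_def rel_restrict ..
  also have "\<dots> \<longleftrightarrow> (\<exists>b. rel S A B F a b \<and> rel S B D G b d)"
    unfolding rel_def by (simp add: forces_Union forces_conj) blast
  finally show ?thesis .
qed

text \<open>The union in \<open>eff_comp\<close> ranges over two nonempty classes, and its members
  coincide because a class depends only on the forced pairs.\<close>

lemma eff_comp_mk_arrow:
  "eff_comp (mk_arrow Y Z G) (mk_arrow X Y F) = mk_arrow X Z (rel_comp (fst X) (fst Y) (fst Z) G F)"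
proof -
  let ?c = "rel_comp (fst X) (fst Y) (fst Z)"
  let ?F = "restrict F (fst X \<times> fst Y)" and ?G = "restrict G (fst Y \<times> fst Z)"
  have "rel_class (fst X) (fst Z) (?c G' F') = rel_class (fst X) (fst Z) (restrict (?c G F) (fst X \<times> fst Z))"
    if "F' \<in> rel_class (fst X) (fst Y) ?F" "G' \<in> rel_class (fst Y) (fst Z) ?G" for F' G'
  proof -
    have "rel S (fst X) (fst Y) F' a b \<longleftrightarrow> rel S (fst X) (fst Y) F a b"
      "rel S (fst Y) (fst Z) G' a b \<longleftrightarrow> rel S (fst Y) (fst Z) G a b" for S :: "'a env set" and a b
      using that unfolding rel_class_def realizes_le_rel rel_restrict by blast+
    then show ?thesis by (intro rel_class_cong) (simp add: rel_rel_comp)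
  qed
  moreover have "rel_class (fst X) (fst Y) ?F \<noteq> {}" "rel_class (fst Y) (fst Z) ?G \<noteq> {}"
    using rel_class_self[of ?F "fst X" "fst Y"] rel_class_self[of ?G "fst Y" "fst Z"] by auto
  ultimately have "(\<Union>F'\<in>rel_class (fst X) (fst Y) ?F. \<Union>G'\<in>rel_class (fst Y) (fst Z) ?G.
     rel_class (fst X) (fst Z) (?c G' F')) = rel_class (fst X) (fst Z) (restrict (?c G F) (fst X \<times> fst Z))"
    by simp
  then show ?thesis unfolding mk_arrow_def by simp
qed

lemma app_comp:
  assumes "f \<in> hom eff X Y" "g \<in> hom eff Y Z"
  shows "app S (eff_comp g f) a c \<longleftrightarrow> (\<exists>b. app S f a b \<and> app S g b c)"
proof -
  obtain F G where "f = mk_arrow X Y F" "g = mk_arrow Y Z G" using assms unfolding hom_iff by blast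
  then show ?thesis by (simp add: eff_comp_mk_arrow app_mk_arrow rel_rel_comp)
qed

text \<open>The form used in diagram chases: a known value \<open>b\<close> replaces the existential
  middle value.\<close>

lemma app_comp_at:
  assumes f: "f \<in> hom eff X Y" and g: "g \<in> hom eff Y Z" and ab: "app S f a b"
  shows "app S (eff_comp g f) a c \<longleftrightarrow> app S g b c"
  using app_unique[OF f _ ab] app_cong1[OF g] ab unfolding app_comp[OF f g] by blast

lemma comp_hom:
  assumes f: "f \<in> hom eff X Y" and g: "g \<in> hom eff Y Z"
  shows "eff_comp g f \<in> hom eff X Z"
proof -
  obtain F G where F: "f = mk_arrow X Y F" and G: "g = mk_arrow Y Z G"
    using assms unfolding hom_iff by blast
  have rel: "rel S (fst X) (fst Z) (rel_comp (fst X) (fst Y) (fst Z) G F) a c \<longleftrightarrow>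
      (\<exists>b. app S f a b \<and> app S g b c)" for S a c
    unfolding F G app_mk_arrow rel_rel_comp ..
  have "mk_arrow X Z (rel_comp (fst X) (fst Y) (fst Z) G F) \<in> hom eff X Z"
  proof (rule mk_arrow_hom)
    fix S :: "'a env set" and a b a' b'
    assume "eqv S X a a"
    then show "\<exists>c. rel S (fst X) (fst Z) (rel_comp (fst X) (fst Y) (fst Z) G F) a c"
      unfolding rel by (metis app_total[OF f] app_total[OF g] app_eqv2[OF f])
  qed (use hom_objects[OF f] hom_objects[OF g] in
    \<open>auto simp: rel intro: app_eqv1[OF f] app_eqv2[OF g] app_cong1[OF f] app_cong2[OF g]
      dest: app_unique[OF f] app_unique[OF g] app_cong1[OF g]\<close>)
  then show ?thesis unfolding F G eff_comp_mk_arrow .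
qed

lemma category_eff: "category eff"
proof
  fix f :: "'a eff_arr"
  assume "f \<in> Arr eff"
  then show "Dom eff f \<in> Obj eff" "Cod eff f \<in> Obj eff" by (auto simp: eff_arrows_def)
next
  fix X :: "'a eff_obj"
  assume "X \<in> Obj eff"
  then show "Id eff X \<in> hom eff X X" unfolding eff_simps(1) by (rule Id_hom)
next
  fix f g h :: "'a eff_arr" and X Y Z W
  assume f: "f \<in> hom eff X Y"
  note ob = hom_objects[OF f]
  show "Id eff Y \<odot>\<^bsub>eff\<^esub> f = f"
    unfolding eff_simps(3)
    by (rule app_ext[OF comp_hom[OF f Id_hom[OF ob(2)]] f])
      (auto simp: app_comp[OF f Id_hom[OF ob(2)]] app_Id[OF ob(2)] simp del: eff_simps intro: app_cong2[OF f])
  show "f \<odot>\<^bsub>eff\<^esub> Id eff X = f"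
    unfolding eff_simps(3)
    by (rule app_ext[OF comp_hom[OF Id_hom[OF ob(1)] f] f])
      (auto simp: app_comp[OF Id_hom[OF ob(1)] f] app_Id[OF ob(1)] simp del: eff_simps
        intro: app_cong1[OF f] eqv_sym[OF ob(1)])
  assume g: "g \<in> hom eff Y Z"
  show "g \<odot>\<^bsub>eff\<^esub> f \<in> hom eff X Z" unfolding eff_simps(3) by (rule comp_hom[OF f g])
  assume h: "h \<in> hom eff Z W"
  show "h \<odot>\<^bsub>eff\<^esub> (g \<odot>\<^bsub>eff\<^esub> f) = h \<odot>\<^bsub>eff\<^esub> g \<odot>\<^bsub>eff\<^esub> f"
    unfolding eff_simps(3)
    by (rule app_ext[OF comp_hom[OF comp_hom[OF f g] h] comp_hom[OF f comp_hom[OF g h]]])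
      (auto simp: app_comp[OF f g] app_comp[OF g h] app_comp[OF comp_hom[OF f g] h]
        app_comp[OF f comp_hom[OF g h]])
qed


section \<open>Small sets\<close>

lemma set_universe_infinite: "set_universe TYPE('u) \<Longrightarrow> infinite (UNIV :: 'u set)"
  unfolding set_universe_def infinite_le_lepoll by (blast intro: lesspoll_imp_lepoll)

text \<open>Pairs and predicates are not of type \<open>'u\<close>; an injection gives them labels
  there, and the image is again small.\<close>

lemma small_encoding:
  assumes "M \<prec> (UNIV :: 'u set)"
  obtains enc :: "'x \<Rightarrow> 'u" where "inj_on enc M" "enc ` M \<prec> (UNIV :: 'u set)"
proof -
  obtain enc :: "'x \<Rightarrow> 'u" where "inj_on enc M"
    using lesspoll_imp_lepoll[OF assms] unfolding lepoll_def by blast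
  then show thesis using assms that by simp
qed

lemma small_square:
  assumes "set_universe TYPE('u)" "C \<prec> (UNIV :: 'u set)"
  shows "C \<times> C \<prec> (UNIV :: 'u set)"
proof (cases "finite C")
  case True
  then show ?thesis
    by (intro finite_lesspoll_infinite set_universe_infinite assms finite_cartesian_product)
next
  case False
  then have "C \<times> C \<approx> C"
    unfolding eqpoll_iff_card_of_ordIso by (rule card_of_Times_same_infinite)
  then show ?thesis using assms(2) by (rule eq_lesspoll_trans)
qed

lemma small_Times:
  fixes A :: "'x set" and B :: "'y set"
  assumes "set_universe TYPE('u)" "A \<prec> (UNIV :: 'u set)" "B \<prec> (UNIV :: 'u set)"
  shows "A \<times> B \<prec> (UNIV :: 'u set)"
proof -
  have "A \<lesssim> B \<or> B \<lesssim> A" unfolding lepoll_def card_of_ordLeq by (rule ordLeq_total) (simp_all add: card_of_Well_order)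
  then show ?thesis
  proof
    assume "A \<lesssim> B"
    then have "A \<times> B \<lesssim> B \<times> B" by (intro times_lepoll_mono) simp_all
    then show ?thesis using small_square[OF assms(1,3)] by (rule lesspoll_trans1)
  next
    assume "B \<lesssim> A"
    then have "A \<times> B \<lesssim> A \<times> A" by (intro times_lepoll_mono) simp_all
    then show ?thesis using small_square[OF assms(1,2)] by (rule lesspoll_trans1)
  qed
qed

text \<open>A predicate is coded by its graph, a subset of the small set
  \<open>A \<times> UNIV\<close>, so the strong limit condition bounds the number of predicates.
  This provides the carrier of a power object.\<close>

lemma small_predicates:
  fixes A :: "'x set"
  assumes "set_universe TYPE('u)" "A \<prec> (UNIV :: 'u set)"
  shows "(A \<rightarrow>\<^sub>E (UNIV :: nat set set)) \<prec> (UNIV :: 'u set)"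
proof -
  have "A \<times> (UNIV :: nat set) \<prec> (UNIV :: 'u set)"
    using assms unfolding set_universe_def by (intro small_Times assms) blast
  then obtain enc :: "'x \<times> nat \<Rightarrow> 'u" where enc: "inj_on enc (A \<times> UNIV)" "enc ` (A \<times> UNIV) \<prec> (UNIV :: 'u set)"
    by (rule small_encoding)
  define g where "g R = enc ` {(a, n). a \<in> A \<and> n \<in> R a}" for R :: "'x \<Rightarrow> nat set"
  have "inj_on g (A \<rightarrow>\<^sub>E UNIV)"
  proof (rule inj_onI)
    fix R R' :: "'x \<Rightarrow> nat set"
    assume R: "R \<in> A \<rightarrow>\<^sub>E UNIV" and R': "R' \<in> A \<rightarrow>\<^sub>E UNIV" and "g R = g R'"
    then have "{(a, n). a \<in> A \<and> n \<in> R a} = {(a, n). a \<in> A \<and> n \<in> R' a}"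
      unfolding g_def by (subst (asm) inj_on_image_eq_iff[OF enc(1)]) auto
    then have "R a = R' a" if "a \<in> A" for a using that by blast
    then show "R = R'" by (rule PiE_ext[OF R R'])
  qed
  moreover have "g ` (A \<rightarrow>\<^sub>E UNIV) \<subseteq> Pow (enc ` (A \<times> UNIV))" unfolding g_def by auto
  ultimately have "(A \<rightarrow>\<^sub>E (UNIV :: nat set set)) \<lesssim> Pow (enc ` (A \<times> UNIV))" unfolding lepoll_def by blast
  moreover have "Pow (enc ` (A \<times> UNIV)) \<prec> (UNIV :: 'u set)"
    using assms(1) enc(2) unfolding set_universe_def by blast
  ultimately show ?thesis by (rule lesspoll_trans1)
qed

section \<open>Finite limits\<close>

subsection \<open>The terminal object\<close>

definition unit_object :: "'u eff_obj" where
  "unit_object = mk_object {undefined} (\<lambda>_. UNIV)"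

lemma eqv_unit_object: "eqv S unit_object a b \<longleftrightarrow> a \<in> S \<rightarrow> {undefined} \<and> b \<in> S \<rightarrow> {undefined}"
  unfolding unit_object_def eqv_mk_object by simp

lemma unit_object_eff_objects:
  assumes "set_universe TYPE('u)"
  shows "(unit_object :: 'u eff_obj) \<in> eff_objects"
  unfolding unit_object_def
  by (rule mk_object_eff_objects[OF finite_lesspoll_infinite[OF set_universe_infinite[OF assms]]])
    (simp_all add: eqv_mk_object)

lemma terminal_unit_object:
  assumes "set_universe TYPE('u)"
  shows "terminal eff (unit_object :: 'u eff_obj)"
  unfolding terminal_def eff_simps(1)
proof (intro conjI ballI ex_ex1I)
  show unit: "(unit_object :: 'u eff_obj) \<in> eff_objects" by (rule unit_object_eff_objects[OF assms])
  fix X :: "'u eff_obj"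
  assume X: "X \<in> eff_objects"
  have fst: "fst unit_object = {undefined}" by (simp add: unit_object_def mk_object_def)
  \<comment> \<open>The graph is the existence predicate of \<open>X\<close>: equality in the
    one-label object is realized by every number.\<close>
  let ?F = "\<lambda>(a, b). snd X (a, a)"
  have rel: "rel S (fst X) (fst unit_object) ?F a b \<longleftrightarrow> eqv S X a a \<and> eqv S unit_object b b" for S a b
    unfolding rel_def eqv_unit_object fst by (auto simp: eqv_def)
  have "mk_arrow X unit_object ?F \<in> hom eff X unit_object"
  proof (rule mk_arrow_hom[OF X unit], unfold rel)
    fix S :: "'u env set" and a
    show "\<exists>b. eqv S X a a \<and> eqv S unit_object b b" if "eqv S X a a"
      using that by (intro exI[of _ "\<lambda>s. undefined"]) (simp add: eqv_unit_object)
  qed (auto simp: eqv_unit_object intro: eqv_refl2[OF X])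
  then show "\<exists>f. f \<in> hom eff X unit_object" ..
  fix f g
  assume f: "f \<in> hom eff X unit_object" and g: "g \<in> hom eff X unit_object"
  show "f = g"
  proof (rule app_ext[OF f g])
    fix S :: "'u env set" and a b
    assume fab: "app S f a b"
    from app_total[OF g app_eqv1[OF f fab]] obtain b' where b': "app S g a b'" ..
    have "eqv S unit_object b' b"
      using app_eqv2[OF f fab] app_eqv2[OF g b'] by (simp add: eqv_unit_object)
    then show "app S g a b" by (rule app_cong2[OF g b'])
  qed
qed

subsection \<open>Tabulations\<close>

text \<open>
  Products, pullbacks and the membership relation of a power object are all jointly monic spans
  whose generic elements are the pairs satisfying a given relation.
\<close>

type_synonym 'u generic_rel = "'u env set \<Rightarrow> ('u env \<Rightarrow> 'u) \<Rightarrow> ('u env \<Rightarrow> 'u) \<Rightarrow> bool"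

definition related :: "'u generic_rel \<Rightarrow> 'u eff_arr \<Rightarrow> 'u eff_arr \<Rightarrow> bool" where
  "related Q f g \<longleftrightarrow> (\<forall>S z a b. app S f z a \<longrightarrow> app S g z b \<longrightarrow> Q S a b)"

definition jointly_monic :: "'u eff_obj \<Rightarrow> 'u eff_arr \<Rightarrow> 'u eff_arr \<Rightarrow> bool" where
  "jointly_monic W p q \<longleftrightarrow> (\<forall>S w w' a b. app S p w a \<longrightarrow> app S p w' a \<longrightarrow>
     app S q w b \<longrightarrow> app S q w' b \<longrightarrow> eqv S W w w')"

definition tabulates :: "'u generic_rel \<Rightarrow> 'u eff_obj \<Rightarrow> 'u eff_arr \<Rightarrow> 'u eff_arr \<Rightarrow> bool" where
  "tabulates Q W p q \<longleftrightarrow> related Q p q \<and> jointly_monic W p q \<and>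
     (\<forall>S a b. Q S a b \<longrightarrow> (\<exists>w. app S p w a \<and> app S q w b))"

lemma relatedI: "(\<And>S z a b. app S f z a \<Longrightarrow> app S g z b \<Longrightarrow> Q S a b) \<Longrightarrow> related Q f g"
  unfolding related_def by blast

lemma relatedD: "related Q f g \<Longrightarrow> app S f z a \<Longrightarrow> app S g z b \<Longrightarrow> Q S a b"
  unfolding related_def by blast

lemma jointly_monicI:
  "(\<And>S w w' a b. app S p w a \<Longrightarrow> app S p w' a \<Longrightarrow> app S q w b \<Longrightarrow> app S q w' b \<Longrightarrow> eqv S W w w') \<Longrightarrow>
   jointly_monic W p q"
  unfolding jointly_monic_def by blast

lemma jointly_monicD:
  "jointly_monic W p q \<Longrightarrow> app S p w a \<Longrightarrow> app S p w' a \<Longrightarrow> app S q w b \<Longrightarrow> app S q w' b \<Longrightarrow> eqv S W w w'"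
  unfolding jointly_monic_def by blast

lemma tabulatesI:
  "related Q p q \<Longrightarrow> jointly_monic W p q \<Longrightarrow>
   (\<And>S a b. Q S a b \<Longrightarrow> \<exists>w. app S p w a \<and> app S q w b) \<Longrightarrow> tabulates Q W p q"
  unfolding tabulates_def by blast

lemma tabulatesD:
  assumes "tabulates Q W p q"
  shows "related Q p q" "jointly_monic W p q" "Q S a b \<Longrightarrow> \<exists>w. app S p w a \<and> app S q w b"
  using assms unfolding tabulates_def by blast+

text \<open>The carrier consists of all coded pairs; \<Phi> is built into the equality instead. A
  pair that violates it remains as a label but does not exist as an element.\<close>

lemma tabulation_exists:
  fixes X Y :: "'u eff_obj"
  assumes univ: "set_universe TYPE('u)" and X: "X \<in> eff_objects" and Y: "Y \<in> eff_objects"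
    and Q: "\<And>S a b. Q S a b \<longleftrightarrow> eqv S X a a \<and> eqv S Y b b \<and> S \<tturnstile> (\<lambda>s. \<Phi> (a s, b s))"
    and cong: "\<And>S a b a' b'. Q S a b \<Longrightarrow> eqv S X a a' \<Longrightarrow> eqv S Y b b' \<Longrightarrow> Q S a' b'"
  obtains W p q where "p \<in> hom eff W X" "q \<in> hom eff W Y" "tabulates Q W p q"
proof -
  obtain enc :: "'u \<times> 'u \<Rightarrow> 'u" where enc: "inj_on enc (fst X \<times> fst Y)" "enc ` (fst X \<times> fst Y) \<prec> (UNIV :: 'u set)"
    using small_Times[OF univ eff_objects_small[OF X] eff_objects_small[OF Y]] by (rule small_encoding)
  define W0 where "W0 = enc ` (fst X \<times> fst Y)"
  define d1 where "d1 w = fst (inv_into (fst X \<times> fst Y) enc w)" for w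
  define d2 where "d2 w = snd (inv_into (fst X \<times> fst Y) enc w)" for w
  have d: "d1 w \<in> fst X" "d2 w \<in> fst Y" if "w \<in> W0" for w
    using inv_into_into[of w enc "fst X \<times> fst Y"] that unfolding W0_def d1_def d2_def by (auto simp: mem_Times_iff)
  have d_enc: "d1 (enc (a, b)) = a" "d2 (enc (a, b)) = b" if "a \<in> fst X" "b \<in> fst Y" for a b
    using that enc(1) unfolding d1_def d2_def by (simp_all add: inv_into_f_f)
  \<comment> \<open>\<Phi> is asked of the first pair alone; symmetry carries it to the second by
    \<open>cong\<close>.\<close>
  define \<rho> where "\<rho> = (\<lambda>(w, w'). snd X (d1 w, d1 w') \<sqinter>\<^sub>r snd Y (d2 w, d2 w') \<sqinter>\<^sub>r \<Phi> (d1 w, d2 w))"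
  define W where "W = mk_object W0 \<rho>"
  have fst_W: "fst W = W0" by (simp add: W_def mk_object_def)
  have in1: "(\<lambda>s. d1 (w s)) \<in> S \<rightarrow> fst X" and in2: "(\<lambda>s. d2 (w s)) \<in> S \<rightarrow> fst Y"
    if "w \<in> S \<rightarrow> W0" for w :: "'u env \<Rightarrow> 'u" and S using that d by auto
  have eqv_W': "eqv S W w w' \<longleftrightarrow> w \<in> S \<rightarrow> W0 \<and> w' \<in> S \<rightarrow> W0 \<and> eqv S X (\<lambda>s. d1 (w s)) (\<lambda>s. d1 (w' s)) \<and>
     eqv S Y (\<lambda>s. d2 (w s)) (\<lambda>s. d2 (w' s)) \<and> S \<tturnstile> (\<lambda>s. \<Phi> (d1 (w s), d2 (w s)))" for S w w'
    unfolding W_def eqv_mk_object \<rho>_def prod.case forces_conj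
    unfolding eqv_def using in1 in2 by blast
  have eqv_W: "eqv S W w w' \<longleftrightarrow> w \<in> S \<rightarrow> W0 \<and> w' \<in> S \<rightarrow> W0 \<and> eqv S X (\<lambda>s. d1 (w s)) (\<lambda>s. d1 (w' s)) \<and>
     eqv S Y (\<lambda>s. d2 (w s)) (\<lambda>s. d2 (w' s)) \<and> Q S (\<lambda>s. d1 (w s)) (\<lambda>s. d2 (w s))" for S w w'
    unfolding eqv_W' Q using eqv_refl1[OF X] eqv_refl1[OF Y] by blast
  have W: "W \<in> eff_objects"
    unfolding W_def
  proof (rule mk_object_eff_objects, fold W_def)
    show "W0 \<prec> (UNIV :: 'u set)" unfolding W0_def by (rule enc(2))
    fix S :: "'u env set" and w w' w''
    assume w: "eqv S W w w'"
    then show "eqv S W w' w" unfolding eqv_W using eqv_sym[OF X] eqv_sym[OF Y] cong by blast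
    assume "eqv S W w' w''"
    with w show "eqv S W w w''" unfolding eqv_W using eqv_trans[OF X] eqv_trans[OF Y] by blast
  qed
  define P1 where "P1 = (\<lambda>(w, a). snd W (w, w) \<sqinter>\<^sub>r snd X (d1 w, a))"
  define P2 where "P2 = (\<lambda>(w, b). snd W (w, w) \<sqinter>\<^sub>r snd Y (d2 w, b))"
  have P1: "rel S (fst W) (fst X) P1 w a \<longleftrightarrow> eqv S W w w \<and> eqv S X (\<lambda>s. d1 (w s)) a" for S w a
    unfolding rel_def P1_def prod.case forces_conj eqv_def fst_W using in1 by blast
  have P2: "rel S (fst W) (fst Y) P2 w b \<longleftrightarrow> eqv S W w w \<and> eqv S Y (\<lambda>s. d2 (w s)) b" for S w b
    unfolding rel_def P2_def prod.case forces_conj eqv_def fst_W using in2 by blast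
  have p: "mk_arrow W X P1 \<in> hom eff W X"
  proof (rule mk_arrow_hom[OF W X], unfold P1)
    fix S :: "'u env set" and w w' a a'
    assume w: "eqv S W w w \<and> eqv S X (\<lambda>s. d1 (w s)) a"
    then show "eqv S W w w \<and> eqv S X a a" using eqv_refl2[OF X] by blast
    show "eqv S W w' w' \<and> eqv S X (\<lambda>s. d1 (w' s)) a'" if ww': "eqv S W w w'" and aa': "eqv S X a a'"
    proof
      show "eqv S W w' w'" by (rule eqv_refl2[OF W ww'])
      have "eqv S X (\<lambda>s. d1 (w' s)) (\<lambda>s. d1 (w s))"
        using ww' unfolding eqv_W by (blast intro: eqv_sym[OF X])
      from eqv_trans[OF X this] w have "eqv S X (\<lambda>s. d1 (w' s)) a" by blast
      from eqv_trans[OF X this aa'] show "eqv S X (\<lambda>s. d1 (w' s)) a'" .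
    qed
    show "eqv S X a a'" if "eqv S W w w \<and> eqv S X (\<lambda>s. d1 (w s)) a'"
      using w that eqv_sym[OF X] eqv_trans[OF X] by blast
  next
    fix S :: "'u env set" and w
    assume "eqv S W w w"
    then show "\<exists>a. eqv S W w w \<and> eqv S X (\<lambda>s. d1 (w s)) a" using eqv_W by blast
  qed
  have q: "mk_arrow W Y P2 \<in> hom eff W Y"
  proof (rule mk_arrow_hom[OF W Y], unfold P2)
    fix S :: "'u env set" and w w' b b'
    assume w: "eqv S W w w \<and> eqv S Y (\<lambda>s. d2 (w s)) b"
    then show "eqv S W w w \<and> eqv S Y b b" using eqv_refl2[OF Y] by blast
    show "eqv S W w' w' \<and> eqv S Y (\<lambda>s. d2 (w' s)) b'" if ww': "eqv S W w w'" and bb': "eqv S Y b b'"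
    proof
      show "eqv S W w' w'" by (rule eqv_refl2[OF W ww'])
      have "eqv S Y (\<lambda>s. d2 (w' s)) (\<lambda>s. d2 (w s))"
        using ww' unfolding eqv_W by (blast intro: eqv_sym[OF Y])
      from eqv_trans[OF Y this] w have "eqv S Y (\<lambda>s. d2 (w' s)) b" by blast
      from eqv_trans[OF Y this bb'] show "eqv S Y (\<lambda>s. d2 (w' s)) b'" .
    qed
    show "eqv S Y b b'" if "eqv S W w w \<and> eqv S Y (\<lambda>s. d2 (w s)) b'"
      using w that eqv_sym[OF Y] eqv_trans[OF Y] by blast
  next
    fix S :: "'u env set" and w
    assume "eqv S W w w"
    then show "\<exists>b. eqv S W w w \<and> eqv S Y (\<lambda>s. d2 (w s)) b" using eqv_W by blast
  qed
  have "tabulates Q W (mk_arrow W X P1) (mk_arrow W Y P2)"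
  proof (rule tabulatesI[OF relatedI jointly_monicI], unfold app_mk_arrow P1 P2)
    fix S w w' a b
    assume w: "eqv S W w w \<and> eqv S X (\<lambda>s. d1 (w s)) a" "eqv S W w w \<and> eqv S Y (\<lambda>s. d2 (w s)) b"
    then have "Q S (\<lambda>s. d1 (w s)) (\<lambda>s. d2 (w s))" unfolding eqv_W by blast
    then show "Q S a b" using w cong by blast
  next
    fix S w w' a b
    assume w: "eqv S W w w \<and> eqv S X (\<lambda>s. d1 (w s)) a" "eqv S W w w \<and> eqv S Y (\<lambda>s. d2 (w s)) b"
      and w': "eqv S W w' w' \<and> eqv S X (\<lambda>s. d1 (w' s)) a" "eqv S W w' w' \<and> eqv S Y (\<lambda>s. d2 (w' s)) b"
    have "eqv S X (\<lambda>s. d1 (w s)) (\<lambda>s. d1 (w' s))"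
      using w(1) w'(1) eqv_sym[OF X] eqv_trans[OF X] by blast
    moreover have "eqv S Y (\<lambda>s. d2 (w s)) (\<lambda>s. d2 (w' s))"
      using w(2) w'(2) eqv_sym[OF Y] eqv_trans[OF Y] by blast
    ultimately show "eqv S W w w'" using w w' unfolding eqv_W by blast
  next
    fix S a b
    assume ab: "Q S a b"
    then have mem: "a \<in> S \<rightarrow> fst X" "b \<in> S \<rightarrow> fst Y" unfolding Q eqv_def by blast+
    \<comment> \<open>The code of the pair is chosen environment by environment; since labels need
      not be computed, this is a legitimate generic element.\<close>
    define w where "w s = enc (a s, b s)" for s
    have w0: "w \<in> S \<rightarrow> W0" unfolding w_def W0_def using mem by auto
    have X1: "eqv S X (\<lambda>s. d1 (w s)) c \<longleftrightarrow> eqv S X a c" "eqv S X c (\<lambda>s. d1 (w s)) \<longleftrightarrow> eqv S X c a"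
      and Y1: "eqv S Y (\<lambda>s. d2 (w s)) c \<longleftrightarrow> eqv S Y b c" "eqv S Y c (\<lambda>s. d2 (w s)) \<longleftrightarrow> eqv S Y c b" for c
      unfolding eqv_def w_def using mem by (auto simp: Pi_iff d_enc elim!: forces_subset)
    have "Q S (\<lambda>s. d1 (w s)) (\<lambda>s. d2 (w s))"
      using cong[OF ab] ab X1(2) Y1(2) unfolding Q by blast
    then show "\<exists>w. (eqv S W w w \<and> eqv S X (\<lambda>s. d1 (w s)) a) \<and> eqv S W w w \<and> eqv S Y (\<lambda>s. d2 (w s)) b"
      using ab w0 X1 Y1 unfolding eqv_W Q by blast
  qed
  with p q show thesis by (rule that)
qed

lemma tabulation_unique:
  assumes p: "p \<in> hom eff W X" and q: "q \<in> hom eff W Y" and mono: "jointly_monic W p q"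
    and h: "h \<in> hom eff Z W" and h': "h' \<in> hom eff Z W"
    and "eff_comp p h = eff_comp p h'" "eff_comp q h = eff_comp q h'"
  shows "h = h'"
proof (rule app_ext[OF h h'])
  fix S z w
  assume zw: "app S h z w"
  from app_total[OF h' app_eqv1[OF h zw]] obtain w' where zw': "app S h' z w'" ..
  from app_total[OF p app_eqv2[OF h zw]] obtain a where wa: "app S p w a" ..
  from app_total[OF q app_eqv2[OF h zw]] obtain b where wb: "app S q w b" ..
  have wa': "app S p w' a" and wb': "app S q w' b"
    using wa wb app_comp_at[OF h p zw] app_comp_at[OF h' p zw'] app_comp_at[OF h q zw] app_comp_at[OF h' q zw']
    unfolding assms(6,7) by blast+
  from jointly_monicD[OF mono wa' wa wb' wb] show "app S h' z w" by (rule app_cong2[OF h' zw'])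
qed

text \<open>The mediating arrow sends \<open>z\<close> to the \<open>w\<close> whose projections are
  values of \<open>f\<close> and \<open>g\<close> at \<open>z\<close>. Completeness of the
  tabulation makes it total, joint monicity makes it single-valued.\<close>

lemma tabulation_pairing:
  assumes p: "p \<in> hom eff W X" and q: "q \<in> hom eff W Y" and tab: "tabulates Q W p q"
    and f: "f \<in> hom eff Z X" and g: "g \<in> hom eff Z Y" and rel: "related Q f g"
  shows "\<exists>!h. h \<in> hom eff Z W \<and> eff_comp p h = f \<and> eff_comp q h = g"
proof -
  note mono = tabulatesD(2)[OF tab]
  obtain F G where F: "f = mk_arrow Z X F" and G: "g = mk_arrow Z Y G"
    using f g unfolding hom_iff by blast
  obtain P R where P: "p = mk_arrow W X P" and R: "q = mk_arrow W Y R"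
    using p q unfolding hom_iff by blast
  define H where "H = (\<lambda>(z, w). \<Union>a\<in>fst X. \<Union>b\<in>fst Y. F (z, a) \<sqinter>\<^sub>r P (w, a) \<sqinter>\<^sub>r G (z, b) \<sqinter>\<^sub>r R (w, b))"
  have H: "rel S (fst Z) (fst W) H z w \<longleftrightarrow>
      (\<exists>a. app S f z a \<and> app S p w a) \<and> (\<exists>b. app S g z b \<and> app S q w b)" for S z w
    unfolding rel_def H_def F G P R app_mk_arrow by (simp add: forces_Union forces_conj) blast
  define h where "h = mk_arrow Z W H"
  have happ: "app S h z w \<longleftrightarrow>
      (\<exists>a. app S f z a \<and> app S p w a) \<and> (\<exists>b. app S g z b \<and> app S q w b)" for S z w
    unfolding h_def app_mk_arrow H ..
  have lift: "\<exists>w. app S p w a \<and> app S q w b" if "app S f z a" "app S g z b" for S z a b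
    using tabulatesD(3)[OF tab] relatedD[OF rel] that by blast
  have h: "h \<in> hom eff Z W"
    unfolding h_def
  proof (rule mk_arrow_hom[OF hom_objects(1)[OF f] hom_objects(1)[OF p]], unfold H)
    fix S :: "'a env set" and z w z' w'
    assume "(\<exists>a. app S f z a \<and> app S p w a) \<and> (\<exists>b. app S g z b \<and> app S q w b)"
    then obtain a b where fa: "app S f z a" and pa: "app S p w a" and gb: "app S g z b" and qb: "app S q w b"
      by blast
    show "eqv S Z z z \<and> eqv S W w w" using app_eqv1[OF f fa] app_eqv1[OF p pa] by blast
    show "(\<exists>a. app S f z' a \<and> app S p w' a) \<and> (\<exists>b. app S g z' b \<and> app S q w' b)"
      if "eqv S Z z z'" "eqv S W w w'"
      using app_cong1[OF f fa that(1)] app_cong1[OF p pa that(2)]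
        app_cong1[OF g gb that(1)] app_cong1[OF q qb that(2)] by blast
    assume "(\<exists>a. app S f z a \<and> app S p w' a) \<and> (\<exists>b. app S g z b \<and> app S q w' b)"
    then obtain a' b' where fa': "app S f z a'" and pa': "app S p w' a'" and gb': "app S g z b'" and qb': "app S q w' b'"
      by blast
    show "eqv S W w w'"
      by (rule jointly_monicD[OF mono pa app_cong2[OF p pa' app_unique[OF f fa' fa]] qb
          app_cong2[OF q qb' app_unique[OF g gb' gb]]])
  next
    fix S :: "'a env set" and z
    assume "eqv S Z z z"
    from app_total[OF f this] app_total[OF g this] lift
    show "\<exists>w. (\<exists>a. app S f z a \<and> app S p w a) \<and> (\<exists>b. app S g z b \<and> app S q w b)" by blast
  qed
  have "eff_comp p h = f"
  proof (rule app_ext[symmetric, OF f comp_hom[OF h p]])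
    fix S z a
    assume fa: "app S f z a"
    from app_total[OF g app_eqv1[OF f this]] obtain b where "app S g z b" ..
    with fa lift show "app S (eff_comp p h) z a" unfolding app_comp[OF h p] happ by blast
  qed
  moreover have "eff_comp q h = g"
  proof (rule app_ext[symmetric, OF g comp_hom[OF h q]])
    fix S z b
    assume gb: "app S g z b"
    from app_total[OF f app_eqv1[OF g this]] obtain a where "app S f z a" ..
    with gb lift show "app S (eff_comp q h) z b" unfolding app_comp[OF h q] happ by blast
  qed
  ultimately show ?thesis
    using h by (intro ex1I[of _ h]) (auto intro: tabulation_unique[OF p q mono])
qed

text \<open>The definition of a topos speaks of arbitrary products and pullbacks, so the tabulation
  property has to be transferred from a constructed span \<open>W0\<close> to any span with the
  universal property. The two comparison arrows \<open>h\<close> and \<open>k\<close> carry it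
  over.\<close>

lemma universal_span_tabulates:
  assumes p: "p \<in> hom eff W X" and q: "q \<in> hom eff W Y" and rel: "related Q p q"
    and p0: "p0 \<in> hom eff W0 X" and q0: "q0 \<in> hom eff W0 Y" and tab0: "tabulates Q W0 p0 q0"
    and univ: "\<And>Z f g. f \<in> hom eff Z X \<Longrightarrow> g \<in> hom eff Z Y \<Longrightarrow> related Q f g \<Longrightarrow>
      \<exists>!h. h \<in> hom eff Z W \<and> eff_comp p h = f \<and> eff_comp q h = g"
  shows "tabulates Q W p q"
proof -
  note W = hom_objects(1)[OF p]
  obtain h where h: "h \<in> hom eff W0 W" and hp: "eff_comp p h = p0" and hq: "eff_comp q h = q0"
    using univ[OF p0 q0 tabulatesD(1)[OF tab0]] by blast
  obtain k where k: "k \<in> hom eff W W0" and kp: "eff_comp p0 k = p" and kq: "eff_comp q0 k = q"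
    using tabulation_pairing[OF p0 q0 tab0 p q rel] by blast
  have hk: "eff_comp h k \<in> hom eff W W" by (rule comp_hom[OF k h])
  have assoc: "eff_comp r (eff_comp h k) = eff_comp (eff_comp r h) k" if "r \<in> hom eff W R" for r R
    using category.comp_assoc[OF category_eff k h that] by simp
  have idr: "eff_comp r (Id eff W) = r" if "r \<in> hom eff W R" for r R
    using category.id_right[OF category_eff that] by (simp del: eff_simps(6))
  \<comment> \<open>Both are endomorphisms of \<open>W\<close> compatible with \<open>p\<close> and
    \<open>q\<close>, so the uniqueness in the universal property identifies them.\<close>
  have "eff_comp h k = Id eff W"
    using univ[OF p q rel] hk Id_hom[OF W] assoc[OF p] assoc[OF q] idr[OF p] idr[OF q]
    unfolding hp hq kp kq by blast
  then have hk_app: "eqv S W w w'" if "app S k w v" "app S h v w'" for S w v w'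
    using that app_comp[OF k h] app_Id[OF W] by metis
  show ?thesis
  proof (rule tabulatesI[OF rel jointly_monicI])
    fix S w w' a b
    assume w: "app S p w a" "app S q w b" "app S p w' a" "app S q w' b"
    from app_total[OF k app_eqv1[OF p w(1)]] obtain v where v: "app S k w v" ..
    from app_total[OF k app_eqv1[OF p w(3)]] obtain v' where v': "app S k w' v'" ..
    have "app S p0 v a" "app S p0 v' a" "app S q0 v b" "app S q0 v' b"
      using w app_comp_at[OF k p0] app_comp_at[OF k q0] v v' unfolding kp kq by blast+
    then have vv': "eqv S W0 v v'" by (rule jointly_monicD[OF tabulatesD(2)[OF tab0]])
    from app_total[OF h app_eqv2[OF k v]] obtain u where u: "app S h v u" ..
    have "eqv S W w u" by (rule hk_app[OF v u])
    moreover have "eqv S W w' u" by (rule hk_app[OF v' app_cong1[OF h u vv']])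
    ultimately show "eqv S W w w'" using eqv_sym[OF W] eqv_trans[OF W] by blast
  next
    fix S a b
    assume "Q S a b"
    from tabulatesD(3)[OF tab0 this] obtain v where v: "app S p0 v a" "app S q0 v b" by blast
    from app_total[OF h app_eqv1[OF p0 v(1)]] obtain w where w: "app S h v w" ..
    show "\<exists>w. app S p w a \<and> app S q w b" 
      using v app_comp_at[OF h p w] app_comp_at[OF h q w] unfolding hp hq by blast
  qed
qed

subsection \<open>Products and pullbacks\<close>

definition product_rel :: "'u eff_obj \<Rightarrow> 'u eff_obj \<Rightarrow> 'u generic_rel" where
  "product_rel X Y S a b \<longleftrightarrow> eqv S X a a \<and> eqv S Y b b"

definition pullback_rel :: "'u eff_arr \<Rightarrow> 'u eff_arr \<Rightarrow> 'u generic_rel" where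
  "pullback_rel f g S a b \<longleftrightarrow> (\<exists>c. app S f a c \<and> app S g b c)"

lemma related_product_rel:
  "f \<in> hom eff Z X \<Longrightarrow> g \<in> hom eff Z Y \<Longrightarrow> related (product_rel X Y) f g"
  unfolding related_def product_rel_def by (blast intro: app_eqv2)

lemma product_tabulation_exists:
  fixes X Y :: "'u eff_obj"
  assumes "set_universe TYPE('u)" "X \<in> eff_objects" "Y \<in> eff_objects"
  obtains W p q where "p \<in> hom eff W X" "q \<in> hom eff W Y" "tabulates (product_rel X Y) W p q"
proof (rule tabulation_exists[OF assms, of "product_rel X Y" "\<lambda>_. UNIV"])
  show "product_rel X Y S a b \<longleftrightarrow> eqv S X a a \<and> eqv S Y b b \<and> S \<tturnstile> (\<lambda>s. UNIV)" for S a b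
    unfolding product_rel_def by simp
  show "product_rel X Y S a b \<Longrightarrow> eqv S X a a' \<Longrightarrow> eqv S Y b b' \<Longrightarrow> product_rel X Y S a' b'" for S a b a' b'
    unfolding product_rel_def using eqv_refl2 assms(2,3) by blast
qed

lemma product_iff:
  fixes X Y :: "'u eff_obj"
  assumes "set_universe TYPE('u)" "X \<in> eff_objects" "Y \<in> eff_objects"
  shows "product eff X Y W p q \<longleftrightarrow>
    p \<in> hom eff W X \<and> q \<in> hom eff W Y \<and> tabulates (product_rel X Y) W p q" (is "_ \<longleftrightarrow> ?R")
proof
  assume ?R
  then show "product eff X Y W p q"
    unfolding product_def eff_simps(1,3) using tabulation_pairing related_product_rel by blast
next
  assume prod: "product eff X Y W p q"
  then have p: "p \<in> hom eff W X" and q: "q \<in> hom eff W Y" unfolding product_def by blast+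
  obtain W0 p0 q0 where "p0 \<in> hom eff W0 X" "q0 \<in> hom eff W0 Y" "tabulates (product_rel X Y) W0 p0 q0"
    using product_tabulation_exists[OF assms] .
  then have "tabulates (product_rel X Y) W p q"
  proof (rule universal_span_tabulates[OF p q related_product_rel[OF p q]])
    fix Z f g
    assume "f \<in> hom eff Z X" "g \<in> hom eff Z Y"
    then show "\<exists>!h. h \<in> hom eff Z W \<and> eff_comp p h = f \<and> eff_comp q h = g"
      using prod hom_objects(1) unfolding product_def eff_simps(1,3) by blast
  qed
  with p q show ?R by blast
qed

lemma related_pullback_rel:
  assumes f: "f \<in> hom eff X Z" and g: "g \<in> hom eff Y Z" and p: "p \<in> hom eff W X" and q: "q \<in> hom eff W Y"
  shows "related (pullback_rel f g) p q \<longleftrightarrow> eff_comp f p = eff_comp g q"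
proof
  assume rel: "related (pullback_rel f g) p q"
  show "eff_comp f p = eff_comp g q"
  proof (rule app_ext[OF comp_hom[OF p f] comp_hom[OF q g]])
    fix S w c
    assume "app S (eff_comp f p) w c"
    then obtain a where a: "app S p w a" "app S f a c" unfolding app_comp[OF p f] by blast
    from app_total[OF q app_eqv1[OF p a(1)]] obtain b where b: "app S q w b" ..
    from relatedD[OF rel a(1) b] obtain c' where c': "app S f a c'" "app S g b c'"
      unfolding pullback_rel_def by blast
    from app_cong2[OF g c'(2) app_unique[OF f c'(1) a(2)]] b
    show "app S (eff_comp g q) w c" unfolding app_comp[OF q g] by blast
  qed
next
  assume eq: "eff_comp f p = eff_comp g q"
  show "related (pullback_rel f g) p q"
  proof (rule relatedI)
    fix S w a b
    assume a: "app S p w a" and b: "app S q w b"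
    from app_total[OF f app_eqv2[OF p a]] obtain c where c: "app S f a c" ..
    with a have "app S (eff_comp g q) w c" unfolding eq[symmetric] app_comp[OF p f] by blast
    then obtain b' where "app S q w b'" "app S g b' c" unfolding app_comp[OF q g] by blast
    with b have "app S g b c" using app_unique[OF q] app_cong1[OF g] by blast
    with c show "pullback_rel f g S a b" unfolding pullback_rel_def by blast
  qed
qed

lemma pullback_tabulation_exists:
  fixes X Y :: "'u eff_obj"
  assumes "set_universe TYPE('u)" and f: "f \<in> hom eff X Z" and g: "g \<in> hom eff Y Z"
  obtains W p q where "p \<in> hom eff W X" "q \<in> hom eff W Y" "tabulates (pullback_rel f g) W p q"
proof -
  obtain F G where F: "f = mk_arrow X Z F" and G: "g = mk_arrow Y Z G"
    using f g unfolding hom_iff by blast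
  show thesis
  \<comment> \<open>The predicate on \<open>(a, b)\<close> says that some \<open>c\<close> is a
    value of \<open>f\<close> at \<open>a\<close> and of \<open>g\<close> at
    \<open>b\<close>.\<close>
  proof (rule tabulation_exists[OF assms(1) hom_objects(1)[OF f] hom_objects(1)[OF g], of "pullback_rel f g"
        "\<lambda>(a, b). \<Union>c\<in>fst Z. F (a, c) \<sqinter>\<^sub>r G (b, c)"])
    fix S a b
    have "eqv S X a a \<and> eqv S Y b b" if "pullback_rel f g S a b"
      using that app_eqv1[OF f] app_eqv1[OF g] unfolding pullback_rel_def by blast
    moreover have "pullback_rel f g S a b \<longleftrightarrow>
        a \<in> S \<rightarrow> fst X \<and> b \<in> S \<rightarrow> fst Y \<and> S \<tturnstile> (\<lambda>s. \<Union>c\<in>fst Z. F (a s, c) \<sqinter>\<^sub>r G (b s, c))"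
      unfolding pullback_rel_def F G app_mk_arrow rel_def forces_Union forces_conj by blast
    moreover have "eqv S X a a \<Longrightarrow> a \<in> S \<rightarrow> fst X" "eqv S Y b b \<Longrightarrow> b \<in> S \<rightarrow> fst Y"
      unfolding eqv_def by blast+
    ultimately show "pullback_rel f g S a b \<longleftrightarrow> eqv S X a a \<and> eqv S Y b b \<and>
        S \<tturnstile> (\<lambda>s. case (a s, b s) of (a, b) \<Rightarrow> \<Union>c\<in>fst Z. F (a, c) \<sqinter>\<^sub>r G (b, c))"
      unfolding prod.case by blast
  next
    fix S a b a' b'
    assume "pullback_rel f g S a b" "eqv S X a a'" "eqv S Y b b'"
    then show "pullback_rel f g S a' b'"
      unfolding pullback_rel_def using app_cong1[OF f] app_cong1[OF g] by blast
  qed (rule that)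
qed

lemma pullback_iff:
  fixes X Y :: "'u eff_obj"
  assumes "set_universe TYPE('u)" and f: "f \<in> hom eff X Z" and g: "g \<in> hom eff Y Z"
  shows "pullback eff f g W p q \<longleftrightarrow>
    p \<in> hom eff W X \<and> q \<in> hom eff W Y \<and> tabulates (pullback_rel f g) W p q" (is "_ \<longleftrightarrow> ?R")
proof -
  have dom: "f \<in> Arr eff" "g \<in> Arr eff" "Dom eff f = X" "Dom eff g = Y" "Cod eff f = Z" "Cod eff g = Z"
    using f g unfolding hom_def by blast+
  show ?thesis
  proof
    assume R: ?R
    then have p: "p \<in> hom eff W X" and q: "q \<in> hom eff W Y" by blast+
    have "eff_comp f p = eff_comp g q"
      using R related_pullback_rel[OF f g p q] tabulatesD(1) by blast
    moreover have "\<exists>!h. h \<in> hom eff V W \<and> eff_comp p h = p' \<and> eff_comp q h = q'"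
      if "p' \<in> hom eff V X" "q' \<in> hom eff V Y" "eff_comp f p' = eff_comp g q'" for V p' q'
      using tabulation_pairing[OF p q _ that(1,2)] R related_pullback_rel[OF f g that(1,2)] that(3) by blast
    ultimately show "pullback eff f g W p q"
      unfolding pullback_def dom eff_simps(3) using p q dom(1,2) by simp
  next
    assume pb: "pullback eff f g W p q"
    then have p: "p \<in> hom eff W X" and q: "q \<in> hom eff W Y" and "eff_comp f p = eff_comp g q"
      unfolding pullback_def dom eff_simps(3) by blast+
    then have rel: "related (pullback_rel f g) p q" using related_pullback_rel[OF f g p q] by blast
    obtain W0 p0 q0 where "p0 \<in> hom eff W0 X" "q0 \<in> hom eff W0 Y" "tabulates (pullback_rel f g) W0 p0 q0"
      using pullback_tabulation_exists[OF assms] .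
    then have "tabulates (pullback_rel f g) W p q"
    proof (rule universal_span_tabulates[OF p q rel])
      fix V p' q'
      assume p': "p' \<in> hom eff V X" and q': "q' \<in> hom eff V Y" and "related (pullback_rel f g) p' q'"
      then have "eff_comp f p' = eff_comp g q'" using related_pullback_rel[OF f g p' q'] by blast
      then show "\<exists>!h. h \<in> hom eff V W \<and> eff_comp p h = p' \<and> eff_comp q h = q'"
        using pb p' q' hom_objects(1)[OF p'] unfolding pullback_def dom eff_simps(1,3) by blast
    qed
    with p q show ?R by blast
  qed
qed

text \<open>Forward, the projections of the kernel pair of \<open>m\<close> coincide when
  \<open>m\<close> is monic, and any two generic elements with the same value lie in it. Backward,
  an injective \<open>m\<close> is jointly monic with itself.\<close>

lemma monic_iff:
  fixes X Y :: "'u eff_obj"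
  assumes "set_universe TYPE('u)" and m: "m \<in> hom eff X Y"
  shows "monic eff m \<longleftrightarrow> (\<forall>S a a' b. app S m a b \<longrightarrow> app S m a' b \<longrightarrow> eqv S X a a')" (is "_ \<longleftrightarrow> ?R")
proof -
  have dom: "m \<in> Arr eff" "Dom eff m = X" using m unfolding hom_def by blast+
  show ?thesis
  proof
    assume mono: "monic eff m"
    obtain W p q where p: "p \<in> hom eff W X" and q: "q \<in> hom eff W X" and tab: "tabulates (pullback_rel m m) W p q"
      using pullback_tabulation_exists[OF assms(1) m m] .
    have "eff_comp m p = eff_comp m q"
      using related_pullback_rel[OF m m p q] tabulatesD(1)[OF tab] by blast
    then have "p = q" using mono p q hom_objects(1)[OF p] unfolding monic_def dom eff_simps(1,3) by blast
    show ?R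
    proof (intro allI impI)
      fix S a a' b
      assume "app S m a b" "app S m a' b"
      then obtain w where "app S p w a" "app S q w a'"
        using tabulatesD(3)[OF tab] unfolding pullback_rel_def by blast
      then show "eqv S X a a'" unfolding \<open>p = q\<close> by (rule app_unique[OF q])
    qed
  next
    assume R: ?R
    have "f = g" if f: "f \<in> hom eff Z X" and g: "g \<in> hom eff Z X" and "eff_comp m f = eff_comp m g" for Z f g
    proof (rule tabulation_unique[OF m m _ f g that(3,3)])
      show "jointly_monic X m m" by (rule jointly_monicI) (use R in blast)
    qed
    then show "monic eff m" unfolding monic_def dom eff_simps(3) using dom(1) by blast
  qed
qed


section \<open>Power objects\<close>

text \<open>Two predicates are forced to be coextensive iff they agree on generic elements at every
  refinement. It describes both equality in a power object and the graph of a classifying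
  arrow.\<close>

lemma forces_Inter_iff:
  fixes S :: "'u env set" and X :: "'u set"
  shows "S \<tturnstile> (\<lambda>s. (\<Inter>x\<in>X. \<phi> s x \<rightarrow>\<^sub>r \<psi> s x) \<sqinter>\<^sub>r (\<Inter>x\<in>X. \<psi> s x \<rightarrow>\<^sub>r \<phi> s x)) \<longleftrightarrow>
     (\<forall>S' h x. refines S' S h \<longrightarrow>
        (x \<in> S' \<rightarrow> X \<and> S' \<tturnstile> (\<lambda>s. \<phi> (h s) (x s))) = (x \<in> S' \<rightarrow> X \<and> S' \<tturnstile> (\<lambda>s. \<psi> (h s) (x s))))"
    (is "_ \<longleftrightarrow> ?R")
proof -
  define F where "F S' h x \<longleftrightarrow> S' \<tturnstile> (\<lambda>s. \<phi> (h s) (x s))" for S' h x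
  define G where "G S' h x \<longleftrightarrow> S' \<tturnstile> (\<lambda>s. \<psi> (h s) (x s))" for S' h x
  show ?thesis
    unfolding forces_conj forces_Inter_imp F_def[symmetric] G_def[symmetric] by blast
qed

definition sub_rel :: "'u eff_obj \<Rightarrow> 'u eff_obj \<Rightarrow> ('u \<times> 'u \<Rightarrow> nat set) \<Rightarrow> 'u generic_rel" where
  "sub_rel X Y \<Phi> S a b \<longleftrightarrow> eqv S X a a \<and> eqv S Y b b \<and> S \<tturnstile> (\<lambda>s. \<Phi> (a s, b s))"

text \<open>
  Equality in \<open>P\<close> is extensionality of the relation given by \<open>\<Phi>\<close>, which satisfies
  the comprehension scheme for extensional predicates.
\<close>

definition generic_power :: "'u eff_obj \<Rightarrow> 'u eff_obj \<Rightarrow> ('u \<times> 'u \<Rightarrow> nat set) \<Rightarrow> bool" where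
  "generic_power X P \<Phi> \<longleftrightarrow>
     (\<forall>S w w'. eqv S P w w' \<longleftrightarrow> eqv S P w w \<and> eqv S P w' w' \<and>
       (\<forall>S' h a. refines S' S h \<longrightarrow>
         sub_rel X P \<Phi> S' a (\<lambda>s. w (h s)) = sub_rel X P \<Phi> S' a (\<lambda>s. w' (h s)))) \<and>
     (\<forall>S a a' w w'. sub_rel X P \<Phi> S a w \<longrightarrow> eqv S X a a' \<longrightarrow> eqv S P w w' \<longrightarrow> sub_rel X P \<Phi> S a' w') \<and>
     (\<forall>S \<psi>. (\<forall>S' h a a'. refines S' S h \<longrightarrow> eqv S' X a a' \<longrightarrow>
         S' \<tturnstile> (\<lambda>s. \<psi> (h s) (a s)) \<longrightarrow> S' \<tturnstile> (\<lambda>s. \<psi> (h s) (a' s))) \<longrightarrow>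
       (\<exists>w. eqv S P w w \<and> (\<forall>S' h a. refines S' S h \<longrightarrow>
         sub_rel X P \<Phi> S' a (\<lambda>s. w (h s)) = (eqv S' X a a \<and> S' \<tturnstile> (\<lambda>s. \<psi> (h s) (a s))))))"

text \<open>
  The elements of the power object are arbitrary functions \<open>R\<close> from the carrier to sets of
  numbers, and \<open>R\<close> stands for its closure under the equality of \<open>X\<close>. Hence no realizers for
  strictness and extensionality of \<open>R\<close> have to be recorded.
\<close>

lemma generic_power_exists:
  fixes X :: "'u eff_obj"
  assumes univ: "set_universe TYPE('u)" and X: "X \<in> eff_objects"
  obtains P \<Phi> where "P \<in> eff_objects" "generic_power X P \<Phi>"
proof -
  obtain enc :: "('u \<Rightarrow> nat set) \<Rightarrow> 'u" where enc: "inj_on enc (fst X \<rightarrow>\<^sub>E UNIV)"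
      "enc ` (fst X \<rightarrow>\<^sub>E UNIV) \<prec> (UNIV :: 'u set)"
    using small_predicates[OF univ eff_objects_small[OF X]] by (rule small_encoding)
  define B where "B = enc ` (fst X \<rightarrow>\<^sub>E UNIV)"
  define dec where "dec = inv_into (fst X \<rightarrow>\<^sub>E UNIV) enc"
  have dec_enc: "dec (enc R) = R" if "R \<in> fst X \<rightarrow>\<^sub>E UNIV" for R
    unfolding dec_def by (rule inv_into_f_f[OF enc(1) that])
  define \<Phi> where "\<Phi> = (\<lambda>(a, w). \<Union>a'\<in>fst X. dec w a' \<sqinter>\<^sub>r snd X (a', a))"
  define P where "P = mk_object B (\<lambda>(w, w'). (\<Inter>a\<in>fst X. \<Phi> (a, w) \<rightarrow>\<^sub>r \<Phi> (a, w')) \<sqinter>\<^sub>r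
      (\<Inter>a\<in>fst X. \<Phi> (a, w') \<rightarrow>\<^sub>r \<Phi> (a, w)))"
  define mem where "mem S a w \<longleftrightarrow> a \<in> S \<rightarrow> fst X \<and> w \<in> S \<rightarrow> B \<and> S \<tturnstile> (\<lambda>s. \<Phi> (a s, w s))"
    for S :: "'u env set" and a w
  have mem_iff: "mem S a w \<longleftrightarrow> w \<in> S \<rightarrow> B \<and> (\<exists>a'. eqv S X a' a \<and> S \<tturnstile> (\<lambda>s. dec (w s) (a' s)))" for S a w
    unfolding mem_def \<Phi>_def prod.case forces_Union forces_conj eqv_def by blast
  have eqv_P: "eqv S P w w' \<longleftrightarrow> w \<in> S \<rightarrow> B \<and> w' \<in> S \<rightarrow> B \<and>
     (\<forall>S' h a. refines S' S h \<longrightarrow> mem S' a (\<lambda>s. w (h s)) = mem S' a (\<lambda>s. w' (h s)))" for S w w'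
  proof -
    have "mem S' a (\<lambda>s. w (h s)) \<longleftrightarrow> a \<in> S' \<rightarrow> fst X \<and> S' \<tturnstile> (\<lambda>s. \<Phi> (a s, w (h s)))"
      if "refines S' S h" "w \<in> S \<rightarrow> B" for S' h a w
    proof -
      have "(\<lambda>s. w (h s)) \<in> S' \<rightarrow> B" using that refines_in by blast
      then show ?thesis unfolding mem_def by simp
    qed
    then show ?thesis
      unfolding P_def eqv_mk_object prod.case forces_Inter_iff by (simp cong: conj_cong)
  qed
  have P: "P \<in> eff_objects"
    unfolding P_def
  proof (rule mk_object_eff_objects, fold P_def)
    show "B \<prec> (UNIV :: 'u set)" unfolding B_def by (rule enc(2))
  qed (unfold eqv_P, simp_all)
  \<comment> \<open>Every label of \<open>P\<close> exists at every stage, since a predicate is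
    trivially coextensive with itself.\<close>
  have eqv_P_refl: "eqv S P w w \<longleftrightarrow> w \<in> S \<rightarrow> B" for S w unfolding eqv_P by blast
  have sub_rel_mem: "sub_rel X P \<Phi> S a w \<longleftrightarrow> mem S a w" for S a w
  proof
    assume "mem S a w"
    moreover from this have "eqv S X a a" unfolding mem_iff by (blast intro: eqv_refl2[OF X])
    ultimately show "sub_rel X P \<Phi> S a w" unfolding sub_rel_def eqv_P_refl mem_def by blast
  next
    assume "sub_rel X P \<Phi> S a w"
    then show "mem S a w" unfolding sub_rel_def eqv_P_refl mem_def eqv_def[of _ X] by blast
  qed
  show thesis
  proof (rule that[OF P, of \<Phi>], unfold generic_power_def sub_rel_mem, intro conjI allI impI)
    fix S w w'
    show "eqv S P w w' \<longleftrightarrow> eqv S P w w \<and> eqv S P w' w' \<and>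
       (\<forall>S' h a. refines S' S h \<longrightarrow> mem S' a (\<lambda>s. w (h s)) = mem S' a (\<lambda>s. w' (h s)))"
      unfolding eqv_P[of S w w'] eqv_P_refl by blast
  next
    fix S a a' w w'
    assume mem: "mem S a w" and aa': "eqv S X a a'" and ww': "eqv S P w w'"
    from mem have "mem S a w'" using ww' refines_id unfolding eqv_P by blast
    then show "mem S a' w'" unfolding mem_iff using eqv_trans[OF X _ aa'] by blast
  next
    fix S and \<psi> :: "'u env \<Rightarrow> 'u \<Rightarrow> nat set"
    assume \<psi>: "\<forall>S' h a a'. refines S' S h \<longrightarrow> eqv S' X a a' \<longrightarrow>
         S' \<tturnstile> (\<lambda>s. \<psi> (h s) (a s)) \<longrightarrow> S' \<tturnstile> (\<lambda>s. \<psi> (h s) (a' s))"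
    \<comment> \<open>Comprehension costs no realizer: the whole environment \<open>s\<close>
      determines the label of the predicate \<open>\<psi> s\<close>, and labels of \<open>P\<close>
      always exist.\<close>
    define w where "w s = enc (restrict (\<psi> s) (fst X))" for s
    have dec_w: "dec (w s) = restrict (\<psi> s) (fst X)" for s unfolding w_def by (rule dec_enc) simp
    have w: "w \<in> S \<rightarrow> B" for S unfolding w_def B_def by auto
    have "mem S' a (\<lambda>s. w (h s)) \<longleftrightarrow> eqv S' X a a \<and> S' \<tturnstile> (\<lambda>s. \<psi> (h s) (a s))"
      if h: "refines S' S h" for S' h a
    proof -
      have "S' \<tturnstile> (\<lambda>s. dec (w (h s)) (a' s)) \<longleftrightarrow> S' \<tturnstile> (\<lambda>s. \<psi> (h s) (a' s))" if "eqv S' X a' a" for a'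
        using that unfolding dec_w by (intro forces_cong) (auto simp: eqv_def)
      then have "mem S' a (\<lambda>s. w (h s)) \<longleftrightarrow> (\<exists>a'. eqv S' X a' a \<and> S' \<tturnstile> (\<lambda>s. \<psi> (h s) (a' s)))"
        unfolding mem_iff using w by (auto simp: Pi_iff)
      then show ?thesis using \<psi>[rule_format, OF h] eqv_refl2[OF X] by blast
    qed
    then show "\<exists>w. eqv S P w w \<and> (\<forall>S' h a. refines S' S h \<longrightarrow>
         mem S' a (\<lambda>s. w (h s)) = (eqv S' X a a \<and> S' \<tturnstile> (\<lambda>s. \<psi> (h s) (a s))))"
      unfolding eqv_P_refl using w by blast
  qed
qed

text \<open>As for sets: \<open>E\<close> is the membership relation, \<open>m\<close> its inclusion
  into the product \<open>W\<close> of \<open>X\<close> and \<open>P\<close>, and \<chi> sends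
  \<open>i\<close> to the predicate naming the fibre of \<open>r\<close> over
  \<open>i\<close>.\<close>

lemma power_object_exists:
  fixes X :: "'u eff_obj"
  assumes univ: "set_universe TYPE('u)" and X: "X \<in> eff_objects"
  shows "\<exists>P W s1 s2 m. power_object eff X P W s1 s2 m"
proof -
  obtain P \<Phi> where P: "P \<in> eff_objects" and power: "generic_power X P \<Phi>"
    using generic_power_exists[OF assms] .
  define mem where "mem = sub_rel X P \<Phi>"
  note power = power[unfolded generic_power_def, folded mem_def]
  note eqv_P = power[THEN conjunct1, rule_format]
    and mem_cong = power[THEN conjunct2, THEN conjunct1, rule_format]
    and compr = power[THEN conjunct2, THEN conjunct2, rule_format]
  have mem_iff: "mem S a w \<longleftrightarrow> eqv S X a a \<and> eqv S P w w \<and> S \<tturnstile> (\<lambda>s. \<Phi> (a s, w s))" for S a w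
    unfolding mem_def sub_rel_def ..
  obtain E e1 e2 where e1: "e1 \<in> hom eff E X" and e2: "e2 \<in> hom eff E P" and E: "tabulates mem E e1 e2"
    using tabulation_exists[OF univ X P mem_iff mem_cong] .
  obtain W s1 s2 where s1: "s1 \<in> hom eff W X" and s2: "s2 \<in> hom eff W P"
    and W: "tabulates (product_rel X P) W s1 s2"
    using product_tabulation_exists[OF univ X P] .
  obtain m where m: "m \<in> hom eff E W" and s1m: "eff_comp s1 m = e1" and s2m: "eff_comp s2 m = e2"
    using tabulation_pairing[OF s1 s2 W e1 e2 related_product_rel[OF e1 e2]] by blast
  have m1: "app S e1 e a \<longleftrightarrow> app S s1 w a" and m2: "app S e2 e p \<longleftrightarrow> app S s2 w p" if "app S m e w" for S e w a p
    using app_comp_at[OF m s1 that] app_comp_at[OF m s2 that] unfolding s1m s2m by blast+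
  \<comment> \<open>An element of \<open>W\<close> is determined by its components, so equality of
    components decides the value of \<open>m\<close>.\<close>
  have m_app: "app S m e w" if e: "app S e1 e a" "app S e2 e p" and w: "app S s1 w a" "app S s2 w p" for S e w a p
  proof -
    from app_total[OF m app_eqv1[OF e1 e(1)]] obtain w' where w': "app S m e w'" ..
    with e have "app S s1 w' a" "app S s2 w' p" using m1 m2 by blast+
    from app_cong2[OF m w' jointly_monicD[OF tabulatesD(2)[OF W] this(1) w(1) this(2) w(2)]] show ?thesis .
  qed
  have W_total: "\<exists>a p. app S s1 w a \<and> app S s2 w p" if "eqv S W w w" for S w
    using app_total[OF s1 that] app_total[OF s2 that] by blast
  have m_monic: "monic eff m"
    unfolding monic_iff[OF univ m]
  proof (intro allI impI)
    fix S e e' w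
    assume e: "app S m e w" and e': "app S m e' w"
    obtain a p where "app S s1 w a" "app S s2 w p" using W_total[OF app_eqv2[OF m e]] by blast
    with e e' show "eqv S E e e'" using m1 m2 by (blast intro: jointly_monicD[OF tabulatesD(2)[OF E]])
  qed
  have "\<exists>!\<chi>. \<chi> \<in> hom eff I P \<and> (\<exists>h k. h \<in> hom eff T W \<and> eff_comp s1 h = t1 \<and>
      eff_comp s2 h = eff_comp \<chi> t2 \<and> pullback eff h m (Dom eff r) r k)"
    if prod: "product eff X I T t1 t2" and r_monic: "monic eff r" and cod_r: "Cod eff r = T" for I T t1 t2 r
  proof -
    have t1: "t1 \<in> hom eff T X" and t2: "t2 \<in> hom eff T I" using prod unfolding product_def by blast+
    note I = hom_objects(2)[OF t2]
    have T: "tabulates (product_rel X I) T t1 t2" using prod product_iff[OF univ X I] by blast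
    define R where "R = Dom eff r"
    have r: "r \<in> hom eff R T" using r_monic cod_r unfolding monic_def hom_def R_def by blast
    have r_inj: "eqv S R x x'" if "app S r x t" "app S r x' t" for S x x' t
      using r_monic that unfolding monic_iff[OF univ r] by blast
    \<comment> \<open>The subobject \<open>r\<close>, read as a relation between \<open>X\<close>
      and \<open>I\<close> through the given product \<open>T\<close>.\<close>
    define Q where "Q S a i \<longleftrightarrow> (\<exists>x t. app S r x t \<and> app S t1 t a \<and> app S t2 t i)" for S a i
    obtain Fr F1 F2 where F: "r = mk_arrow R T Fr" "t1 = mk_arrow T X F1" "t2 = mk_arrow T I F2"
      using r t1 t2 unfolding hom_iff by blast
    define \<Psi> where "\<Psi> = (\<lambda>(a, i). \<Union>x\<in>fst R. \<Union>t\<in>fst T. Fr (x, t) \<sqinter>\<^sub>r F1 (t, a) \<sqinter>\<^sub>r F2 (t, i))"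
    have Q_\<Psi>: "Q S a i \<longleftrightarrow> a \<in> S \<rightarrow> fst X \<and> i \<in> S \<rightarrow> fst I \<and> S \<tturnstile> (\<lambda>s. \<Psi> (a s, i s))" for S a i
      unfolding Q_def F app_mk_arrow rel_def \<Psi>_def prod.case forces_Union forces_conj by blast
    have Q_eqv: "eqv S X a a" "eqv S I i i" if "Q S a i" for S a i
      using that app_eqv2[OF t1] app_eqv2[OF t2] unfolding Q_def by blast+
    have Q_cong: "Q S a' i'" if "Q S a i" "eqv S X a a'" "eqv S I i i'" for S a i a' i'
      using that app_cong2[OF t1] app_cong2[OF t2] unfolding Q_def by blast
    have eqv_mem: "i \<in> S \<rightarrow> fst Y" if "eqv S Y i i" for i S and Y :: "'u eff_obj"
      using that unfolding eqv_def by blast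

    \<comment> \<open>The graph of \<chi>: \<open>w\<close> is a value at \<open>i\<close> iff
      \<open>a\<close> belongs to \<open>w\<close> exactly when \<open>Q\<close> relates
      \<open>a\<close> to \<open>i\<close>, for all \<open>a\<close>.\<close>
    define K where "K = (\<lambda>(i, w). snd I (i, i) \<sqinter>\<^sub>r snd P (w, w) \<sqinter>\<^sub>r
        (\<Inter>a\<in>fst X. snd X (a, a) \<sqinter>\<^sub>r \<Phi> (a, w) \<rightarrow>\<^sub>r \<Psi> (a, i)) \<sqinter>\<^sub>r
        (\<Inter>a\<in>fst X. \<Psi> (a, i) \<rightarrow>\<^sub>r snd X (a, a) \<sqinter>\<^sub>r \<Phi> (a, w)))"
    have K: "rel S (fst I) (fst P) K i w \<longleftrightarrow> eqv S I i i \<and> eqv S P w w \<and>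
        (\<forall>S' h a. refines S' S h \<longrightarrow> mem S' a (\<lambda>s. w (h s)) = Q S' a (\<lambda>s. i (h s)))" for S i w
    proof -
      have "rel S (fst I) (fst P) K i w \<longleftrightarrow> eqv S I i i \<and> eqv S P w w \<and>
        (\<forall>S' h a. refines S' S h \<longrightarrow>
          (a \<in> S' \<rightarrow> fst X \<and> S' \<tturnstile> (\<lambda>s. snd X (a s, a s) \<sqinter>\<^sub>r \<Phi> (a s, w (h s)))) =
          (a \<in> S' \<rightarrow> fst X \<and> S' \<tturnstile> (\<lambda>s. \<Psi> (a s, i (h s)))))"
        unfolding rel_def K_def prod.case forces_conj[of S "\<lambda>s. snd I (i s, i s)"]
          forces_conj[of S "\<lambda>s. snd P (w s, w s)"]
          forces_Inter_iff eqv_def by blast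
      moreover have "mem S' a (\<lambda>s. w (h s)) \<longleftrightarrow>
          a \<in> S' \<rightarrow> fst X \<and> S' \<tturnstile> (\<lambda>s. snd X (a s, a s) \<sqinter>\<^sub>r \<Phi> (a s, w (h s)))"
        if h: "refines S' S h" and w: "eqv S P w w" for S' h a
        unfolding mem_iff forces_conj using eqv_mono[OF h w] by (simp add: eqv_def[of _ X])
      moreover have "Q S' a (\<lambda>s. i (h s)) \<longleftrightarrow> a \<in> S' \<rightarrow> fst X \<and> S' \<tturnstile> (\<lambda>s. \<Psi> (a s, i (h s)))"
        if h: "refines S' S h" and i: "eqv S I i i" for S' h a
        unfolding Q_\<Psi> using eqv_mem[OF eqv_mono[OF h i]] by simp
      ultimately show ?thesis by (simp cong: conj_cong)
    qed
    define \<chi> where "\<chi> = mk_arrow I P K"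
    note \<chi>_app = app_mk_arrow[of _ I P K, folded \<chi>_def, unfolded K]
    have \<chi>: "\<chi> \<in> hom eff I P"
      unfolding \<chi>_def
    proof (rule mk_arrow_hom[OF I P], unfold K)
      fix S :: "'u env set" and i i' w w'
      assume iw: "eqv S I i i \<and> eqv S P w w \<and>
        (\<forall>S' h a. refines S' S h \<longrightarrow> mem S' a (\<lambda>s. w (h s)) = Q S' a (\<lambda>s. i (h s)))"
      then show "eqv S I i i \<and> eqv S P w w" by blast
      show "eqv S I i' i' \<and> eqv S P w' w' \<and>
        (\<forall>S' h a. refines S' S h \<longrightarrow> mem S' a (\<lambda>s. w' (h s)) = Q S' a (\<lambda>s. i' (h s)))"
        if ii': "eqv S I i i'" and ww': "eqv S P w w'"
      proof (intro conjI allI impI)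
        show "eqv S I i' i'" "eqv S P w' w'" using eqv_refl2[OF I ii'] eqv_refl2[OF P ww'] by blast+
        fix S' h a
        assume h: "refines S' S h"
        have "Q S' a (\<lambda>s. i' (h s)) \<longleftrightarrow> Q S' a (\<lambda>s. i (h s))"
          using Q_cong Q_eqv(1) eqv_mono[OF h ii'] eqv_sym[OF I] by blast
        moreover have "mem S' a (\<lambda>s. w' (h s)) = mem S' a (\<lambda>s. w (h s))"
          using ww' h eqv_P[of S w w'] by simp
        ultimately show "mem S' a (\<lambda>s. w' (h s)) = Q S' a (\<lambda>s. i' (h s))" using iw h by simp
      qed
      show "eqv S P w w'" if "eqv S I i i \<and> eqv S P w' w' \<and>
        (\<forall>S' h a. refines S' S h \<longrightarrow> mem S' a (\<lambda>s. w' (h s)) = Q S' a (\<lambda>s. i (h s)))"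
        using iw that eqv_P[of S w w'] by simp
    next
      fix S :: "'u env set" and i
      assume i: "eqv S I i i"
      \<comment> \<open>Totality of \<chi> is comprehension for the fibre of \<open>Q\<close> over
        \<open>i\<close>.\<close>
      have "\<exists>w. eqv S P w w \<and> (\<forall>S' h a. refines S' S h \<longrightarrow>
         mem S' a (\<lambda>s. w (h s)) = (eqv S' X a a \<and> S' \<tturnstile> (\<lambda>s. \<Psi> (a s, i (h s)))))"
      proof (rule compr)
        fix S' h a a'
        assume h: "refines S' S h" and aa': "eqv S' X a a'" and \<psi>: "S' \<tturnstile> (\<lambda>s. \<Psi> (a s, i (h s)))"
        have "Q S' a (\<lambda>s. i (h s))"
          unfolding Q_\<Psi> using \<psi> eqv_mem[OF eqv_mono[OF h i]] eqv_mem[OF eqv_refl1[OF X aa']] by blast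
        from Q_cong[OF this aa' eqv_mono[OF h i]]
        show "S' \<tturnstile> (\<lambda>s. \<Psi> (a' s, i (h s)))" unfolding Q_\<Psi> by blast
      qed
      then obtain w where w: "eqv S P w w" and w_mem: "\<And>S' h a. refines S' S h \<Longrightarrow>
         mem S' a (\<lambda>s. w (h s)) = (eqv S' X a a \<and> S' \<tturnstile> (\<lambda>s. \<Psi> (a s, i (h s))))" by blast
      have "mem S' a (\<lambda>s. w (h s)) = Q S' a (\<lambda>s. i (h s))" if h: "refines S' S h" for S' h a
      proof
        assume "mem S' a (\<lambda>s. w (h s))"
        then show "Q S' a (\<lambda>s. i (h s))"
          unfolding w_mem[OF h] Q_\<Psi> using eqv_mem[OF eqv_mono[OF h i]] eqv_mem[of S' X a] by blast
      next
        assume q: "Q S' a (\<lambda>s. i (h s))"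
        then show "mem S' a (\<lambda>s. w (h s))"
          unfolding w_mem[OF h] using Q_eqv(1)[OF q] q[unfolded Q_\<Psi>] by blast
      qed
      with i w show "\<exists>w. eqv S I i i \<and> eqv S P w w \<and>
        (\<forall>S' h a. refines S' S h \<longrightarrow> mem S' a (\<lambda>s. w (h s)) = Q S' a (\<lambda>s. i (h s)))" by blast
    qed
    have \<chi>_mem: "mem S a w \<longleftrightarrow> Q S a i" if "app S \<chi> i w" for S a i w
      using that refines_id[of S] unfolding \<chi>_app by blast
    have \<chi>t2: "eff_comp \<chi> t2 \<in> hom eff T P" by (rule comp_hom[OF t2 \<chi>])
    obtain h where h: "h \<in> hom eff T W" and s1h: "eff_comp s1 h = t1" and s2h: "eff_comp s2 h = eff_comp \<chi> t2"
      using tabulation_pairing[OF s1 s2 W t1 \<chi>t2 related_product_rel[OF t1 \<chi>t2]] by blast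
    have t1r: "eff_comp t1 r \<in> hom eff R X" and \<chi>t2r: "eff_comp (eff_comp \<chi> t2) r \<in> hom eff R P"
      by (rule comp_hom[OF r t1], rule comp_hom[OF r \<chi>t2])
    have "related mem (eff_comp t1 r) (eff_comp (eff_comp \<chi> t2) r)"
    proof (rule relatedI)
      fix S x a w
      assume "app S (eff_comp t1 r) x a" and w: "app S (eff_comp (eff_comp \<chi> t2) r) x w"
      then obtain t where t: "app S r x t" "app S t1 t a" unfolding app_comp[OF r t1] by blast
      with w obtain i where "app S t2 t i" "app S \<chi> i w"
        unfolding app_comp_at[OF r \<chi>t2 t(1)] app_comp[OF t2 \<chi>] by blast
      with t show "mem S a w" unfolding \<chi>_mem[OF \<open>app S \<chi> i w\<close>] Q_def by blast
    qed
    from tabulation_pairing[OF e1 e2 E t1r \<chi>t2r this] obtain k where k: "k \<in> hom eff R E"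
      and e1k: "eff_comp e1 k = eff_comp t1 r" and e2k: "eff_comp e2 k = eff_comp (eff_comp \<chi> t2) r" by blast
    have k_app: "app S e1 e a \<longleftrightarrow> app S t1 t a" "app S e2 e w \<longleftrightarrow> app S (eff_comp \<chi> t2) t w"
      if "app S r x t" "app S k x e" for S x t e a w
      using app_comp_at[OF k e1 that(2)] app_comp_at[OF k e2 that(2)]
        app_comp_at[OF r t1 that(1)] app_comp_at[OF r \<chi>t2 that(1)] unfolding e1k e2k by blast+
    have h_app: "app S s1 w a \<longleftrightarrow> app S t1 t a" "app S s2 w p \<longleftrightarrow> app S (eff_comp \<chi> t2) t p"
      if "app S h t w" for S t w a p
      using app_comp_at[OF h s1 that] app_comp_at[OF h s2 that] unfolding s1h s2h by blast+
    have "tabulates (pullback_rel h m) R r k"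
    proof (rule tabulatesI[OF relatedI jointly_monicI])
      fix S x t e
      assume t: "app S r x t" and e: "app S k x e"
      from app_total[OF h app_eqv2[OF r t]] obtain w where w: "app S h t w" ..
      obtain a p where "app S s1 w a" "app S s2 w p" using W_total[OF app_eqv2[OF h w]] by blast
      moreover from this have "app S e1 e a" "app S e2 e p"
        unfolding k_app[OF t e] h_app[OF w] by blast+
      ultimately have "app S m e w" using m_app by blast
      with w show "pullback_rel h m S t e" unfolding pullback_rel_def by blast
    next
      fix S x x' t
      assume "app S r x t" "app S r x' t"
      then show "eqv S R x x'" by (rule r_inj)
    next
      fix S t e
      assume "pullback_rel h m S t e"
      then obtain w where w: "app S h t w" "app S m e w" unfolding pullback_rel_def by blast
      obtain a p where ap: "app S s1 w a" "app S s2 w p" using W_total[OF app_eqv2[OF h w(1)]] by blast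
      then have t: "app S t1 t a" "app S (eff_comp \<chi> t2) t p" unfolding h_app[OF w(1)] by blast+
      then obtain i where i: "app S t2 t i" "app S \<chi> i p" unfolding app_comp[OF t2 \<chi>] by blast
      have e: "app S e1 e a" "app S e2 e p" using ap m1[OF w(2)] m2[OF w(2)] by blast+
      \<comment> \<open>Membership of \<open>a\<close> in \<open>p\<close>, a value of \<chi> at
        \<open>i\<close>, yields a preimage under \<open>r\<close>; joint monicity of
        \<open>t1\<close> and \<open>t2\<close> then places it over \<open>t\<close>.\<close>
      then have "Q S a i" using relatedD[OF tabulatesD(1)[OF E]] \<chi>_mem[OF i(2)] by blast
      then obtain x t' where x: "app S r x t'" "app S t1 t' a" "app S t2 t' i" unfolding Q_def by blast
      have "eqv S T t' t" by (rule jointly_monicD[OF tabulatesD(2)[OF T] x(2) t(1) x(3) i(1)])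
      then have xt: "app S r x t" by (rule app_cong2[OF r x(1)])
      from app_total[OF k app_eqv1[OF r xt]] obtain e' where e': "app S k x e'" ..
      have "app S e1 e' a" "app S e2 e' p" using t unfolding k_app[OF xt e'] by blast+
      with e have "eqv S E e' e" by (blast intro: jointly_monicD[OF tabulatesD(2)[OF E]])
      then have "app S k x e" by (rule app_cong2[OF k e'])
      with xt show "\<exists>x. app S r x t \<and> app S k x e" by blast
    qed
    then have pb: "pullback eff h m R r k" using r k pullback_iff[OF univ h m] by blast
    show ?thesis
    proof (rule ex1I[of _ \<chi>])
      show "\<chi> \<in> hom eff I P \<and> (\<exists>h k. h \<in> hom eff T W \<and> eff_comp s1 h = t1 \<and>
        eff_comp s2 h = eff_comp \<chi> t2 \<and> pullback eff h m (Dom eff r) r k)"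
        using \<chi> h s1h s2h pb unfolding R_def by blast
    next
      fix \<chi>'
      assume "\<chi>' \<in> hom eff I P \<and> (\<exists>h k. h \<in> hom eff T W \<and> eff_comp s1 h = t1 \<and>
        eff_comp s2 h = eff_comp \<chi>' t2 \<and> pullback eff h m (Dom eff r) r k)"
      then obtain h' k' where \<chi>': "\<chi>' \<in> hom eff I P" and h': "h' \<in> hom eff T W"
        and s1h': "eff_comp s1 h' = t1" and s2h': "eff_comp s2 h' = eff_comp \<chi>' t2"
        and "pullback eff h' m R r k'" unfolding R_def by blast
      then have k': "k' \<in> hom eff R E" and tab': "tabulates (pullback_rel h' m) R r k'"
        using pullback_iff[OF univ h' m] by blast+
      have h'_app: "app S s1 w a \<longleftrightarrow> app S t1 t a" "app S s2 w p \<longleftrightarrow> app S (eff_comp \<chi>' t2) t p"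
        if "app S h' t w" for S t w a p
        using app_comp_at[OF h' s1 that] app_comp_at[OF h' s2 that] unfolding s1h' s2h' by blast+
      \<comment> \<open>The pullback property of any classifying arrow fixes the members of its
        values: they are the fibre of \<open>Q\<close>.\<close>
      have \<chi>'_mem: "mem S a p \<longleftrightarrow> Q S a i" if ip: "app S \<chi>' i p" for S a i p
      proof
        assume mem: "mem S a p"
        from tabulatesD(3)[OF E mem] obtain e where e: "app S e1 e a" "app S e2 e p" by blast
        have "product_rel X I S a i"
          using mem app_eqv1[OF \<chi>' ip] unfolding mem_iff product_rel_def by blast
        from tabulatesD(3)[OF T this] obtain t where t: "app S t1 t a" "app S t2 t i" by blast
        from app_total[OF h' app_eqv1[OF t1 t(1)]] obtain w where w: "app S h' t w" ..
        have "app S s1 w a" "app S s2 w p"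
          unfolding h'_app[OF w] app_comp[OF t2 \<chi>'] using t ip by blast+
        from m_app[OF e this] w have "pullback_rel h' m S t e" unfolding pullback_rel_def by blast
        from tabulatesD(3)[OF tab' this] t show "Q S a i" unfolding Q_def by blast
      next
        assume "Q S a i"
        then obtain x t where t: "app S r x t" "app S t1 t a" "app S t2 t i" unfolding Q_def by blast
        from app_total[OF k' app_eqv1[OF r t(1)]] obtain e where e: "app S k' x e" ..
        from relatedD[OF tabulatesD(1)[OF tab'] t(1) e] obtain w where w: "app S h' t w" "app S m e w"
          unfolding pullback_rel_def by blast
        have "app S s1 w a" "app S s2 w p"
          unfolding h'_app[OF w(1)] app_comp[OF t2 \<chi>'] using t ip by blast+
        then show "mem S a p"
          using relatedD[OF tabulatesD(1)[OF E]] m1[OF w(2)] m2[OF w(2)] by blast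
      qed
      show "\<chi>' = \<chi>"
      \<comment> \<open>The graph of \<chi> speaks of all refinements, so the value of
        \<open>\<chi>'\<close> is first carried there by \<open>app_mono\<close>.\<close>
      proof (rule app_ext[OF \<chi>' \<chi>])
        fix S i p
        assume "app S \<chi>' i p"
        then show "app S \<chi> i p"
          unfolding \<chi>_app using app_eqv1[OF \<chi>'] app_eqv2[OF \<chi>'] \<chi>'_mem[OF app_mono] by blast
      qed
    qed
  qed
  moreover have "product eff X P W s1 s2" using product_iff[OF univ X P] s1 s2 W by blast
  moreover have "Cod eff m = W" using m unfolding hom_def by blast
  ultimately have "power_object eff X P W s1 s2 m"
    unfolding power_object_def eff_simps(3) using m_monic by blast
  then show ?thesis by blast
qed

lemma elementary_topos_eff:
  assumes univ: "set_universe TYPE('u)"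
  shows "elementary_topos (eff :: ('u eff_obj, 'u eff_arr) cat)"
  unfolding elementary_topos_def
proof (intro conjI ballI impI)
  show "category (eff :: ('u eff_obj, 'u eff_arr) cat)" by (rule category_eff)
  show "\<exists>t. terminal eff (t :: 'u eff_obj)" using terminal_unit_object[OF univ] ..
  show "\<exists>P S s1 s2 m. power_object eff X P S s1 s2 m" if "X \<in> Obj eff" for X :: "'u eff_obj"
    using power_object_exists[OF univ] that by simp
  fix f g :: "'u eff_arr"
  assume "f \<in> Arr eff" "g \<in> Arr eff" "Cod eff f = Cod eff g"
  then have fg: "f \<in> hom eff (Dom eff f) (Cod eff f)" "g \<in> hom eff (Dom eff g) (Cod eff f)"
    unfolding hom_def by simp_all
  obtain W p q where "p \<in> hom eff W (Dom eff f)" "q \<in> hom eff W (Dom eff g)" "tabulates (pullback_rel f g) W p q"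
    using pullback_tabulation_exists[OF univ fg] .
  then show "\<exists>s p q. pullback eff f g s p q" using pullback_iff[OF univ fg] by blast
qed

section \<open>Global points\<close>

text \<open>One number realizing that \<open>x\<close> equals itself makes the constant function at
  \<open>x\<close> a generic element of every stage, hence a value of a global point.\<close>

lemma point_exists:
  fixes X :: "'u eff_obj"
  assumes univ: "set_universe TYPE('u)" and X: "X \<in> eff_objects" and x: "x \<in> fst X" "snd X (x, x) \<noteq> {}"
  obtains f where "f \<in> hom eff unit_object X"
    "\<And>S u a. app S f u a \<longleftrightarrow> u \<in> S \<rightarrow> {undefined} \<and> eqv S X (\<lambda>s. x) a"
proof -
  have fst: "fst unit_object = {undefined}" by (simp add: unit_object_def mk_object_def)
  have rel: "rel S (fst unit_object) (fst X) (\<lambda>(u, a). snd X (x, a)) u a \<longleftrightarrow>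
      u \<in> S \<rightarrow> {undefined} \<and> eqv S X (\<lambda>s. x) a" for S u a
    unfolding rel_def eqv_def fst using x(1) by auto
  have xx: "eqv S X (\<lambda>s. x) (\<lambda>s. x)" for S
    using x by (auto simp: eqv_def intro: forces_const)
  have "mk_arrow unit_object X (\<lambda>(u, a). snd X (x, a)) \<in> hom eff unit_object X"
  proof (rule mk_arrow_hom[OF unit_object_eff_objects[OF univ] X], unfold rel eqv_unit_object)
    fix S :: "'u env set" and u u' a a'
    assume a: "u \<in> S \<rightarrow> {undefined} \<and> eqv S X (\<lambda>s. x) a"
    then show "(u \<in> S \<rightarrow> {undefined} \<and> u \<in> S \<rightarrow> {undefined}) \<and> eqv S X a a"
      using eqv_refl2[OF X] by blast
    show "u' \<in> S \<rightarrow> {undefined} \<and> eqv S X (\<lambda>s. x) a'"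
      if "u \<in> S \<rightarrow> {undefined} \<and> u' \<in> S \<rightarrow> {undefined}" "eqv S X a a'"
      using a that eqv_trans[OF X] by blast
    show "eqv S X a a'" if "u \<in> S \<rightarrow> {undefined} \<and> eqv S X (\<lambda>s. x) a'"
      using a that eqv_trans[OF X] eqv_sym[OF X] by blast
  qed (use xx in blast)
  then show thesis by (rule that) (simp only: app_mk_arrow rel)
qed

lemma app_empty: "f \<in> hom eff X Y \<Longrightarrow> app {} f a b"
  unfolding hom_iff by (auto simp: app_mk_arrow rel_def)

text \<open>Without realized self-equalities, generic elements of \<open>X\<close> occur only at the
  empty stage, where everything is forced. This is the uniqueness half of initiality.\<close>

lemma pointless_initial:
  assumes "\<And>x. x \<in> fst X \<Longrightarrow> snd X (x, x) = {}" "f \<in> hom eff X Y" "g \<in> hom eff X Y"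
  shows "f = g"
proof (rule app_ext[OF assms(2,3)])
  fix S a b
  assume "app S f a b"
  then have "eqv S X a a" by (rule app_eqv1[OF assms(2)])
  then have "S = {}" using assms(1) forces_nonempty[of S "\<lambda>s. snd X (a s, a s)"] unfolding eqv_def by blast
  then show "app S g a b" using app_empty[OF assms(3)] by simp
qed

text \<open>If no label of \<open>A\<close> existed, all parallel arrows out of \<open>A\<close>
  would agree, and the epimorphism \<open>b\<close> would make all parallel arrows out of
  \<open>t\<close> agree. An object with two distinct global points refutes this.\<close>

lemma well_supported_point:
  fixes A :: "'u eff_obj"
  assumes univ: "set_universe TYPE('u)" and t: "terminal eff t" and b: "b \<in> hom eff A t" and epi: "epic eff b"
  shows "\<exists>x\<in>fst A. snd A (x, x) \<noteq> {}"
proof (rule ccontr)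
  assume "\<not> ?thesis"
  then have pointless: "\<And>x. x \<in> fst A \<Longrightarrow> snd A (x, x) = {}" by blast
  obtain c :: 'u where c: "c \<noteq> undefined"
    using ex_new_if_finite[OF set_universe_infinite[OF univ], of "{undefined}"] by auto
  \<comment> \<open>The object 1 + 1: two labels that no number proves equal.\<close>
  define D where "D = mk_object {undefined, c} (\<lambda>(x, y). if x = y then UNIV else {})"
  have eqv_D: "eqv S D a b \<longleftrightarrow> a \<in> S \<rightarrow> {undefined, c} \<and> b \<in> S \<rightarrow> {undefined, c} \<and> (\<forall>s\<in>S. a s = b s)" for S a b
  proof -
    have "S \<tturnstile> (\<lambda>s. if a s = b s then UNIV else {}) \<longleftrightarrow> (\<forall>s\<in>S. a s = b s)"
    proof
      assume L: "S \<tturnstile> (\<lambda>s. if a s = b s then UNIV else {})"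
      show "\<forall>s\<in>S. a s = b s"
      proof
        fix s
        assume "s \<in> S"
        from forces_nonempty[OF L this] show "a s = b s" by (cases "a s = b s") simp_all
      qed
    next
      assume "\<forall>s\<in>S. a s = b s"
      then show "S \<tturnstile> (\<lambda>s. if a s = b s then UNIV else {})"
        by (subst forces_cong[of S _ "\<lambda>s. UNIV"]) simp_all
    qed
    then show ?thesis unfolding D_def eqv_mk_object by simp
  qed
  have D: "D \<in> eff_objects"
    unfolding D_def
    by (rule mk_object_eff_objects[OF finite_lesspoll_infinite[OF set_universe_infinite[OF univ]]], fold D_def)
      (simp_all add: eqv_D)
  have D_fst: "undefined \<in> fst D" "c \<in> fst D" and D_snd: "snd D (undefined, undefined) \<noteq> {}" "snd D (c, c) \<noteq> {}"
    by (simp_all add: D_def mk_object_def)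
  obtain f0 where f0: "f0 \<in> hom eff unit_object D"
    and f0_app: "\<And>S u a. app S f0 u a \<longleftrightarrow> u \<in> S \<rightarrow> {undefined} \<and> eqv S D (\<lambda>s. undefined) a"
    using point_exists[OF univ D D_fst(1) D_snd(1)] by metis
  obtain f1 where f1: "f1 \<in> hom eff unit_object D"
    and f1_app: "\<And>S u a. app S f1 u a \<longleftrightarrow> u \<in> S \<rightarrow> {undefined} \<and> eqv S D (\<lambda>s. c) a"
    using point_exists[OF univ D D_fst(2) D_snd(2)] by metis
  have unit: "(unit_object :: 'u eff_obj) \<in> Obj eff" using unit_object_eff_objects[OF univ] by simp
  have t_obj: "t \<in> Obj eff" using t unfolding terminal_def by blast
  obtain j where j: "j \<in> hom eff t unit_object"
    using terminal_unit_object[OF univ] t_obj unfolding terminal_def by blast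
  obtain k where k: "k \<in> hom eff unit_object t" using t unit unfolding terminal_def by blast
  \<comment> \<open>The terminal object \<open>t\<close> is arbitrary, while the two points start at
    \<open>unit_object\<close>; this composite brings an equation over \<open>t\<close> back
    there.\<close>
  have jk: "eff_comp j k = Id eff unit_object"
    using terminal_unit_object[OF univ] unit comp_hom[OF k j] category.id_hom[OF category_eff unit]
    unfolding terminal_def by blast
  have "eff_comp (eff_comp f0 j) b = eff_comp (eff_comp f1 j) b"
    by (rule pointless_initial[OF pointless comp_hom[OF b comp_hom[OF j f0]] comp_hom[OF b comp_hom[OF j f1]]])
  moreover have "Cod eff b = t" using b unfolding hom_def by blast
  ultimately have "eff_comp f0 j = eff_comp f1 j"
    using epi D comp_hom[OF j f0] comp_hom[OF j f1] unfolding epic_def eff_simps(1,3) by blast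
  then have "eff_comp f0 (eff_comp j k) = eff_comp f1 (eff_comp j k)"
    using category.comp_assoc[OF category_eff k j] f0 f1 unfolding eff_simps(3) by metis
  then have eq: "f0 = f1"
    using category.id_right[OF category_eff] f0 f1 unfolding jk eff_simps(3) by metis
  \<comment> \<open>Any nonempty stage separates the points, since equality in \<open>D\<close> is
    equality of labels.\<close>
  have "app {[]} f0 (\<lambda>s. undefined) (\<lambda>s. undefined)" unfolding f0_app eqv_D by simp
  then show False unfolding eq f1_app eqv_D using c by simp
qed

theorem proposition2p4:
  assumes "set_universe TYPE('u)"
  shows "hilbertian_topos (eff :: ('u eff_obj, 'u eff_arr) cat)"
  unfolding hilbertian_topos_def
proof (intro conjI allI impI)
  show "elementary_topos (eff :: ('u eff_obj, 'u eff_arr) cat)" by (rule elementary_topos_eff[OF assms])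
  fix t A X :: "'u eff_obj" and b p
  assume "terminal eff t \<and> b \<in> hom eff A t \<and> epic eff b \<and> p \<in> hom eff X A \<and> monic eff p"
  then have t: "terminal eff t" and b: "b \<in> hom eff A t" and epi: "epic eff b" and p: "p \<in> hom eff X A"
    by blast+
  note cat = category_eff
  have t_obj: "t \<in> Obj eff" using t unfolding terminal_def by blast
  have X_obj: "X \<in> Obj eff" and A: "A \<in> eff_objects" using hom_objects[OF p] by simp_all
  note X = hom_objects(1)[OF p]
  obtain e where e: "e \<in> hom eff X t" using t X_obj unfolding terminal_def by blast
  obtain j where j: "j \<in> hom eff t unit_object"
    using terminal_unit_object[OF assms] t_obj unfolding terminal_def by blast
  have id_t: "Id eff t \<in> hom eff t t" and id_X: "Id eff X \<in> hom eff X X"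
    using category.id_hom[OF cat] t_obj X_obj by blast+
  show "\<exists>U e i u \<epsilon>. e \<in> hom eff X U \<and> epic eff e \<and> i \<in> hom eff U t \<and> monic eff i \<and>
      u \<in> hom eff U X \<and> \<epsilon> \<in> hom eff t A \<and> p \<odot>\<^bsub>eff\<^esub> u = \<epsilon> \<odot>\<^bsub>eff\<^esub> i"
  proof (cases "\<exists>x\<in>fst X. snd X (x, x) \<noteq> {}")
    \<comment> \<open>Here \<open>U = t\<close> with \<open>i\<close> the identity, and \<epsilon>
      is the image under \<open>p\<close> of a point of \<open>X\<close>.\<close>
    case True
    then obtain x where "x \<in> fst X" "snd X (x, x) \<noteq> {}" by blast
    from point_exists[OF assms X this] obtain f where f: "f \<in> hom eff unit_object X" by metis
    define u where "u = eff_comp f j"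
    have u: "u \<in> hom eff t X" unfolding u_def by (rule comp_hom[OF j f])
    have eu: "eff_comp e u = Id eff t"
      using t t_obj comp_hom[OF u e] id_t unfolding terminal_def by blast
    have "epic eff e"
      unfolding epic_def
    proof (intro conjI ballI impI)
      show "e \<in> Arr eff" using e unfolding hom_def by blast
      have cod: "Cod eff e = t" using e unfolding hom_def by blast
      fix z f g
      assume f: "f \<in> hom eff (Cod eff e) z" and g: "g \<in> hom eff (Cod eff e) z"
        and fg: "f \<odot>\<^bsub>eff\<^esub> e = g \<odot>\<^bsub>eff\<^esub> e"
      have "f = f \<odot>\<^bsub>eff\<^esub> (e \<odot>\<^bsub>eff\<^esub> u)"
        using category.id_right[OF cat f] unfolding eff_simps(3) eu cod by simp
      also have "\<dots> = g \<odot>\<^bsub>eff\<^esub> (e \<odot>\<^bsub>eff\<^esub> u)"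
        using category.comp_assoc[OF cat u e] f g fg unfolding cod by metis
      also have "\<dots> = g" using category.id_right[OF cat g] unfolding eff_simps(3) eu cod by simp
      finally show "f = g" .
    qed
    moreover have "monic eff (Id eff t)"
      unfolding monic_iff[OF assms id_t] app_Id[OF hom_objects(1)[OF id_t]]
      using eqv_sym eqv_trans hom_objects(1)[OF id_t] by blast
    moreover have "eff_comp p u \<in> hom eff t A" by (rule comp_hom[OF u p])
    moreover from this have "p \<odot>\<^bsub>eff\<^esub> u = eff_comp p u \<odot>\<^bsub>eff\<^esub> Id eff t"
      using category.id_right[OF cat] by (metis eff_simps(3))
    ultimately show ?thesis using e id_t u by blast
  next
    \<comment> \<open>The point \<epsilon> cannot come from \<open>X\<close> and is supplied by the
      support of \<open>A\<close>. Epicness of the identity and the final equation both hold because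
      parallel arrows out of \<open>X\<close> agree.\<close>
    case False
    then have pointless: "\<And>x. x \<in> fst X \<Longrightarrow> snd X (x, x) = {}" by blast
    obtain a where "a \<in> fst A" "snd A (a, a) \<noteq> {}" using well_supported_point[OF assms t b epi] by blast
    from point_exists[OF assms A this] obtain f where f: "f \<in> hom eff unit_object A" by metis
    have \<epsilon>: "eff_comp f j \<in> hom eff t A" by (rule comp_hom[OF j f])
    have "epic eff (Id eff X)"
      unfolding epic_def
    proof (intro conjI ballI impI)
      show "Id eff X \<in> Arr eff" using id_X unfolding hom_def by blast
      have cod: "Cod eff (Id eff X) = X" by simp
      fix z f g
      assume "f \<in> hom eff (Cod eff (Id eff X)) z" "g \<in> hom eff (Cod eff (Id eff X)) z"
      then show "f = g" unfolding cod by (intro pointless_initial[OF pointless])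
    qed
    moreover have "monic eff e"
      unfolding monic_iff[OF assms e]
    proof (intro allI impI)
      fix S x x' y
      assume "app S e x y" "app S e x' y"
      then have xx: "eqv S X x x" "eqv S X x' x'" by (blast intro: app_eqv1[OF e])+
      \<comment> \<open>A generic element of \<open>X\<close> forces its stage to be empty, so
        injectivity of \<open>e\<close> holds vacuously.\<close>
      then have "S = {}" using pointless forces_nonempty[of S "\<lambda>s. snd X (x s, x s)"] unfolding eqv_def by blast
      then show "eqv S X x x'" unfolding eqv_def by simp
    qed
    moreover have "p \<odot>\<^bsub>eff\<^esub> Id eff X = eff_comp f j \<odot>\<^bsub>eff\<^esub> e"
      unfolding eff_simps(3) by (rule pointless_initial[OF pointless comp_hom[OF id_X p] comp_hom[OF e \<epsilon>]])
    ultimately show ?thesis using e id_X \<epsilon> by blast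
  qed
qed

end
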